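(* (1) Let $H\le\Sigma_n$ be a $k$-transitive subgroup, let $r\ge1$, let $\mu_r$ be the group of $r$th roots of unity in $\mathbb{C}$, and let $G=\mu_r^n\rtimes H$, embedded in $\mathrm{GL}_n(\mathbb{C})$ via generalized permutation matrices. Then, modulo the $m_\tau$ with $|\tau|>k$ (that is, the coefficients of $m_\tau$ on the two sides agree for every partition $\tau$ with $|\tau|\le k$), $$\mathbb{E}[\mathrm{Exp}_\sigma(X_Gh_1)]\equiv\mathrm{Exp}_\sigma(h_r+h_{2r}+h_{3r}+\cdots).$$ (2) Let $G=W(D_n)\le\mathrm{GL}_n(\mathbb{C})$ be the Weyl group of the $D_n$ root system, or equivalently the group of generalized permutation matrices $W\rtimes\Sigma_n\le\mu_2^n\rtimes\Sigma_n$, where $W\le\mu_2^n$ is the subgroup of tuples whose product is $1$. Then, modulo the $m_\tau$ with $|\tau|>n$, $$\mathbb{E}[\mathrm{Exp}_\sigma(X_Gh_1)]\equiv\mathrm{Exp}_\sigma(h_2+h_4+h_6+\cdots)+h_n.$$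
   Context: $\Sigma_n$ is the symmetric group on $\{1,\ldots,n\}$. A subgroup $H\le\Sigma_n$ is $k$-transitive (with $k\le n$) if it acts transitively on ordered $k$-tuples of distinct elements of $\{1,\ldots,n\}$. The group $\mu_r^n\rtimes H$ (with $H$ permuting the coordinates of $\mu_r^n$) is embedded in $\mathrm{GL}_n(\mathbb{C})$ with $\mu_r^n$ acting as diagonal matrices and $H$ as permutation matrices. Partitions: a partition is a non-increasing sequence $\tau=(\tau_1,\tau_2,\ldots)$ of non-negative integers that is eventually zero; $|\tau|=\sum_i\tau_i$. Symmetric functions: $\Lambda=\varprojlim_n\mathbb{Z}[t_1,\ldots,t_n]^{\Sigma_n}$ (graded) is the ring of symmetric functions in $t_1,t_2,\ldots$; $h_i$ and $p_i$ are the $i$th complete and power sum symmetric functions; $h_\tau=h_{\tau_1}h_{\tau_2}\cdots$; $m_\tau$ is the monomial symmetric function, the sum of all distinct permutations of $t_1^{\tau_1}t_2^{\tau_2}\cdots$. For a ring $C$, $\Lambda_C^\wedge$ is the ring of symmetric power series in $t_1,t_2,\ldots$ over $C$, i.e. formal, possibly infinite, sums $\sum_\tau a_\tau m_\tau$ with $a_\tau\in C$. Plethystic exponential: for a symmetric power series $F$ with integer (or rational) coefficients and zero constant term, $p_i\circ F:=F(t_1^i,t_2^i,\ldots)$; $f\mapsto f\circ F$ extends to a ring homomorphism on $\Lambda_{\mathbb{Q}}=\mathbb{Q}[p_1,p_2,\ldots]$; and $\mathrm{Exp}_\sigma(F):=\sum_{k\ge0}h_k\circ F=\prod_{i\ge1}\exp\left(\frac1i\,p_i\circ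 F\right)$. $\sigma$-moment generating function of a finite matrix group: let $G\le\mathrm{GL}_N(\mathbb{C})$ be finite. $\mathbb{Z}[\mathbb{C}]$ is the ring of finite formal sums $\sum a_j[z_j]$ ($a_j\in\mathbb{Z}$, $z_j\in\mathbb{C}$) with $[z][w]=[zw]$, with $\lambda$-ring structure determined by $p_i\circ\sum a_j[z_j]=\sum a_j[z_j^i]$; functions $G\to\mathbb{Z}[\mathbb{C}]$ form a $\lambda$-ring pointwise, with expectation $\mathbb{E}[f]=\frac1{\#G}\sum_{g\in G}f(g)_1$, where $(\sum a_j[z_j])_1=\sum a_jz_j\in\mathbb{C}$. $X_G$ is the function sending $g$ to the formal sum of its eigenvalues with multiplicity. The $\sigma$-moment generating function is $\mathbb{E}[\mathrm{Exp}_\sigma(X_Gh_1)]=\sum_\tau\mathbb{E}[h_\tau\circ X_G]\,m_\tau\in\Lambda_{\mathbb{C}}^\wedge$; explicitly, $\mathbb{E}[h_\tau\circ X_G]$ is the average over $g\in G$ of the value of $h_\tau$ at the eigenvalues of $g$ (with multiplicity). *)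

theory Defs
  imports
    "HOL-Library.Poly_Mapping"
    "HOL-Algebra.Sym_Groups"
    "HOL-Algebra.Generated_Groups"
    "Jordan_Normal_Form.Char_Poly"
begin

section \<open>Power series in countably many variables\<close>

text \<open>
  A monomial in the variables \<open>t\<^sub>1, t\<^sub>2, \<dots>\<close> is its exponent sequence. Sequences are
  indexed from \<open>0\<close>, so \<open>lookup \<alpha> j\<close> is the exponent of \<open>t\<^sub>j\<^sub>+\<^sub>1\<close>.
  The rings of symmetric functions and of symmetric power series over \<open>'a\<close> are subrings of the
  ring \<open>'a pser\<close> of all formal power series in these variables.
\<close>

type_synonym monom_exp = "nat \<Rightarrow>\<^sub>0 nat"

typedef 'a pser = "UNIV :: (monom_exp \<Rightarrow> 'a) set"
  morphisms pcoeff Abs_pser ..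

lemma pcoeff_Abs [simp]: "pcoeff (Abs_pser f) = f"
  by (simp add: Abs_pser_inverse)

lemma pser_eqI: "(\<And>\<alpha>. pcoeff F \<alpha> = pcoeff G \<alpha>) \<Longrightarrow> F = G"
  by (metis pcoeff_inject ext)

lemma finite_monom_splits: "finite {(\<alpha>, \<beta>). \<alpha> + \<beta> = (\<gamma> :: monom_exp)}"
proof -
  let ?K = "Poly_Mapping.keys \<gamma>"
  let ?M = "Max (insert 0 (Poly_Mapping.lookup \<gamma> ` ?K))"
  let ?B = "{f. \<forall>x. (x \<in> ?K \<longrightarrow> f x \<in> {..?M}) \<and> (x \<notin> ?K \<longrightarrow> f x = (0::nat))}"
  let ?L = "Poly_Mapping.lookup -` ?B :: monom_exp set"
  have "finite ?B"
    by (rule finite_set_of_finite_funs) auto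
  moreover have "inj (Poly_Mapping.lookup :: monom_exp \<Rightarrow> _)"
    by (auto intro: injI poly_mapping_eqI)
  ultimately have L: "finite ?L"
    by (rule finite_vimageI)
  have bnd: "\<delta> \<in> ?L" if le: "\<And>x. Poly_Mapping.lookup \<delta> x \<le> Poly_Mapping.lookup \<gamma> x" for \<delta>
  proof -
    have "Poly_Mapping.lookup \<delta> x \<le> ?M" if "x \<in> ?K" for x
      using le[of x] that by (intro order.trans[OF _ Max_ge]) auto
    moreover have "Poly_Mapping.lookup \<delta> x = 0" if "x \<notin> ?K" for x
      using le[of x] that by (simp add: in_keys_iff)
    ultimately show ?thesis
      by auto
  qed
  have "{(\<alpha>, \<beta>). \<alpha> + \<beta> = \<gamma>} \<subseteq> ?L \<times> ?L"
  proof (rule subrelI)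
    fix \<alpha> \<beta> assume "(\<alpha>, \<beta>) \<in> {(\<alpha>, \<beta>). \<alpha> + \<beta> = \<gamma>}"
    then have "\<gamma> = \<alpha> + \<beta>" by simp
    then show "(\<alpha>, \<beta>) \<in> ?L \<times> ?L"
      using bnd[of \<alpha>] bnd[of \<beta>] by (simp add: lookup_add)
  qed
  then show ?thesis
    using L by (meson finite_SigmaI finite_subset)
qed

instantiation pser :: (comm_ring_1) comm_ring_1
begin

definition "0 = Abs_pser (\<lambda>_. 0)"
definition "1 = Abs_pser (\<lambda>\<gamma>. if \<gamma> = 0 then 1 else 0)"
definition "F + G = Abs_pser (\<lambda>\<gamma>. pcoeff F \<gamma> + pcoeff G \<gamma>)"
definition "F - G = Abs_pser (\<lambda>\<gamma>. pcoeff F \<gamma> - pcoeff G \<gamma>)"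
definition "- F = Abs_pser (\<lambda>\<gamma>. - pcoeff F \<gamma>)"
definition "F * G =
  Abs_pser (\<lambda>\<gamma>. \<Sum>(\<alpha>, \<beta>) | \<alpha> + \<beta> = \<gamma>. pcoeff F \<alpha> * pcoeff G \<beta>)"

lemma pcoeff_0 [simp]: "pcoeff 0 \<gamma> = 0"
  and pcoeff_1: "pcoeff 1 \<gamma> = (if \<gamma> = 0 then 1 else 0)"
  and pcoeff_add [simp]: "pcoeff (F + G) \<gamma> = pcoeff F \<gamma> + pcoeff G \<gamma>"
  and pcoeff_diff [simp]: "pcoeff (F - G) \<gamma> = pcoeff F \<gamma> - pcoeff G \<gamma>"
  and pcoeff_uminus [simp]: "pcoeff (- F) \<gamma> = - pcoeff F \<gamma>"
  and pcoeff_mult: "pcoeff (F * G) \<gamma> =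
    (\<Sum>(\<alpha>, \<beta>) | \<alpha> + \<beta> = \<gamma>. pcoeff F \<alpha> * pcoeff G \<beta>)"
  by (simp_all add: zero_pser_def one_pser_def plus_pser_def minus_pser_def uminus_pser_def
      times_pser_def)

instance
proof
  fix F G H :: "'a pser"
  show "F * G * H = F * (G * H)"
  proof (rule pser_eqI)
    fix \<gamma>
    have "pcoeff (F * G * H) \<gamma> =
      (\<Sum>u\<in>{(\<delta>, \<epsilon>). \<delta> + \<epsilon> = \<gamma>}. \<Sum>v\<in>{(\<alpha>, \<beta>). \<alpha> + \<beta> = fst u}.
        pcoeff F (fst v) * pcoeff G (snd v) * pcoeff H (snd u))"
      by (simp add: pcoeff_mult sum_distrib_right case_prod_unfold)
    also have "\<dots> = (\<Sum>(u, v)\<in>(SIGMA u:{(\<delta>, \<epsilon>). \<delta> + \<epsilon> = \<gamma>}. {(\<alpha>, \<beta>). \<alpha> + \<beta> = fst u}).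
        pcoeff F (fst v) * pcoeff G (snd v) * pcoeff H (snd u))"
      by (rule sum.Sigma) (simp_all add: finite_monom_splits)
    also have "\<dots> = (\<Sum>(u, v)\<in>(SIGMA u:{(\<delta>, \<epsilon>). \<delta> + \<epsilon> = \<gamma>}. {(\<alpha>, \<beta>). \<alpha> + \<beta> = snd u}).
        pcoeff F (fst u) * (pcoeff G (fst v) * pcoeff H (snd v)))"
      by (rule sum.reindex_bij_witness
          [where i = "\<lambda>((a, x), (b, c)). ((a + b, c), (a, b))"
            and j = "\<lambda>((x, c), (a, b)). ((a, b + c), (b, c))"])
        (auto simp: add.assoc mult.assoc)
    also have "\<dots> =
      (\<Sum>u\<in>{(\<delta>, \<epsilon>). \<delta> + \<epsilon> = \<gamma>}. \<Sum>v\<in>{(\<alpha>, \<beta>). \<alpha> + \<beta> = snd u}.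
        pcoeff F (fst u) * (pcoeff G (fst v) * pcoeff H (snd v)))"
      by (rule sum.Sigma [symmetric]) (simp_all add: finite_monom_splits)
    also have "\<dots> = pcoeff (F * (G * H)) \<gamma>"
      by (simp add: pcoeff_mult sum_distrib_left case_prod_unfold)
    finally show "pcoeff (F * G * H) \<gamma> = pcoeff (F * (G * H)) \<gamma>" .
  qed
  show "F * G = G * F"
  proof (rule pser_eqI)
    fix \<gamma>
    show "pcoeff (F * G) \<gamma> = pcoeff (G * F) \<gamma>"
      unfolding pcoeff_mult
      by (rule sum.reindex_bij_witness[where i = prod.swap and j = prod.swap])
        (auto simp: add.commute mult.commute)
  qed
  show "1 * F = F"
  proof (rule pser_eqI)
    fix \<gamma>
    have "pcoeff (1 * F) \<gamma> =
      (\<Sum>u\<in>{(\<alpha>, \<beta>). \<alpha> + \<beta> = \<gamma>}. if u = (0, \<gamma>) then pcoeff F \<gamma> else 0)"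
      unfolding pcoeff_mult by (rule sum.cong) (auto simp: pcoeff_1 split: if_splits)
    also have "\<dots> = pcoeff F \<gamma>"
      by (simp add: finite_monom_splits)
    finally show "pcoeff (1 * F) \<gamma> = pcoeff F \<gamma>" .
  qed
  show "(F + G) * H = F * H + G * H"
    by (rule pser_eqI)
      (simp add: pcoeff_mult distrib_right case_prod_unfold sum.distrib)
  show "(0 :: 'a pser) \<noteq> 1"
    by (metis pcoeff_0 pcoeff_1 zero_neq_one)
qed (auto intro!: pser_eqI)

end

definition pconst :: "'a::zero \<Rightarrow> 'a pser" where
  "pconst c = Abs_pser (\<lambda>\<gamma>. if \<gamma> = 0 then c else 0)"

definition map_pser :: "('a \<Rightarrow> 'b) \<Rightarrow> 'a pser \<Rightarrow> 'b pser" where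
  "map_pser f F = Abs_pser (\<lambda>\<gamma>. f (pcoeff F \<gamma>))"

text \<open>
  Infinite formal sum, coefficient by coefficient. It is meant for families in which every
  monomial occurs in only finitely many members; a coefficient that receives infinitely many
  nonzero contributions is \<open>0\<close> by convention.
\<close>

definition psum :: "'i set \<Rightarrow> ('i \<Rightarrow> 'a::comm_monoid_add pser) \<Rightarrow> 'a pser" where
  "psum I F = Abs_pser (\<lambda>\<gamma>. \<Sum>i | i \<in> I \<and> pcoeff (F i) \<gamma> \<noteq> 0. pcoeff (F i) \<gamma>)"


section \<open>Symmetric functions\<close>

definition mdeg :: "monom_exp \<Rightarrow> nat" where
  "mdeg \<alpha> = (\<Sum>j\<in>Poly_Mapping.keys \<alpha>. Poly_Mapping.lookup \<alpha> j)"

text \<open>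
  A partition \<open>\<tau>\<close> is represented by the exponent sequence of \<open>t\<^sub>1\<^bsup>\<tau>\<^sub>1\<^esup> t\<^sub>2\<^bsup>\<tau>\<^sub>2\<^esup> \<cdots>\<close>, so \<open>|\<tau>|\<close> is
  \<open>mdeg \<tau>\<close>, and the coefficient of \<open>m\<^sub>\<tau>\<close> in a symmetric power series \<open>F\<close> is \<open>pcoeff F \<tau>\<close>.
\<close>

definition is_partition :: "monom_exp \<Rightarrow> bool" where
  "is_partition \<tau> \<longleftrightarrow> antimono (Poly_Mapping.lookup \<tau>)"

definition sym_h :: "nat \<Rightarrow> 'a::comm_ring_1 pser" where
  "sym_h i = Abs_pser (\<lambda>\<alpha>. if mdeg \<alpha> = i then 1 else 0)"

definition sym_p :: "nat \<Rightarrow> 'a::comm_ring_1 pser" where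
  "sym_p i = Abs_pser (\<lambda>\<alpha>. if \<exists>j. \<alpha> = Poly_Mapping.single j i then 1 else 0)"

definition sym_m :: "monom_exp \<Rightarrow> 'a::comm_ring_1 pser" where
  "sym_m \<tau> = Abs_pser (\<lambda>\<alpha>.
     if \<exists>\<pi>. bij \<pi> \<and> Poly_Mapping.lookup \<alpha> = Poly_Mapping.lookup \<tau> \<circ> \<pi> then 1 else 0)"

definition sym_h_part :: "monom_exp \<Rightarrow> 'a::comm_ring_1 pser" where
  "sym_h_part \<tau> = (\<Prod>j\<in>Poly_Mapping.keys \<tau>. sym_h (Poly_Mapping.lookup \<tau> j))"

text \<open>
  Equality modulo the \<open>m\<^sub>\<tau>\<close> with \<open>|\<tau>| > k\<close>.
\<close>

definition sym_cong :: "nat \<Rightarrow> 'a pser \<Rightarrow> 'a pser \<Rightarrow> bool" where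
  "sym_cong k F G \<longleftrightarrow>
     (\<forall>\<tau>. is_partition \<tau> \<and> mdeg \<tau> \<le> k \<longrightarrow> pcoeff F \<tau> = pcoeff G \<tau>)"


section \<open>Plethysm and the plethystic exponential\<close>

text \<open>
  \<open>adams i F\<close> is \<open>p\<^sub>i \<circ> F = F(t\<^sub>1\<^sup>i, t\<^sub>2\<^sup>i, \<dots>)\<close>, for \<open>i \<ge> 1\<close>.
\<close>

definition adams :: "nat \<Rightarrow> 'a::zero pser \<Rightarrow> 'a pser" where
  "adams i F = Abs_pser (\<lambda>\<alpha>.
     if \<forall>j. i dvd Poly_Mapping.lookup \<alpha> j
     then pcoeff F (Poly_Mapping.map (\<lambda>a. a div i) \<alpha>) else 0)"

text \<open>
  Evaluation of a polynomial over the rationals in the variables \<open>x\<^sub>0, x\<^sub>1, \<dots>\<close>, given as the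
  finitely supported map from its monomials to their coefficients.
\<close>

definition poly_eval :: "((nat \<Rightarrow>\<^sub>0 nat) \<Rightarrow>\<^sub>0 rat) \<Rightarrow> (nat \<Rightarrow> rat pser) \<Rightarrow> rat pser" where
  "poly_eval P x = (\<Sum>\<mu>\<in>Poly_Mapping.keys P. pconst (Poly_Mapping.lookup P \<mu>) *
     (\<Prod>i\<in>Poly_Mapping.keys \<mu>. x i ^ Poly_Mapping.lookup \<mu> i))"

text \<open>
  The power sums are algebraically independent and generate \<open>\<Lambda>\<^sub>\<rat>\<close>, so every \<open>f \<in> \<Lambda>\<^sub>\<rat>\<close> is
  \<open>P(p\<^sub>1, p\<^sub>2, \<dots>)\<close> for exactly one polynomial \<open>P\<close>. The ring homomorphism \<open>f \<mapsto> f \<circ> F\<close> sends it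
  to \<open>P(p\<^sub>1 \<circ> F, p\<^sub>2 \<circ> F, \<dots>)\<close>.
\<close>

definition pleth :: "rat pser \<Rightarrow> rat pser \<Rightarrow> rat pser" where
  "pleth f F = poly_eval (THE P. poly_eval P (\<lambda>i. sym_p (Suc i)) = f) (\<lambda>i. adams (Suc i) F)"

definition Exp_sigma :: "rat pser \<Rightarrow> rat pser" where
  "Exp_sigma F = psum UNIV (\<lambda>k. pleth (sym_h k) F)"


section \<open>The moment generating function of a finite matrix group\<close>

text \<open>
  The value of a symmetric function (of bounded degree) at \<open>t = (z\<^sub>1, \<dots>, z\<^sub>N, 0, 0, \<dots>)\<close>.
\<close>

definition sym_value :: "complex pser \<Rightarrow> complex list \<Rightarrow> complex" where
  "sym_value f zs =
     (\<Sum>\<alpha> | pcoeff f \<alpha> \<noteq> 0 \<and> Poly_Mapping.keys \<alpha> \<subseteq> {..<length zs}.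
        pcoeff f \<alpha> * (\<Prod>j\<in>Poly_Mapping.keys \<alpha>. zs ! j ^ Poly_Mapping.lookup \<alpha> j))"

text \<open>
  The eigenvalues with multiplicity, listed in an arbitrary order.
\<close>

definition eigenvalue_list :: "complex mat \<Rightarrow> complex list" where
  "eigenvalue_list A = (SOME zs. mset zs = proots (char_poly A))"

definition expectation :: "complex mat set \<Rightarrow> (complex mat \<Rightarrow> complex) \<Rightarrow> complex" where
  "expectation G f = (\<Sum>g\<in>G. f g) / of_nat (card G)"

definition sigma_mgf :: "complex mat set \<Rightarrow> complex pser" where
  "sigma_mgf G = psum {\<tau>. is_partition \<tau>} (\<lambda>\<tau>.
     pconst (expectation G (\<lambda>g. sym_value (sym_h_part \<tau>) (eigenvalue_list g))) * sym_m \<tau>)"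


section \<open>Groups\<close>

definition k_transitive :: "nat \<Rightarrow> nat \<Rightarrow> (nat \<Rightarrow> nat) set \<Rightarrow> bool" where
  "k_transitive n k H \<longleftrightarrow> k \<le> n \<and>
     (\<forall>xs ys. length xs = k \<and> distinct xs \<and> set xs \<subseteq> {1..n} \<and>
              length ys = k \<and> distinct ys \<and> set ys \<subseteq> {1..n} \<longrightarrow>
              (\<exists>\<sigma>\<in>H. map \<sigma> xs = ys))"

text \<open>
  \<open>\<Sigma>\<^sub>n\<close> acts on \<open>{1..n}\<close>, whereas rows and columns of matrices are numbered from \<open>0\<close>.
\<close>

definition perm_mat :: "nat \<Rightarrow> (nat \<Rightarrow> nat) \<Rightarrow> complex mat" where
  "perm_mat n \<sigma> = Matrix.mat n n (\<lambda>(i, j). if Suc i = \<sigma> (Suc j) then 1 else 0)"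

definition mu_tuples :: "nat \<Rightarrow> nat \<Rightarrow> (nat \<Rightarrow> complex) set" where
  "mu_tuples r n = {1..n} \<rightarrow>\<^sub>E {z. z ^ r = 1}"

text \<open>
  The image of \<open>T \<rtimes> H\<close> in \<open>GL\<^sub>n(\<complex>)\<close>, for \<open>T\<close> a subgroup of \<open>\<mu>\<^sub>r\<^sup>n\<close> stable under \<open>H \<le> \<Sigma>\<^sub>n\<close>.
  The embedding is injective, so the matrix group may be used in place of \<open>T \<rtimes> H\<close>.
\<close>

definition gen_perm_group ::
  "nat \<Rightarrow> (nat \<Rightarrow> complex) set \<Rightarrow> (nat \<Rightarrow> nat) set \<Rightarrow> complex mat set" where
  "gen_perm_group n T H = {mat_diag n (\<lambda>i. \<zeta> (Suc i)) * perm_mat n \<sigma> | \<zeta> \<sigma>. \<zeta> \<in> T \<and> \<sigma> \<in> H}"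

definition D_roots :: "nat \<Rightarrow> complex Matrix.vec set" where
  "D_roots n = {a \<cdot>\<^sub>v unit_vec n i + b \<cdot>\<^sub>v unit_vec n j | a b i j.
     a \<in> {1, -1} \<and> b \<in> {1, -1} \<and> i < j \<and> j < n}"

definition reflection_mat :: "nat \<Rightarrow> complex Matrix.vec \<Rightarrow> complex mat" where
  "reflection_mat n v = Matrix.mat n n (\<lambda>(i, j).
     (if i = j then 1 else 0) - 2 * v $ i * v $ j / (v \<bullet> v))"

definition GL :: "nat \<Rightarrow> complex mat monoid" where
  "GL n = units_of (ring_mat TYPE(complex) n ())"

definition weyl_D :: "nat \<Rightarrow> complex mat set" where
  "weyl_D n = generate (GL n) (reflection_mat n ` D_roots n)"

end

theory Submission
  imports Defs "Jordan_Normal_Form.Schur_Decomposition"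
begin

text \<open>
  Both sides count multisets of monomials. On the right, \<open>Exp\<^sub>\<sigma>\<close> of a sum of distinct nonconstant
  monomials has as coefficient at \<open>\<tau>\<close> the number of multisets of these monomials with product \<open>\<tau>\<close>;
  this follows from Newton's identities, which determine \<open>h\<^sub>k \<circ> F\<close> from the \<open>p\<^sub>i \<circ> F\<close>.

  On the left, for \<open>g = \<zeta>\<sigma>\<close> a second instance of Newton's identities, applied to the traces of the
  powers of \<open>g\<close>, writes \<open>h\<^sub>\<tau>\<close> of the eigenvalues as a sum over the maps \<open>F\<close> from \<open>{1..n}\<close> to monomials
  that are \<open>\<sigma>\<close>-invariant and have product \<open>\<tau>\<close>, weighted by \<open>\<Prod>\<^sub>x \<zeta>\<^sub>x\<close> to the power \<open>deg F(x)\<close>.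
  Averaging over \<open>\<zeta>\<close> keeps the \<open>F\<close> on which all characters are trivial: all degrees divisible
  by \<open>r\<close> in part (1); all even or all odd in part (2). Averaging over \<open>\<sigma>\<close> counts orbits. As at most
  \<open>|\<tau>| \<le> k\<close> values of \<open>F\<close> are nontrivial, \<open>k\<close>-transitivity makes the orbits correspond to the
  multisets of nontrivial values. All degrees odd forces \<open>|\<tau>| = n\<close> and every value to be a
  variable, which gives the extra summand \<open>h\<^sub>n\<close>.
\<close>


section \<open>Monomials\<close>

text \<open>Newton's identities take the place of the cycle type and of a factored characteristic
  polynomial: over a field of characteristic zero they determine complete symmetric functions from
  power sums, and the power sums of eigenvalues are traces of powers, which for a generalized
  permutation matrix are sums over closed walks. The same device handles \<open>pleth\<close>, which
  is defined through the unique polynomial in the power sums: unfolding the recursion yields one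
  polynomial valid for all its solutions. At the variables it expresses \<open>sym_h k\<close>; at a
  set of monomials it gives the plethysm. Uniqueness amounts to the algebraic independence of the
  power sums.

  The maps F arise by transposing an array: h_\<tau> is a product over the variables j of sums over
  invariant exponent vectors on {1..n}, and one vector for each j gives an array of naturals whose
  rows are the monomials F(x). The bound on |\<tau>| enters twice: it confines the nontrivial values
  of F to k points, and it leaves enough points to hold any multiset of nontrivial factors of
  \<tau>.\<close>

lemma mdeg_superset:
  assumes "finite X" "Poly_Mapping.keys \<alpha> \<subseteq> X"
  shows "mdeg \<alpha> = (\<Sum>x\<in>X. Poly_Mapping.lookup \<alpha> x)"
  unfolding mdeg_def using assms
  by (intro sum.mono_neutral_left) (auto simp: in_keys_iff)

lemma keys_add_nat: "Poly_Mapping.keys (\<alpha> + \<beta> :: monom_exp) = Poly_Mapping.keys \<alpha> \<union> Poly_Mapping.keys \<beta>"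
  by (auto simp: in_keys_iff lookup_add)

lemma mdeg_add [simp]: "mdeg (\<alpha> + \<beta>) = mdeg \<alpha> + mdeg \<beta>"
proof -
  let ?X = "Poly_Mapping.keys \<alpha> \<union> Poly_Mapping.keys \<beta>"
  show ?thesis
    using mdeg_superset[of ?X \<alpha>] mdeg_superset[of ?X \<beta>] mdeg_superset[of ?X "\<alpha> + \<beta>"]
    by (simp add: keys_add_nat lookup_add sum.distrib)
qed

lemma mdeg_0 [simp]: "mdeg 0 = 0"
  by (simp add: mdeg_def)

lemma mdeg_single [simp]: "mdeg (Poly_Mapping.single x i) = i"
  by (simp add: mdeg_def)

lemma mdeg_eq_0_iff [simp]: "mdeg \<alpha> = 0 \<longleftrightarrow> \<alpha> = 0"
  by (auto simp: mdeg_def in_keys_iff intro: poly_mapping_eqI)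

lemma mdeg_sum: "mdeg (\<Sum>i\<in>I. f i) = (\<Sum>i\<in>I. mdeg (f i))"
  by (induction I rule: infinite_finite_induct) auto

lemma lookup_le_mdeg: "Poly_Mapping.lookup \<alpha> x \<le> mdeg \<alpha>"
proof (cases "x \<in> Poly_Mapping.keys \<alpha>")
  case True
  then show ?thesis unfolding mdeg_def by (intro member_le_sum) auto
qed (simp add: in_keys_iff)

lemma monom_minus_add:
  assumes "\<And>x. Poly_Mapping.lookup \<beta> x \<le> Poly_Mapping.lookup \<alpha> x"
  shows "(\<alpha> - \<beta>) + \<beta> = (\<alpha> :: monom_exp)"
  by (rule poly_mapping_eqI) (use assms in \<open>simp add: lookup_add lookup_minus\<close>)

text \<open>Evaluation of a monomial at a point. The codomain is a general commutative monoid
  because points are complex tuples in the eigenvalue sums and tuples of power series in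
  \<open>poly_eval\<close>.\<close>

definition mweight :: "(nat \<Rightarrow> 'a::comm_monoid_mult) \<Rightarrow> monom_exp \<Rightarrow> 'a" where
  "mweight \<zeta> \<alpha> = (\<Prod>x\<in>Poly_Mapping.keys \<alpha>. \<zeta> x ^ Poly_Mapping.lookup \<alpha> x)"

lemma mweight_superset:
  assumes "finite X" "Poly_Mapping.keys \<alpha> \<subseteq> X"
  shows "mweight \<zeta> \<alpha> = (\<Prod>x\<in>X. \<zeta> x ^ Poly_Mapping.lookup \<alpha> x)"
  unfolding mweight_def using assms
  by (intro prod.mono_neutral_left) (auto simp: in_keys_iff)

lemma mweight_add: "mweight \<zeta> (\<alpha> + \<beta>) = mweight \<zeta> \<alpha> * mweight \<zeta> \<beta>"
proof -
  let ?X = "Poly_Mapping.keys \<alpha> \<union> Poly_Mapping.keys \<beta>"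
  show ?thesis
    using mweight_superset[of ?X \<alpha> \<zeta>] mweight_superset[of ?X \<beta> \<zeta>] mweight_superset[of ?X "\<alpha> + \<beta>" \<zeta>]
    by (simp add: keys_add_nat lookup_add prod.distrib power_add)
qed

lemma mweight_0 [simp]: "mweight \<zeta> 0 = 1"
  by (simp add: mweight_def)

lemma mweight_single [simp]: "mweight \<zeta> (Poly_Mapping.single x i) = \<zeta> x ^ i"
  by (simp add: mweight_def)

lemma mweight_sum: "mweight \<zeta> (\<Sum>i\<in>I. f i) = (\<Prod>i\<in>I. mweight \<zeta> (f i))"
  by (induction I rule: infinite_finite_induct) (auto simp: mweight_add)

lemma finite_bounded_monoms:
  assumes "finite X"
  shows "finite {\<alpha> :: monom_exp. Poly_Mapping.keys \<alpha> \<subseteq> X \<and> mdeg \<alpha> \<le> m}"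
proof -
  let ?B = "{f. \<forall>x. (x \<in> X \<longrightarrow> f x \<in> {..m}) \<and> (x \<notin> X \<longrightarrow> f x = (0::nat))}"
  have "finite ?B"
    using assms by (intro finite_set_of_finite_funs) auto
  moreover have "inj (Poly_Mapping.lookup :: monom_exp \<Rightarrow> _)"
    by (auto intro: injI poly_mapping_eqI)
  ultimately have "finite (Poly_Mapping.lookup -` ?B :: monom_exp set)"
    by (rule finite_vimageI)
  then show ?thesis
    by (rule rev_finite_subset)
      (auto simp: subset_iff in_keys_iff intro: order.trans[OF lookup_le_mdeg])
qed


section \<open>Newton's identity for a permutation with weights\<close>

text \<open>These exponent vectors live on the points of \<open>X\<close>, not on the variables t.
  When \<sigma> permutes \<open>X\<close>, an invariant vector assigns one multiplicity to each
  cycle.\<close>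

definition inv_exps :: "nat set \<Rightarrow> (nat \<Rightarrow> nat) \<Rightarrow> nat \<Rightarrow> monom_exp set" where
  "inv_exps X \<sigma> m = {\<alpha>. Poly_Mapping.keys \<alpha> \<subseteq> X \<and>
     (\<forall>x. Poly_Mapping.lookup \<alpha> (\<sigma> x) = Poly_Mapping.lookup \<alpha> x) \<and> mdeg \<alpha> = m}"

text \<open>When \<sigma> permutes \<open>X\<close>, this is the coefficient of u^m in the product
  over the cycles c of 1 / (1 - \<zeta>(c) u^|c|), with \<zeta>(c) the product of \<zeta> along c.
  It is thus h_m of the eigenvalues of the weighted permutation matrix; for the identity it is h_m
  of the weights.\<close>

definition inv_sum :: "nat set \<Rightarrow> (nat \<Rightarrow> nat) \<Rightarrow> (nat \<Rightarrow> 'a::comm_ring_1) \<Rightarrow> nat \<Rightarrow> 'a" where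
  "inv_sum X \<sigma> \<zeta> m = (\<Sum>\<alpha>\<in>inv_exps X \<sigma> m. mweight \<zeta> \<alpha>)"

text \<open>The trace of the i-th power of the same matrix (\<open>mtrace_gen_perm_mat_pow\<close>):
  a point contributes when \<open>i\<close> steps lead back to it.\<close>

definition per_sum :: "nat set \<Rightarrow> (nat \<Rightarrow> nat) \<Rightarrow> (nat \<Rightarrow> 'a::comm_ring_1) \<Rightarrow> nat \<Rightarrow> 'a" where
  "per_sum X \<sigma> \<zeta> i = (\<Sum>x | x \<in> X \<and> (\<sigma> ^^ i) x = x. \<Prod>l<i. \<zeta> ((\<sigma> ^^ l) x))"

definition trail :: "(nat \<Rightarrow> nat) \<Rightarrow> nat \<Rightarrow> nat \<Rightarrow> monom_exp" where
  "trail \<sigma> x i = (\<Sum>l<i. Poly_Mapping.single ((\<sigma> ^^ l) x) 1)"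

lemma finite_inv_exps: "finite X \<Longrightarrow> finite (inv_exps X \<sigma> m)"
  by (rule finite_subset[OF _ finite_bounded_monoms[of X m]]) (auto simp: inv_exps_def)

lemma mdeg_trail [simp]: "mdeg (trail \<sigma> x i) = i"
  by (simp add: trail_def mdeg_sum)

lemma mweight_trail: "mweight \<zeta> (trail \<sigma> x i) = (\<Prod>l<i. \<zeta> ((\<sigma> ^^ l) x))"
  by (simp add: trail_def mweight_sum)

lemma lookup_trail: "Poly_Mapping.lookup (trail \<sigma> x i) y = card {l. l < i \<and> (\<sigma> ^^ l) x = y}"
proof -
  have "Poly_Mapping.lookup (trail \<sigma> x i) y = (\<Sum>l<i. if (\<sigma> ^^ l) x = y then 1 else 0)"
    by (simp add: trail_def lookup_sum lookup_single when_def del: One_nat_def)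
  also have "\<dots> = card {l. l < i \<and> (\<sigma> ^^ l) x = y}"
    by (simp add: sum.If_cases Int_def)
  finally show ?thesis .
qed

text \<open>A closed trail may be started one step later without changing its visits, and shifting
  it by \<sigma> does exactly this.\<close>

lemma lookup_trail_perm:
  assumes "inj \<sigma>" "(\<sigma> ^^ i) x = x"
  shows "Poly_Mapping.lookup (trail \<sigma> x i) (\<sigma> y) = Poly_Mapping.lookup (trail \<sigma> x i) y"
proof -
  have "trail \<sigma> x i = (\<Sum>l<i. Poly_Mapping.single ((\<sigma> ^^ Suc l) x) 1)"
  proof (cases i)
    case (Suc j)
    have "trail \<sigma> x i = Poly_Mapping.single x 1 + (\<Sum>l<j. Poly_Mapping.single ((\<sigma> ^^ Suc l) x) 1)"
      unfolding trail_def Suc by (subst sum.lessThan_Suc_shift) simp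
    also have "\<dots> = (\<Sum>l<i. Poly_Mapping.single ((\<sigma> ^^ Suc l) x) 1)"
      using assms(2) by (simp add: Suc add.commute)
    finally show ?thesis .
  qed (simp add: trail_def)
  then have "Poly_Mapping.lookup (trail \<sigma> x i) (\<sigma> y) =
      (\<Sum>l<i. if \<sigma> ((\<sigma> ^^ l) x) = \<sigma> y then 1 else 0)"
    by (simp add: lookup_sum lookup_single when_def del: One_nat_def)
  also have "\<dots> = (\<Sum>l<i. if (\<sigma> ^^ l) x = y then 1 else 0)"
    using assms(1) by (simp add: inj_eq)
  also have "\<dots> = Poly_Mapping.lookup (trail \<sigma> x i) y"
    by (simp add: trail_def lookup_sum lookup_single when_def del: One_nat_def)
  finally show ?thesis .
qed

lemma lookup_funpow_invariant:
  assumes "\<And>y. Poly_Mapping.lookup \<alpha> (\<sigma> y) = Poly_Mapping.lookup \<alpha> y"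
  shows "Poly_Mapping.lookup \<alpha> ((\<sigma> ^^ l) x) = Poly_Mapping.lookup \<alpha> x"
  by (induction l) (simp_all add: assms)

text \<open>The return times to \<open>x\<close> are the multiples of its cycle length, and
  \<open>q\<close> of them lie below \<open>q\<close> times that length.\<close>

lemma lookup_trail_self:
  assumes "permutation \<sigma>"
  shows "Poly_Mapping.lookup (trail \<sigma> x (q * least_power \<sigma> x)) x = q"
proof -
  let ?p = "least_power \<sigma> x"
  have p: "?p > 0"
    using assms by (rule least_power_of_permutation)
  have "{l. l < q * ?p \<and> (\<sigma> ^^ l) x = x} = (\<lambda>t. t * ?p) ` {..<q}"
    using p by (auto simp: least_power_dvd[OF assms, symmetric] dvd_def image_iff mult.commute)
  also have "card \<dots> = q"
    using p by (subst card_image) (auto simp: inj_on_def)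
  finally show ?thesis
    by (simp add: lookup_trail)
qed

lemma sum_Sigma3:
  assumes "finite A" "\<And>a. a \<in> A \<Longrightarrow> finite (B a)" "\<And>a b. a \<in> A \<Longrightarrow> b \<in> B a \<Longrightarrow> finite (C a b)"
  shows "(\<Sum>a\<in>A. \<Sum>b\<in>B a. \<Sum>c\<in>C a b. f a b c) =
    (\<Sum>(a, b, c)\<in>(SIGMA a:A. SIGMA b:B a. C a b). f a b c)"
proof -
  have "(\<Sum>a\<in>A. \<Sum>b\<in>B a. \<Sum>c\<in>C a b. f a b c) =
      (\<Sum>a\<in>A. \<Sum>(b, c)\<in>(SIGMA b:B a. C a b). f a b c)"
    using assms by (intro sum.cong sum.Sigma) auto
  also have "\<dots> = (\<Sum>(a, b, c)\<in>(SIGMA a:A. SIGMA b:B a. C a b). f a b c)"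
    using assms by (intro sum.Sigma) auto
  finally show ?thesis .
qed

text \<open>
  Expanding \<open>m = deg \<alpha>\<close> as the number of pairs \<open>(x, q)\<close> with \<open>1 \<le> q \<le> \<alpha> x\<close>, a triple \<open>(\<alpha>, x, q)\<close>
  corresponds to the splitting of \<open>\<alpha>\<close> into the closed trail that runs \<open>q\<close> times around the cycle of
  \<open>x\<close> and an invariant rest. With \<open>\<sigma>\<close> the identity this is the classical identity.
\<close>

lemma newton_inv_sum:
  assumes X: "finite X" and \<sigma>: "\<sigma> permutes X"
  shows "of_nat m * inv_sum X \<sigma> \<zeta> m = (\<Sum>i\<in>{1..m}. per_sum X \<sigma> \<zeta> i * inv_sum X \<sigma> \<zeta> (m - i))"
proof -
  let ?L = Poly_Mapping.lookup
  let ?p = "least_power \<sigma>"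
  have perm: "permutation \<sigma>"
    using assms by (auto simp: permutation_permutes)
  have inj: "inj \<sigma>"
    using \<sigma> by (rule permutes_inj)
  have ppos: "?p x > 0" and pfix: "(\<sigma> ^^ (q * ?p x)) x = x" for x q
    using least_power_of_permutation(2)[OF perm] least_power_dvd[OF perm, of x "q * ?p x"] by auto
  have keys_trail: "Poly_Mapping.keys (trail \<sigma> x i) \<subseteq> X" if "x \<in> X" for x i
  proof
    fix y assume "y \<in> Poly_Mapping.keys (trail \<sigma> x i)"
    then have "card {l. l < i \<and> (\<sigma> ^^ l) x = y} \<noteq> 0"
      by (simp add: in_keys_iff lookup_trail)
    then obtain l where "y = (\<sigma> ^^ l) x"
      by (metis (mono_tags, lifting) Collect_empty_eq card.empty)
    moreover have "(\<sigma> ^^ l) x \<in> X"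
      using that by (induction l) (simp_all add: permutes_in_image[OF \<sigma>])
    ultimately show "y \<in> X" by simp
  qed
  \<comment> \<open>On the orbit of \<open>x\<close> both sides are constant, with values
    \<open>q\<close> and \<open>?L \<alpha> x\<close>; off the orbit the left side is 0.\<close>
  have trail_le: "?L (trail \<sigma> x (q * ?p x)) y \<le> ?L \<alpha> y"
    if "q \<le> ?L \<alpha> x" "\<And>y. ?L \<alpha> (\<sigma> y) = ?L \<alpha> y" for x q \<alpha> y
  proof (cases "\<exists>l. y = (\<sigma> ^^ l) x")
    case True
    then obtain l where y: "y = (\<sigma> ^^ l) x" by blast
    have "?L (trail \<sigma> x (q * ?p x)) y = q"
      unfolding y by (subst lookup_funpow_invariant)
        (simp_all add: lookup_trail_perm inj pfix lookup_trail_self perm)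
    moreover have "?L \<alpha> y = ?L \<alpha> x"
      unfolding y using that(2) by (rule lookup_funpow_invariant)
    ultimately show ?thesis using that by simp
  next
    case False
    then have "{l. l < q * ?p x \<and> (\<sigma> ^^ l) x = y} = {}" by blast
    then show ?thesis by (simp only: lookup_trail) simp
  qed
  let ?I = "SIGMA \<alpha>:inv_exps X \<sigma> m. SIGMA x:X. {1..?L \<alpha> x}"
  let ?J = "SIGMA i:{1..m}. {x \<in> X. (\<sigma> ^^ i) x = x} \<times> inv_exps X \<sigma> (m - i)"
  have "of_nat m * inv_sum X \<sigma> \<zeta> m = (\<Sum>\<alpha>\<in>inv_exps X \<sigma> m. \<Sum>x\<in>X. \<Sum>q\<in>{1..?L \<alpha> x}. mweight \<zeta> \<alpha>)"
    unfolding inv_sum_def sum_distrib_left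
  proof (rule sum.cong)
    fix \<alpha> assume "\<alpha> \<in> inv_exps X \<sigma> m"
    then have "m = (\<Sum>x\<in>X. ?L \<alpha> x)"
      using mdeg_superset[OF X, of \<alpha>] by (simp add: inv_exps_def)
    then have "of_nat m * mweight \<zeta> \<alpha> = of_nat (\<Sum>x\<in>X. ?L \<alpha> x) * mweight \<zeta> \<alpha>" by simp
    then show "of_nat m * mweight \<zeta> \<alpha> = (\<Sum>x\<in>X. \<Sum>q\<in>{1..?L \<alpha> x}. mweight \<zeta> \<alpha>)"
      by (simp add: sum_distrib_right)
  qed simp
  also have "\<dots> = (\<Sum>(\<alpha>, x, q)\<in>?I. mweight \<zeta> \<alpha>)"
    using X by (intro sum_Sigma3) (auto intro: finite_inv_exps)
  also have "\<dots> = (\<Sum>(i, x, \<beta>)\<in>?J. (\<Prod>l<i. \<zeta> ((\<sigma> ^^ l) x)) * mweight \<zeta> \<beta>)"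
  proof (rule sum.reindex_bij_witness
      [where i = "\<lambda>(i, x, \<beta>). (\<beta> + trail \<sigma> x i, x, i div ?p x)"
        and j = "\<lambda>(\<alpha>, x, q). (q * ?p x, x, \<alpha> - trail \<sigma> x (q * ?p x))"], goal_cases)
    case (1 a)
    then obtain \<alpha> x q where a: "a = (\<alpha>, x, q)" and *: "\<alpha> \<in> inv_exps X \<sigma> m" "x \<in> X" "1 \<le> q" "q \<le> ?L \<alpha> x"
      by (cases a) auto
    then show ?case
      using ppos[of x] by (auto simp: a inv_exps_def intro!: monom_minus_add trail_le)
  next
    case (2 a)
    then obtain \<alpha> x q where a: "a = (\<alpha>, x, q)" and *: "\<alpha> \<in> inv_exps X \<sigma> m" "x \<in> X" "1 \<le> q" "q \<le> ?L \<alpha> x"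
      by (cases a) auto
    let ?t = "trail \<sigma> x (q * ?p x)"
    have split: "\<alpha> = (\<alpha> - ?t) + ?t"
      by (rule monom_minus_add [symmetric]) (use * in \<open>auto simp: inv_exps_def intro!: trail_le\<close>)
    then have deg: "m = mdeg (\<alpha> - ?t) + q * ?p x"
      using *(1) by (metis (mono_tags, lifting) inv_exps_def mdeg_add mdeg_trail mem_Collect_eq)
    have "?L (\<alpha> - ?t) (\<sigma> y) = ?L (\<alpha> - ?t) y" for y
      using *(1) by (simp add: lookup_minus inv_exps_def lookup_trail_perm inj pfix)
    moreover have "Poly_Mapping.keys (\<alpha> - ?t) \<subseteq> X"
      using *(1) by (auto simp: inv_exps_def in_keys_iff lookup_minus subset_iff)
    ultimately show ?case
      using deg * ppos[of x] pfix[of q x] by (auto simp: a inv_exps_def)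
  next
    case (3 b)
    then obtain i x \<beta> where b: "b = (i, x, \<beta>)" and *: "1 \<le> i" "i \<le> m" "x \<in> X" "(\<sigma> ^^ i) x = x"
        "\<beta> \<in> inv_exps X \<sigma> (m - i)"
      by (cases b) auto
    \<comment> \<open>A return after \<open>i\<close> steps makes \<open>i\<close> a multiple of the
      cycle length, so multiplying the quotient \<open>i div ?p x\<close> back loses
      nothing.\<close>
    have "?p x dvd i"
      using *(4) by (rule least_power_minimal)
    then show ?case by (simp add: b)
  next
    case (4 b)
    then obtain i x \<beta> where b: "b = (i, x, \<beta>)" and *: "1 \<le> i" "i \<le> m" "x \<in> X" "(\<sigma> ^^ i) x = x"
        "\<beta> \<in> inv_exps X \<sigma> (m - i)"
      by (cases b) auto
    have dvd: "?p x dvd i"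
      using *(4) by (rule least_power_minimal)
    then have "?L (trail \<sigma> x i) x = i div ?p x"
      using lookup_trail_self[OF perm, of x "i div ?p x"] by simp
    moreover have "i div ?p x \<ge> 1"
      using dvd *(1) ppos[of x] by (auto elim!: dvdE)
    ultimately show ?case
      using * keys_trail[OF *(3), of i]
      by (auto simp: b inv_exps_def keys_add_nat lookup_add lookup_trail_perm inj)
  next
    case (5 a)
    then obtain \<alpha> x q where a: "a = (\<alpha>, x, q)" and *: "\<alpha> \<in> inv_exps X \<sigma> m" "x \<in> X" "1 \<le> q" "q \<le> ?L \<alpha> x"
      by (cases a) auto
    have "\<alpha> = (\<alpha> - trail \<sigma> x (q * ?p x)) + trail \<sigma> x (q * ?p x)"
      by (rule monom_minus_add [symmetric]) (use * in \<open>auto simp: inv_exps_def intro!: trail_le\<close>)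
    then show ?case
      by (simp add: a mweight_trail [symmetric]) (metis mult.commute mweight_add)
  qed
  also have "\<dots> = (\<Sum>i\<in>{1..m}. \<Sum>x | x \<in> X \<and> (\<sigma> ^^ i) x = x. \<Sum>\<beta>\<in>inv_exps X \<sigma> (m - i).
      (\<Prod>l<i. \<zeta> ((\<sigma> ^^ l) x)) * mweight \<zeta> \<beta>)"
    using X by (intro sum_Sigma3 [symmetric]) (auto intro: finite_inv_exps)
  also have "\<dots> = (\<Sum>i\<in>{1..m}. per_sum X \<sigma> \<zeta> i * inv_sum X \<sigma> \<zeta> (m - i))"
    by (simp add: per_sum_def inv_sum_def sum_product)
  finally show ?thesis .
qed

lemma inv_exps_0: "inv_exps X \<sigma> 0 = {0}"
  by (auto simp: inv_exps_def)

lemma inv_sum_cong_per_sum: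
  fixes \<zeta> \<xi> :: "nat \<Rightarrow> 'a::field_char_0"
  assumes "finite X" "\<sigma> permutes X" "finite Y" "\<rho> permutes Y"
    and eq: "\<And>i. i \<ge> 1 \<Longrightarrow> per_sum X \<sigma> \<zeta> i = per_sum Y \<rho> \<xi> i"
  shows "inv_sum X \<sigma> \<zeta> m = inv_sum Y \<rho> \<xi> m"
proof (induction m rule: less_induct)
  case (less m)
  show ?case
  proof (cases "m = 0")
    case True
    then show ?thesis by (simp add: inv_sum_def inv_exps_0)
  next
    case False
    have "of_nat m * inv_sum X \<sigma> \<zeta> m = of_nat m * inv_sum Y \<rho> \<xi> m"
      unfolding newton_inv_sum[OF assms(1,2)] newton_inv_sum[OF assms(3,4)]
      using False by (intro sum.cong) (auto simp: eq less.IH)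
    then show ?thesis using False by simp
  qed
qed


section \<open>Polynomials in the power sums\<close>

lemma pcoeff_sum: "pcoeff (\<Sum>i\<in>I. F i) \<gamma> = (\<Sum>i\<in>I. pcoeff (F i) \<gamma>)"
  by (induction I rule: infinite_finite_induct) auto

lemma pcoeff_pconst: "pcoeff (pconst c) \<gamma> = (if \<gamma> = 0 then c else 0)"
  by (simp add: pconst_def)

lemma pcoeff_pconst_mult: "pcoeff (pconst c * F) \<gamma> = c * pcoeff F \<gamma>"
proof -
  have "pcoeff (pconst c * F) \<gamma> =
      (\<Sum>u\<in>{(\<alpha>, \<beta>). \<alpha> + \<beta> = \<gamma>}. if u = (0, \<gamma>) then c * pcoeff F \<gamma> else 0)"
    unfolding pcoeff_mult by (rule sum.cong) (auto simp: pcoeff_pconst split: if_splits)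
  also have "\<dots> = c * pcoeff F \<gamma>"
    by (simp add: finite_monom_splits)
  finally show ?thesis .
qed

lemma pconst_0 [simp]: "pconst 0 = 0"
  by (rule pser_eqI) (simp add: pcoeff_pconst)

lemma pconst_1 [simp]: "pconst 1 = 1"
  by (rule pser_eqI) (simp add: pcoeff_pconst pcoeff_1)

lemma pconst_add: "pconst (a + b) = pconst a + pconst b"
  by (rule pser_eqI) (simp add: pcoeff_pconst)

lemma pconst_mult: "pconst (a * b) = pconst a * pconst b"
  by (rule pser_eqI) (simp add: pcoeff_pconst pcoeff_pconst_mult)

lemma of_nat_pser: "of_nat n = pconst (of_nat n)"
  by (induction n) (simp_all add: pconst_add)

lemma poly_eval_superset:
  assumes "finite A" "Poly_Mapping.keys P \<subseteq> A"
  shows "poly_eval P x = (\<Sum>\<mu>\<in>A. pconst (Poly_Mapping.lookup P \<mu>) * mweight x \<mu>)"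
  unfolding poly_eval_def mweight_def using assms
  by (intro sum.mono_neutral_left) (auto simp: in_keys_iff)

lemma poly_eval_add: "poly_eval (P + Q) x = poly_eval P x + poly_eval Q x"
proof -
  let ?A = "Poly_Mapping.keys P \<union> Poly_Mapping.keys Q"
  have "Poly_Mapping.keys (P + Q) \<subseteq> ?A"
    by (rule keys_add)
  then show ?thesis
    using poly_eval_superset[of ?A P x] poly_eval_superset[of ?A Q x] poly_eval_superset[of ?A "P + Q" x]
    by (simp add: lookup_add pconst_add distrib_right sum.distrib)
qed

lemma poly_eval_0 [simp]: "poly_eval 0 x = 0"
  by (simp add: poly_eval_def)

lemma poly_eval_sum: "poly_eval (\<Sum>i\<in>I. P i) x = (\<Sum>i\<in>I. poly_eval (P i) x)"
  by (induction I rule: infinite_finite_induct) (auto simp: poly_eval_add)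

lemma poly_eval_single: "poly_eval (Poly_Mapping.single \<mu> c) x = pconst c * mweight x \<mu>"
  using poly_eval_superset[of "{\<mu>}" "Poly_Mapping.single \<mu> c" x] by simp

lemma poly_mapping_as_sum:
  "P = (\<Sum>\<nu>\<in>Poly_Mapping.keys P. Poly_Mapping.single \<nu> (Poly_Mapping.lookup P \<nu>))"
  by (rule poly_mapping_eqI) (auto simp: lookup_sum lookup_single when_def in_keys_iff)

lemma poly_eval_single_mult:
  "poly_eval (Poly_Mapping.single \<mu> c * P) x = pconst c * mweight x \<mu> * poly_eval P x"
proof -
  have "Poly_Mapping.single \<mu> c * P = (\<Sum>\<nu>\<in>Poly_Mapping.keys P.
      Poly_Mapping.single (\<mu> + \<nu>) (c * Poly_Mapping.lookup P \<nu>))"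
    using arg_cong[OF poly_mapping_as_sum[of P], of "(*) (Poly_Mapping.single \<mu> c)"]
    by (simp only: sum_distrib_left mult_single)
  then show ?thesis
    by (simp add: poly_eval_sum poly_eval_single pconst_mult mweight_add poly_eval_superset[of "Poly_Mapping.keys P" P]
        sum_distrib_left mult_ac)
qed

text \<open>Dividing the recursion by \<open>k\<close> expresses \<open>E k\<close> through earlier
  values. The polynomial comes before \<open>x\<close> and \<open>E\<close> in the quantifiers, so
  that \<open>pleth_sym_h\<close> can use the same one for two solutions. The shift
  \<open>i - 1\<close> matches the numbering of the power sums by \<open>Suc\<close>.\<close>

lemma newton_poly_exists:
  "\<exists>P. \<forall>(x :: nat \<Rightarrow> rat pser) E. E 0 = 1 \<and> (\<forall>m. of_nat m * E m = (\<Sum>i\<in>{1..m}. x (i - 1) * E (m - i)))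
     \<longrightarrow> poly_eval P x = E k"
proof (induction k rule: less_induct)
  case (less k)
  show ?case
  proof (cases "k = 0")
    case True
    then show ?thesis
      by (intro exI[of _ "Poly_Mapping.single 0 1"]) (simp add: poly_eval_single del: single_one)
  next
    case False
    from less.IH obtain P where P: "\<And>j (x :: nat \<Rightarrow> rat pser) E. j < k \<Longrightarrow> E 0 = 1 \<Longrightarrow>
        (\<forall>m. of_nat m * E m = (\<Sum>i\<in>{1..m}. x (i - 1) * E (m - i))) \<Longrightarrow> poly_eval (P j) x = E j"
      by metis
    show ?thesis
    proof (intro exI allI impI)
      fix x :: "nat \<Rightarrow> rat pser" and E assume E: "E 0 = 1 \<and> (\<forall>m. of_nat m * E m = (\<Sum>i\<in>{1..m}. x (i - 1) * E (m - i)))"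
      have "poly_eval (\<Sum>i\<in>{1..k}. Poly_Mapping.single (Poly_Mapping.single (i - 1) 1) (1 / of_nat k) * P (k - i)) x
        = pconst (1 / of_nat k) * (\<Sum>i\<in>{1..k}. x (i - 1) * poly_eval (P (k - i)) x)"
        by (simp add: poly_eval_sum poly_eval_single_mult sum_distrib_left mult.assoc)
      also have "(\<Sum>i\<in>{1..k}. x (i - 1) * poly_eval (P (k - i)) x) = (\<Sum>i\<in>{1..k}. x (i - 1) * E (k - i))"
        using E by (intro sum.cong) (auto simp: P)
      also have "\<dots> = of_nat k * E k"
        using E by simp
      also have "pconst (1 / of_nat k) * \<dots> = pconst (1 / of_nat k * of_nat k) * E k"
        by (simp only: of_nat_pser pconst_mult mult.assoc)
      also have "\<dots> = E k"
        using False by simp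
      finally show "poly_eval (\<Sum>i\<in>{1..k}. Poly_Mapping.single (Poly_Mapping.single (i - 1) 1) (1 / of_nat k) * P (k - i)) x = E k" .
    qed
  qed
qed

section \<open>Algebraic independence of the power sums\<close>

lemma monom_induct [case_names zero add]:
  assumes "P 0" "\<And>\<nu> i. P \<nu> \<Longrightarrow> P (\<nu> + Poly_Mapping.single i 1)"
  shows "P (\<mu> :: monom_exp)"
proof (induction "mdeg \<mu>" arbitrary: \<mu>)
  case 0
  then show ?case using assms(1) by simp
next
  case (Suc m)
  then have "\<mu> \<noteq> 0" by auto
  then obtain i where i: "Poly_Mapping.lookup \<mu> i \<noteq> 0"
    by (metis lookup_zero poly_mapping_eqI)
  let ?s = "Poly_Mapping.single i 1 :: monom_exp"
  have eq: "(\<mu> - ?s) + ?s = \<mu>"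
    using i by (intro monom_minus_add) (auto simp: lookup_single when_def)
  then have "mdeg \<mu> = mdeg (\<mu> - ?s) + 1"
    by (metis mdeg_add mdeg_single)
  then show ?case
    using Suc assms(2)[of "\<mu> - ?s" i] eq by simp
qed

abbreviation psum_prod :: "monom_exp \<Rightarrow> rat pser" where
  "psum_prod \<equiv> mweight (\<lambda>i. sym_p (Suc i))"

lemma pcoeff_sym_p: "pcoeff (sym_p i) \<alpha> = (if \<exists>j. \<alpha> = Poly_Mapping.single j i then 1 else 0)"
  by (simp add: sym_p_def)

text \<open>Excludes cancellation: in \<open>psum_prod_witness\<close> a single summand of the
  convolution bounds the coefficient from below.\<close>

lemma psum_prod_nonneg: "pcoeff (psum_prod \<mu>) \<alpha> \<ge> 0"
proof (induction \<mu> arbitrary: \<alpha> rule: monom_induct)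
  case zero
  then show ?case by (simp add: pcoeff_1)
next
  case (add \<nu> i)
  then show ?case
    by (auto simp: mweight_add pcoeff_mult pcoeff_sym_p intro!: sum_nonneg)
qed

text \<open>
  Among the monomials of a product of power sums, those in the largest number of variables
  determine the factors. This is what makes the power sums algebraically independent.
\<close>

lemma psum_prod_support:
  assumes "pcoeff (psum_prod \<mu>) \<alpha> \<noteq> 0"
  shows "card (Poly_Mapping.keys \<alpha>) \<le> mdeg \<mu> \<and> (card (Poly_Mapping.keys \<alpha>) = mdeg \<mu> \<longrightarrow>
    (\<forall>i. Poly_Mapping.lookup \<mu> i = card {j. Poly_Mapping.lookup \<alpha> j = Suc i}))"
  using assms
proof (induction \<mu> arbitrary: \<alpha> rule: monom_induct)
  case zero
  then show ?case by (auto simp: pcoeff_1 split: if_splits)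
next
  case (add \<nu> i)
  then have "(\<Sum>(\<beta>, \<delta>) | \<beta> + \<delta> = \<alpha>. pcoeff (psum_prod \<nu>) \<beta> * pcoeff (sym_p (Suc i)) \<delta>) \<noteq> 0"
    by (simp add: mweight_add pcoeff_mult)
  then obtain \<beta> \<delta> where *: "\<beta> + \<delta> = \<alpha>" "pcoeff (psum_prod \<nu>) \<beta> \<noteq> 0" "pcoeff (sym_p (Suc i)) \<delta> \<noteq> (0::rat)"
    by (auto elim!: sum.not_neutral_contains_not_neutral)
  then obtain j where j: "\<delta> = Poly_Mapping.single j (Suc i)"
    by (auto simp: pcoeff_sym_p split: if_splits)
  note IH = add.IH[OF *(2)]
  have keys: "Poly_Mapping.keys \<alpha> = insert j (Poly_Mapping.keys \<beta>)"
    by (simp add: *(1) [symmetric] j keys_add_nat)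
  show ?case
  proof (cases "j \<in> Poly_Mapping.keys \<beta>")
    case True
    then show ?thesis using IH by (simp add: keys insert_absorb)
  next
    case False
    then have \<beta>j: "Poly_Mapping.lookup \<beta> j = 0"
      by (simp add: in_keys_iff)
    have fin: "finite {l. Poly_Mapping.lookup \<beta> l = Suc t}" for t
      by (rule finite_subset[OF _ finite_keys[of \<beta>]]) (auto simp: in_keys_iff)
    have "{l. Poly_Mapping.lookup \<alpha> l = Suc t} =
      (if t = i then insert j {l. Poly_Mapping.lookup \<beta> l = Suc t} else {l. Poly_Mapping.lookup \<beta> l = Suc t})" for t
      using \<beta>j by (auto simp: *(1) [symmetric] j lookup_add lookup_single when_def split: if_splits)
    then show ?thesis
      using IH False \<beta>j fin by (auto simp: keys lookup_add lookup_single when_def)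
  qed
qed

text \<open>Giving each power sum factor a variable of its own produces a monomial with as many
  variables as there are factors, the maximum allowed by \<open>psum_prod_support\<close>.\<close>

lemma psum_prod_witness:
  "\<exists>\<alpha>. card (Poly_Mapping.keys \<alpha>) = mdeg \<mu> \<and> pcoeff (psum_prod \<mu>) \<alpha> > 0"
proof (induction \<mu> rule: monom_induct)
  case zero
  then show ?case by (intro exI[of _ 0]) (simp add: pcoeff_1)
next
  case (add \<nu> i)
  then obtain \<beta> where \<beta>: "card (Poly_Mapping.keys \<beta>) = mdeg \<nu>" "pcoeff (psum_prod \<nu>) \<beta> > 0"
    by blast
  obtain j where j: "j \<notin> Poly_Mapping.keys \<beta>"
    using ex_new_if_finite[OF infinite_UNIV_nat finite_keys] by blast
  let ?s = "Poly_Mapping.single j (Suc i) :: monom_exp"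
  have "0 < pcoeff (psum_prod \<nu>) \<beta> * pcoeff (sym_p (Suc i)) ?s"
    using \<beta>(2) by (auto simp: pcoeff_sym_p)
  also have "\<dots> \<le> pcoeff (psum_prod (\<nu> + Poly_Mapping.single i 1)) (\<beta> + ?s)"
    unfolding mweight_add pcoeff_mult mweight_single power_one_right
    by (rule order.trans[OF _ member_le_sum[of "(\<beta>, ?s)"]])
      (auto simp: finite_monom_splits psum_prod_nonneg pcoeff_sym_p)
  finally show ?case
    using j \<beta>(1) by (intro exI[of _ "\<beta> + ?s"]) (simp add: keys_add_nat)
qed

text \<open>Choose a term \<mu> with the most factors and a witness \<alpha> for it. Another term
  \<nu> containing \<alpha> would need at least as many factors, hence equally many, and then the
  exponents of \<alpha> spell out both \<mu> and \<nu>. So \<alpha> survives in the sum with a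
  nonzero coefficient.\<close>

lemma poly_eval_sym_p_eq_0:
  assumes "poly_eval P (\<lambda>i. sym_p (Suc i)) = 0"
  shows "P = 0"
proof (rule ccontr)
  assume "P \<noteq> 0"
  then have ne: "Poly_Mapping.keys P \<noteq> {}"
    by (metis empty_iff in_keys_iff lookup_zero poly_mapping_eqI)
  obtain \<mu> where \<mu>: "\<mu> \<in> Poly_Mapping.keys P" "\<And>\<nu>. \<nu> \<in> Poly_Mapping.keys P \<Longrightarrow> mdeg \<nu> \<le> mdeg \<mu>"
  proof -
    have "Max (mdeg ` Poly_Mapping.keys P) \<in> mdeg ` Poly_Mapping.keys P"
      using ne by (intro Max_in) auto
    then show ?thesis
      using that by (metis Max_ge finite_imageI finite_keys imageE imageI)
  qed
  obtain \<alpha> where \<alpha>: "card (Poly_Mapping.keys \<alpha>) = mdeg \<mu>" "pcoeff (psum_prod \<mu>) \<alpha> > 0"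
    using psum_prod_witness by blast
  have "0 = pcoeff (poly_eval P (\<lambda>i. sym_p (Suc i))) \<alpha>"
    using assms by simp
  also have "\<dots> = (\<Sum>\<nu>\<in>Poly_Mapping.keys P. Poly_Mapping.lookup P \<nu> * pcoeff (psum_prod \<nu>) \<alpha>)"
    by (simp add: poly_eval_superset[of "Poly_Mapping.keys P"] pcoeff_sum pcoeff_pconst_mult)
  also have "\<dots> = (\<Sum>\<nu>\<in>Poly_Mapping.keys P. if \<nu> = \<mu> then Poly_Mapping.lookup P \<mu> * pcoeff (psum_prod \<mu>) \<alpha> else 0)"
  proof (intro sum.cong refl)
    fix \<nu> assume \<nu>: "\<nu> \<in> Poly_Mapping.keys P"
    have "\<nu> = \<mu>" if "pcoeff (psum_prod \<nu>) \<alpha> \<noteq> 0"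
    proof (rule poly_mapping_eqI)
      fix i
      have "card (Poly_Mapping.keys \<alpha>) = mdeg \<nu>"
        using psum_prod_support[OF that] \<mu>(2)[OF \<nu>] \<alpha>(1) by simp
      then show "Poly_Mapping.lookup \<nu> i = Poly_Mapping.lookup \<mu> i"
        using psum_prod_support[OF that] psum_prod_support[of \<mu> \<alpha>] \<alpha> by simp
    qed
    then show "Poly_Mapping.lookup P \<nu> * pcoeff (psum_prod \<nu>) \<alpha> =
      (if \<nu> = \<mu> then Poly_Mapping.lookup P \<mu> * pcoeff (psum_prod \<mu>) \<alpha> else 0)"
      by auto
  qed
  also have "\<dots> = Poly_Mapping.lookup P \<mu> * pcoeff (psum_prod \<mu>) \<alpha>"
    using \<mu>(1) by simp
  finally show False
    using \<mu>(1) \<alpha>(2) by (simp add: in_keys_iff)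
qed

lemma poly_eval_sym_p_inj:
  assumes "poly_eval P (\<lambda>i. sym_p (Suc i)) = poly_eval Q (\<lambda>i. sym_p (Suc i))"
  shows "P = Q"
proof -
  have "poly_eval (P - Q) (\<lambda>i. sym_p (Suc i)) + poly_eval Q (\<lambda>i. sym_p (Suc i)) =
      poly_eval P (\<lambda>i. sym_p (Suc i))"
    by (simp add: poly_eval_add [symmetric])
  then have "poly_eval (P - Q) (\<lambda>i. sym_p (Suc i)) = 0"
    using assms by simp
  then show ?thesis
    using poly_eval_sym_p_eq_0 by fastforce
qed


section \<open>Counting multisets of monomials\<close>

definition msets :: "monom_exp set \<Rightarrow> nat \<Rightarrow> monom_exp \<Rightarrow> monom_exp multiset set" where
  "msets S k \<gamma> = {M. set_mset M \<subseteq> S \<and> size M = k \<and> \<Sum>\<^sub># M = \<gamma>}"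

definition ind_ser :: "monom_exp set \<Rightarrow> 'a::comm_ring_1 pser" where
  "ind_ser S = Abs_pser (\<lambda>\<alpha>. if \<alpha> \<in> S then 1 else 0)"

text \<open>This is h_k with the monomials of \<open>S\<close> put in place of the variables;
  \<open>pleth_sym_h\<close> identifies it with the plethysm.\<close>

definition mset_ser :: "monom_exp set \<Rightarrow> nat \<Rightarrow> rat pser" where
  "mset_ser S k = Abs_pser (\<lambda>\<gamma>. of_nat (card (msets S k \<gamma>)))"

lemma pcoeff_ind_ser: "pcoeff (ind_ser S) \<alpha> = (if \<alpha> \<in> S then 1 else 0)"
  by (simp add: ind_ser_def)

lemma sum_mset_member_le:
  assumes "\<alpha> \<in># M"
  shows "Poly_Mapping.lookup \<alpha> x \<le> Poly_Mapping.lookup (\<Sum>\<^sub># M :: monom_exp) x"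
    "mdeg \<alpha> \<le> mdeg (\<Sum>\<^sub># M)"
  using multi_member_split[OF assms] by (auto simp: lookup_add)

text \<open>Each member of such a multiset divides \<gamma>, so there are finitely many candidates,
  and the size is prescribed.\<close>

lemma finite_msets [simp]: "finite (msets S k \<gamma>)"
proof (rule finite_subset)
  let ?A = "{\<alpha> :: monom_exp. Poly_Mapping.keys \<alpha> \<subseteq> Poly_Mapping.keys \<gamma> \<and> mdeg \<alpha> \<le> mdeg \<gamma>}"
  show "msets S k \<gamma> \<subseteq> multisets_of_size ?A k"
  proof
    fix M assume "M \<in> msets S k \<gamma>"
    then have M: "size M = k" "\<Sum>\<^sub># M = \<gamma>"
      by (auto simp: msets_def)
    have "\<alpha> \<in> ?A" if "\<alpha> \<in># M" for \<alpha>
      using sum_mset_member_le[OF that] by (auto simp: M(2) in_keys_iff subset_iff) (metis le_zero_eq not_gr_zero)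
    then show "M \<in> multisets_of_size ?A k"
      using M(1) by (auto simp: multisets_of_size_def)
  qed
  show "finite (multisets_of_size ?A k)"
    by (intro finite_multisets_of_size finite_bounded_monoms) simp
qed

text \<open>The product is the convolution on \<open>poly_mapping\<close>, where
  \<open>of_nat i\<close> is concentrated at 0. It therefore multiplies all exponents by
  \<open>i\<close>, which is the i-th power of the monomial.\<close>

lemma lookup_of_nat_mult:
  "Poly_Mapping.lookup (of_nat i * \<alpha> :: monom_exp) x = i * Poly_Mapping.lookup \<alpha> x"
  by (induction i) (simp_all add: lookup_add distrib_right)

text \<open>For \<open>i \<ge> 1\<close> a monomial has at most one i-th root, so the cardinality is
  0 or 1. The form as a cardinality suits the counting in \<open>newton_mset_ser\<close>.\<close>

lemma pcoeff_adams_ind_ser: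
  assumes "i \<ge> 1"
  shows "pcoeff (adams i (ind_ser S)) a = of_nat (card {\<alpha>\<in>S. a = of_nat i * \<alpha>})"
proof -
  let ?q = "Poly_Mapping.map (\<lambda>c. c div i) a"
  have q: "Poly_Mapping.lookup ?q x = Poly_Mapping.lookup a x div i" for x
    by (simp add: map.rep_eq when_def)
  have "a = of_nat i * \<alpha> \<longleftrightarrow> (\<forall>x. i dvd Poly_Mapping.lookup a x) \<and> \<alpha> = ?q" for \<alpha>
    using assms by (auto simp: poly_mapping_eq_iff fun_eq_iff lookup_of_nat_mult q)
  then have "{\<alpha>\<in>S. a = of_nat i * \<alpha>} =
      (if (\<forall>x. i dvd Poly_Mapping.lookup a x) \<and> ?q \<in> S then {?q} else {})"
    by auto
  then show ?thesis
    by (simp add: adams_def pcoeff_ind_ser)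
qed

text \<open>The factor \<open>k\<close> counts pairs (\<alpha>, q) with 1 \<le> q \<le>
  \<open>count M \<alpha>\<close>. Removing \<open>q\<close> copies of \<alpha> splits off the
  monomial \<alpha>^q, a term of \<open>adams q\<close>, and leaves a multiset of size
  \<open>k - q\<close>.\<close>

lemma newton_mset_ser:
  "of_nat k * mset_ser S k = (\<Sum>i\<in>{1..k}. adams i (ind_ser S) * mset_ser S (k - i))"
proof (rule pser_eqI)
  fix \<gamma> :: monom_exp
  let ?r = "\<lambda>q \<alpha>. of_nat q * \<alpha> :: monom_exp"
  let ?P = "{(a, b). a + b = \<gamma>}"
  let ?C = "\<lambda>i (a, b). {\<alpha>\<in>S. a = ?r i \<alpha>} \<times> msets S (k - i) b"
  let ?I = "SIGMA M:msets S k \<gamma>. SIGMA \<alpha>:set_mset M. {1..count M \<alpha>}"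
  let ?J = "SIGMA i:{1..k}. SIGMA u:?P. ?C i u"
  have fin: "finite {\<alpha>\<in>S. a = ?r i \<alpha>}" if "i \<ge> 1" for a i
  proof (rule finite_subset)
    show "{\<alpha>\<in>S. a = ?r i \<alpha>} \<subseteq> {Poly_Mapping.map (\<lambda>c. c div i) a}"
    proof
      fix \<alpha> assume "\<alpha> \<in> {\<alpha>\<in>S. a = ?r i \<alpha>}"
      then have "\<alpha> = Poly_Mapping.map (\<lambda>c. c div i) a"
        using that by (intro poly_mapping_eqI) (simp add: map.rep_eq when_def lookup_of_nat_mult)
      then show "\<alpha> \<in> {Poly_Mapping.map (\<lambda>c. c div i) a}" by simp
    qed
  qed simp
  have "of_nat k * of_nat (card (msets S k \<gamma>)) = (\<Sum>M\<in>msets S k \<gamma>. of_nat k :: rat)"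
    by simp
  also have "\<dots> = (\<Sum>M\<in>msets S k \<gamma>. of_nat (size M))"
    by (rule sum.cong) (auto simp: msets_def)
  also have "\<dots> = (\<Sum>M\<in>msets S k \<gamma>. \<Sum>\<alpha>\<in>set_mset M. \<Sum>q\<in>{1..count M \<alpha>}. 1)"
    proof (rule sum.cong)
    show "of_nat (size M) = (\<Sum>\<alpha>\<in>set_mset M. \<Sum>q\<in>{1..count M \<alpha>}. 1 :: rat)" for M :: "monom_exp multiset"
      unfolding size_multiset_overloaded_eq by simp
  qed simp
  also have "\<dots> = (\<Sum>(M, \<alpha>, q)\<in>?I. 1)"
    by (rule sum_Sigma3) auto
  also have "\<dots> = (\<Sum>(i, u, v)\<in>?J. 1)"
  proof (rule sum.reindex_bij_witness
      [where j = "\<lambda>(M, \<alpha>, q). (q, (?r q \<alpha>, \<Sum>\<^sub># (M - replicate_mset q \<alpha>)), (\<alpha>, M - replicate_mset q \<alpha>))"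
        and i = "\<lambda>(i, u, (\<alpha>, M')). (M' + replicate_mset i \<alpha>, \<alpha>, i)"], goal_cases)
    case (1 a)
    then obtain M \<alpha> q where a: "a = (M, \<alpha>, q)" and *: "M \<in> msets S k \<gamma>" "1 \<le> q" "q \<le> count M \<alpha>"
      by (cases a) auto
    then show ?case by (simp add: a count_le_replicate_mset_subset_eq)
  next
    case (2 a)
    then obtain M \<alpha> q where a: "a = (M, \<alpha>, q)" and *: "M \<in> msets S k \<gamma>" "1 \<le> q" "q \<le> count M \<alpha>" "\<alpha> \<in># M"
      by (cases a) auto
    define M' where "M' = M - replicate_mset q \<alpha>"
    have M: "M = M' + replicate_mset q \<alpha>"
      using *(3) by (simp add: M'_def count_le_replicate_mset_subset_eq)
    show ?case
      using * unfolding a M by (auto simp: msets_def add.commute)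
  next
    case (3 b)
    then obtain i u \<alpha> M' where b: "b = (i, u, (\<alpha>, M'))" and *: "1 \<le> i" "i \<le> k" "fst u + snd u = \<gamma>"
        "\<alpha> \<in> S" "fst u = ?r i \<alpha>" "M' \<in> msets S (k - i) (snd u)"
      by (cases b) auto
    then show ?case by (cases u) (simp add: msets_def)
  next
    case (4 b)
    then obtain i u \<alpha> M' where b: "b = (i, u, (\<alpha>, M'))" and *: "1 \<le> i" "i \<le> k" "fst u + snd u = \<gamma>"
        "\<alpha> \<in> S" "fst u = ?r i \<alpha>" "M' \<in> msets S (k - i) (snd u)"
      by (cases b) auto
    then show ?case by (simp add: msets_def add.commute)
  qed (simp only: case_prod_unfold)
  also have "\<dots> = (\<Sum>i\<in>{1..k}. \<Sum>u\<in>?P. \<Sum>v\<in>?C i u. 1)"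
    by (rule sum_Sigma3 [symmetric]) (auto simp: finite_monom_splits fin)
  also have "\<dots> = (\<Sum>i\<in>{1..k}. pcoeff (adams i (ind_ser S) * mset_ser S (k - i)) \<gamma>)"
    unfolding pcoeff_mult
    by (intro sum.cong refl) (auto simp: pcoeff_adams_ind_ser mset_ser_def card_cartesian_product)
  finally show "pcoeff (of_nat k * mset_ser S k) \<gamma> =
      pcoeff (\<Sum>i\<in>{1..k}. adams i (ind_ser S) * mset_ser S (k - i)) \<gamma>"
    by (simp only: of_nat_pser pcoeff_pconst_mult pcoeff_sum) (simp add: mset_ser_def)
qed

lemma mset_ser_0: "mset_ser S 0 = 1"
proof (rule pser_eqI)
  fix \<gamma>
  have "msets S 0 \<gamma> = (if \<gamma> = 0 then {{#}} else {})"
    by (auto simp: msets_def)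
  then show "pcoeff (mset_ser S 0) \<gamma> = pcoeff 1 \<gamma>"
    by (simp add: mset_ser_def pcoeff_1)
qed

definition all_msets :: "monom_exp set \<Rightarrow> monom_exp \<Rightarrow> monom_exp multiset set" where
  "all_msets S \<gamma> = {M. set_mset M \<subseteq> S \<and> \<Sum>\<^sub># M = \<gamma>}"

text \<open>Unique factorization: a monomial is the product of exactly one multiset of variables, in
  which each variable has its exponent as multiplicity.\<close>

lemma mset_ser_singles: "mset_ser (range (\<lambda>j. Poly_Mapping.single j 1)) k = sym_h k"
proof (rule pser_eqI)
  fix \<gamma> :: monom_exp
  let ?S = "range (\<lambda>j. Poly_Mapping.single j 1) :: monom_exp set"
  have mdeg: "mdeg (\<Sum>\<^sub># M) = size M" if "set_mset M \<subseteq> ?S" for M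
    using that by (induction M) auto
  have count: "count M (Poly_Mapping.single j 1) = Poly_Mapping.lookup (\<Sum>\<^sub># M) j" if "set_mset M \<subseteq> ?S" for M j
    using that by (induction M) (auto simp: lookup_add lookup_single when_def)
  have ex: "\<exists>M. set_mset M \<subseteq> ?S \<and> \<Sum>\<^sub># M = \<gamma>" for \<gamma>
  proof (induction \<gamma> rule: monom_induct)
    case zero
    then show ?case by (intro exI[of _ "{#}"]) simp
  next
    case (add \<nu> i)
    then obtain M where "set_mset M \<subseteq> ?S" "\<Sum>\<^sub># M = \<nu>" by blast
    then show ?case
      by (intro exI[of _ "add_mset (Poly_Mapping.single i 1) M"]) (auto simp: add.commute)
  qed
  have uniq: "M = N" if "set_mset M \<subseteq> ?S" "set_mset N \<subseteq> ?S" "\<Sum>\<^sub># M = \<Sum>\<^sub># N" for M N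
  proof (rule multiset_eqI)
    fix \<alpha>
    show "count M \<alpha> = count N \<alpha>"
    proof (cases "\<alpha> \<in> ?S")
      case True
      then show ?thesis using count[OF that(1)] count[OF that(2)] that(3) by auto
    next
      case False
      then have "\<alpha> \<notin># M" "\<alpha> \<notin># N" using that by auto
      then show ?thesis by (simp add: not_in_iff)
    qed
  qed
  have "card (msets ?S k \<gamma>) = (if mdeg \<gamma> = k then 1 else 0)"
  proof (cases "mdeg \<gamma> = k")
    case True
    obtain M where M: "set_mset M \<subseteq> ?S" "\<Sum>\<^sub># M = \<gamma>" using ex by blast
    have "M \<in> msets ?S k \<gamma>"
      using M mdeg[OF M(1)] True by (simp add: msets_def)
    moreover have "N = M" if "N \<in> msets ?S k \<gamma>" for N
      using that M by (intro uniq) (simp_all add: msets_def)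
    ultimately have "msets ?S k \<gamma> = {M}"
      by blast
    then show ?thesis using True by simp
  next
    case False
    then have "msets ?S k \<gamma> = {}"
      using mdeg by (auto simp: msets_def)
    then show ?thesis using False by simp
  qed
  then show "pcoeff (mset_ser ?S k) \<gamma> = pcoeff (sym_h k) \<gamma>"
    by (simp add: mset_ser_def sym_h_def)
qed

lemma adams_singles:
  assumes "i \<ge> 1"
  shows "adams i (ind_ser (range (\<lambda>j. Poly_Mapping.single j 1))) = sym_p i"
proof (rule pser_eqI)
  fix \<gamma> :: monom_exp
  have *: "of_nat i * Poly_Mapping.single j 1 = (Poly_Mapping.single j i :: monom_exp)" for j
    by (rule poly_mapping_eqI) (simp add: lookup_of_nat_mult lookup_single when_def)
  have "{\<alpha> \<in> range (\<lambda>j. Poly_Mapping.single j 1). \<gamma> = of_nat i * \<alpha>} =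
      (\<lambda>j. Poly_Mapping.single j 1) ` {j. \<gamma> = Poly_Mapping.single j i}"
    using * by auto
  moreover have "inj_on (\<lambda>j. Poly_Mapping.single j 1 :: monom_exp) A" for A
    by (rule inj_onI) (metis lookup_single_eq lookup_single_not_eq zero_neq_one)
  moreover have "card {j. \<gamma> = Poly_Mapping.single j i} = (if \<exists>j. \<gamma> = Poly_Mapping.single j i then 1 else 0)"
  proof (cases "\<exists>j. \<gamma> = Poly_Mapping.single j i")
    case True
    then obtain j where j: "\<gamma> = Poly_Mapping.single j i" by blast
    have "{j. \<gamma> = Poly_Mapping.single j i} = {j}"
    proof safe
      fix l assume "\<gamma> = Poly_Mapping.single l i"
      then have "Poly_Mapping.lookup (Poly_Mapping.single j i) l = i" using j by simp
      then show "l = j" using assms by (auto simp: lookup_single when_def split: if_splits)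
    qed (rule j)
    then show ?thesis using True by simp
  qed simp
  ultimately show "pcoeff (adams i (ind_ser (range (\<lambda>j. Poly_Mapping.single j 1)))) \<gamma> = pcoeff (sym_p i) \<gamma>"
    using assms by (simp only: pcoeff_adams_ind_ser card_image) (simp add: sym_p_def)
qed

text \<open>One polynomial \<open>P\<close> solves Newton's recursion for every set of monomials.
  For the set of variables this says that \<open>P\<close> expresses \<open>sym_h k\<close> in the
  power sums, so \<open>P\<close> is the polynomial selected by \<open>THE\<close>; for
  \<open>S\<close> it then evaluates the plethysm.\<close>

lemma pleth_sym_h: "pleth (sym_h k) (ind_ser S) = mset_ser S k"
proof -
  obtain P where P: "\<And>(x :: nat \<Rightarrow> rat pser) E. E 0 = 1 \<Longrightarrow>
      (\<forall>m. of_nat m * E m = (\<Sum>i\<in>{1..m}. x (i - 1) * E (m - i))) \<Longrightarrow> poly_eval P x = E k"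
    using newton_poly_exists by metis
  have newton: "poly_eval P (\<lambda>i. adams (Suc i) (ind_ser T)) = mset_ser T k" for T
    by (rule P) (auto simp: mset_ser_0 newton_mset_ser intro!: sum.cong)
  have "(\<lambda>i. adams (Suc i) (ind_ser (range (\<lambda>j. Poly_Mapping.single j 1)))) =
      (\<lambda>i. sym_p (Suc i) :: rat pser)"
    by (intro ext adams_singles) simp
  then have "poly_eval P (\<lambda>i. sym_p (Suc i)) = sym_h k"
    using newton[of "range (\<lambda>j. Poly_Mapping.single j 1)"] by (simp only: mset_ser_singles)
  then have "(THE P. poly_eval P (\<lambda>i. sym_p (Suc i)) = sym_h k) = P"
    using poly_eval_sym_p_inj by (intro the_equality) auto
  then show ?thesis
    by (simp add: pleth_def newton)
qed

section \<open>Coefficients of the plethystic exponential\<close>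

lemma size_le_mdeg_sum_mset:
  assumes "0 \<notin># M"
  shows "size M \<le> mdeg (\<Sum>\<^sub># M)"
  using assms
proof (induction M)
  case (add \<alpha> M)
  then have "mdeg \<alpha> \<noteq> 0" by auto
  then show ?case using add by (simp del: mdeg_eq_0_iff)
qed simp

lemma all_msets_UN:
  assumes "0 \<notin> S"
  shows "all_msets S \<gamma> = (\<Union>k\<in>{..mdeg \<gamma>}. msets S k \<gamma>)"
  using assms by (auto simp: all_msets_def msets_def intro!: size_le_mdeg_sum_mset)

lemma finite_all_msets: "0 \<notin> S \<Longrightarrow> finite (all_msets S \<gamma>)"
  by (simp add: all_msets_UN)

lemma pcoeff_Exp_sigma:
  assumes "0 \<notin> S"
  shows "pcoeff (Exp_sigma (ind_ser S)) \<gamma> = of_nat (card (all_msets S \<gamma>))"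
proof -
  \<comment> \<open>Members of positive degree bound the size by the degree of \<gamma>. This keeps
    the index set in \<open>psum\<close> finite, so the default value 0 of an infinite sum does not
    arise.\<close>
  have empty: "msets S k \<gamma> = {}" if "k > mdeg \<gamma>" for k
    using that assms by (auto simp: msets_def not_le [symmetric] intro!: size_le_mdeg_sum_mset)
  have "pcoeff (Exp_sigma (ind_ser S)) \<gamma> =
      (\<Sum>k | card (msets S k \<gamma>) \<noteq> 0. of_nat (card (msets S k \<gamma>)))"
    by (simp add: Exp_sigma_def psum_def pleth_sym_h mset_ser_def del: card_0_eq)
  also have "\<dots> = (\<Sum>k\<le>mdeg \<gamma>. of_nat (card (msets S k \<gamma>)))"
    using empty by (intro sum.mono_neutral_left) (auto simp: not_less [symmetric])
  also have "\<dots> = of_nat (card (\<Union>k\<in>{..mdeg \<gamma>}. msets S k \<gamma>))"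
    by (subst card_UN_disjoint) (simp_all, auto simp: msets_def)
  finally show ?thesis
    by (simp add: all_msets_UN assms)
qed

definition mult_monoms :: "nat \<Rightarrow> monom_exp set" where
  "mult_monoms r = {\<alpha>. \<alpha> \<noteq> 0 \<and> r dvd mdeg \<alpha>}"

text \<open>The degrees \<open>j * r\<close> are distinct, so each nonconstant monomial of degree
  divisible by \<open>r\<close> occurs in exactly one summand, with coefficient 1.\<close>

lemma psum_sym_h_multiples:
  assumes "r \<ge> 1"
  shows "psum {1..} (\<lambda>j. sym_h (j * r)) = (ind_ser (mult_monoms r) :: 'a::comm_ring_1 pser)"
proof (rule pser_eqI)
  fix \<gamma> :: monom_exp
  have "{j. j \<in> {1..} \<and> pcoeff (sym_h (j * r) :: 'a pser) \<gamma> \<noteq> 0} =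
      (if \<gamma> \<in> mult_monoms r then {mdeg \<gamma> div r} else {})"
  proof -
    have "mdeg \<gamma> div r \<noteq> 0" if "r dvd mdeg \<gamma>" "\<gamma> \<noteq> 0"
      using that by (auto elim!: dvdE simp flip: mdeg_eq_0_iff)
    then show ?thesis
      using assms by (auto simp: sym_h_def mult_monoms_def Suc_le_eq simp flip: mdeg_eq_0_iff)
  qed
  then show "pcoeff (psum {1..} (\<lambda>j. sym_h (j * r)) :: 'a pser) \<gamma> = pcoeff (ind_ser (mult_monoms r)) \<gamma>"
    using assms by (auto simp: psum_def pcoeff_ind_ser sym_h_def mult_monoms_def)
qed

lemma pcoeff_Exp_sigma_multiples:
  assumes "r \<ge> 1"
  shows "pcoeff (Exp_sigma (psum {1..} (\<lambda>j. sym_h (j * r)))) \<gamma> =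
    of_nat (card (all_msets (mult_monoms r) \<gamma>))"
  unfolding psum_sym_h_multiples[OF assms]
  by (rule pcoeff_Exp_sigma) (simp add: mult_monoms_def)


section \<open>Symmetric functions of the eigenvalues\<close>

definition mtrace :: "'a::comm_monoid_add mat \<Rightarrow> 'a" where
  "mtrace A = (\<Sum>i<dim_row A. A $$ (i, i))"

lemma mtrace_mult_commute:
  fixes A :: "'a::comm_ring_1 mat"
  assumes "A \<in> carrier_mat n n" "B \<in> carrier_mat n n"
  shows "mtrace (A * B) = mtrace (B * A)"
proof -
  have "mtrace (A * B) = (\<Sum>i<n. \<Sum>j<n. A $$ (i, j) * B $$ (j, i))"
    using assms by (simp add: mtrace_def scalar_prod_def lessThan_atLeast0)
  also have "\<dots> = (\<Sum>j<n. \<Sum>i<n. B $$ (j, i) * A $$ (i, j))"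
    by (subst sum.swap) (simp add: mult.commute)
  also have "\<dots> = mtrace (B * A)"
    using assms by (simp add: mtrace_def scalar_prod_def lessThan_atLeast0)
  finally show ?thesis .
qed

lemma upper_triangular_pow:
  fixes B :: "'a::comm_ring_1 mat"
  assumes B: "B \<in> carrier_mat n n" "upper_triangular B"
  shows "upper_triangular (B ^\<^sub>m k) \<and> (\<forall>i<n. (B ^\<^sub>m k) $$ (i, i) = (B $$ (i, i)) ^ k)"
proof (induction k)
  case 0
  then show ?case using B by auto
next
  case (Suc k)
  have entry: "(B ^\<^sub>m Suc k) $$ (i, j) = (if i = j then (B $$ (i, i)) ^ Suc k else 0)" if "i < n" "j \<le> i" for i j
  proof -
    have "(B ^\<^sub>m Suc k) $$ (i, j) = (\<Sum>l<n. (B ^\<^sub>m k) $$ (i, l) * B $$ (l, j))"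
      using that B by (simp add: scalar_prod_def lessThan_atLeast0)
    also have "\<dots> = (\<Sum>l<n. if l = i then (if i = j then (B $$ (i, i)) ^ Suc k else 0) else 0)"
    proof (intro sum.cong refl)
      fix l assume l: "l \<in> {..<n}"
      show "(B ^\<^sub>m k) $$ (i, l) * B $$ (l, j) = (if l = i then (if i = j then (B $$ (i, i)) ^ Suc k else 0) else 0)"
      proof (cases l i rule: linorder_cases)
        case less
        then have "(B ^\<^sub>m k) $$ (i, l) = 0"
          using Suc.IH B that by (auto simp: upper_triangular_def)
        then show ?thesis using less by simp
      next
        case equal
        then show ?thesis
          using Suc.IH B that by (auto simp: upper_triangular_def mult.commute)
      next
        case greater
        then have "B $$ (l, j) = 0"
          using B that l by (auto simp: upper_triangular_def)
        then show ?thesis using greater by simp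
      qed
    qed
    also have "\<dots> = (if i = j then (B $$ (i, i)) ^ Suc k else 0)"
      using that by simp
    finally show ?thesis .
  qed
  show ?case
    using B entry by (auto simp: upper_triangular_def simp del: pow_mat.simps)
qed

text \<open>Schur decomposition conjugates \<open>A\<close> to a triangular matrix with diagonal
  \<open>zs\<close>. Conjugation preserves the trace, and powers of a triangular matrix act
  entrywise on its diagonal.\<close>

lemma mtrace_pow_eigenvalues:
  fixes A :: "complex mat"
  assumes A: "A \<in> carrier_mat n n" and cp: "char_poly A = (\<Prod>z\<leftarrow>zs. [:- z, 1:])"
  shows "mtrace (A ^\<^sub>m k) = (\<Sum>j<n. (zs ! j) ^ k)"
proof -
  obtain B P Q where "schur_decomposition A zs = (B, P, Q)"
    by (cases "schur_decomposition A zs")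
  note schur = schur_decomposition[OF A cp this]
  from schur have sim: "similar_mat_wit A B P Q" and up: "upper_triangular B" and diag: "diag_mat B = zs"
    by auto
  note w = similar_mat_witD2[OF A sim]
  have Bk: "B ^\<^sub>m k \<in> carrier_mat n n"
    using w by simp
  have "mtrace (A ^\<^sub>m k) = mtrace (P * B ^\<^sub>m k * Q)"
    by (simp add: similar_mat_wit_pow_id[OF sim])
  also have "\<dots> = mtrace (Q * (P * B ^\<^sub>m k))"
    using w Bk by (intro mtrace_mult_commute[of _ n]) auto
  also have "Q * (P * B ^\<^sub>m k) = B ^\<^sub>m k"
    using w Bk by (subst assoc_mult_mat [symmetric, of _ n n _ n _ n]) auto
  also have "mtrace (B ^\<^sub>m k) = (\<Sum>j<n. (B $$ (j, j)) ^ k)"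
    using upper_triangular_pow[OF w(5) up, of k] w(5) by (simp add: mtrace_def)
  also have "\<dots> = (\<Sum>j<n. (zs ! j) ^ k)"
    using w(5) by (intro sum.cong) (auto simp: diag [symmetric] diag_mat_def)
  finally show ?thesis .
qed

lemma eigenvalue_list:
  assumes A: "A \<in> carrier_mat n n"
  shows "char_poly A = (\<Prod>z\<leftarrow>eigenvalue_list A. [:- z, 1:])" "length (eigenvalue_list A) = n"
proof -
  have m: "mset (eigenvalue_list A) = proots (char_poly A)"
    unfolding eigenvalue_list_def by (rule someI_ex) (rule ex_mset)
  have monic: "degree (char_poly A) = n" "coeff (char_poly A) n = 1"
    using degree_monic_char_poly[OF A] by auto
  have "char_poly A = (\<Prod>z\<in>#proots (char_poly A). [:- z, 1:])"
    using complex_poly_decompose_multiset[of "char_poly A"] monic by simp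
  also have "\<dots> = (\<Prod>z\<leftarrow>eigenvalue_list A. [:- z, 1:])"
    by (simp add: m [symmetric] prod_mset_prod_list flip: mset_map)
  finally show "char_poly A = (\<Prod>z\<leftarrow>eigenvalue_list A. [:- z, 1:])" .
  show "length (eigenvalue_list A) = n"
    using m monic size_proots_complex[of "char_poly A"] by (metis size_mset)
qed

section \<open>Generalized permutation matrices\<close>

definition gen_perm_mat :: "nat \<Rightarrow> (nat \<Rightarrow> complex) \<Rightarrow> (nat \<Rightarrow> nat) \<Rightarrow> complex mat" where
  "gen_perm_mat n \<zeta> \<sigma> = mat_diag n (\<lambda>i. \<zeta> (Suc i)) * perm_mat n \<sigma>"

lemma perm_mat_carrier [simp]: "perm_mat n \<sigma> \<in> carrier_mat n n"
  by (simp add: perm_mat_def)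

lemma gen_perm_mat_carrier [simp]: "gen_perm_mat n \<zeta> \<sigma> \<in> carrier_mat n n"
  unfolding gen_perm_mat_def by (intro mult_carrier_mat[of _ n n]) simp_all

lemma gen_perm_mat_index:
  "i < n \<Longrightarrow> j < n \<Longrightarrow> gen_perm_mat n \<zeta> \<sigma> $$ (i, j) = (if Suc i = \<sigma> (Suc j) then \<zeta> (Suc i) else 0)"
  by (simp add: gen_perm_mat_def mat_diag_mult_left[OF perm_mat_carrier]) (simp add: perm_mat_def)

text \<open>Column \<open>b\<close> has its only nonzero entry in row \<sigma> b, with the weight of
  that row. Walking \<open>k\<close> steps thus collects the weights of the points reached, the
  start excluded and the end included.\<close>

lemma gen_perm_mat_pow_index:
  assumes \<sigma>: "\<sigma> permutes {1..n}"
  shows "a < n \<Longrightarrow> b < n \<Longrightarrow> (gen_perm_mat n \<zeta> \<sigma> ^\<^sub>m k) $$ (a, b) =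
    (if Suc a = (\<sigma> ^^ k) (Suc b) then \<Prod>l<k. \<zeta> ((\<sigma> ^^ Suc l) (Suc b)) else 0)"
proof (induction k arbitrary: a b)
  case 0
  then show ?case using carrier_matD(1)[OF gen_perm_mat_carrier[of n \<zeta> \<sigma>]] by simp
next
  case (Suc k)
  let ?A = "gen_perm_mat n \<zeta> \<sigma>"
  have dim: "dim_row ?A = n" "dim_col ?A = n"
    by (simp_all only: carrier_matD[OF gen_perm_mat_carrier])
  have "\<sigma> (Suc b) \<in> {1..n}"
    using Suc.prems by (subst permutes_in_image[OF \<sigma>]) auto
  then obtain c where c: "\<sigma> (Suc b) = Suc c" "c < n"
    by (cases "\<sigma> (Suc b)") auto
  have "(?A ^\<^sub>m Suc k) $$ (a, b) = (\<Sum>l<n. (?A ^\<^sub>m k) $$ (a, l) * ?A $$ (l, b))"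
    using Suc.prems by (simp add: scalar_prod_def lessThan_atLeast0 dim)
  also have "\<dots> = (\<Sum>l<n. if l = c then (?A ^\<^sub>m k) $$ (a, c) * \<zeta> (Suc c) else 0)"
    using Suc.prems by (intro sum.cong) (auto simp: gen_perm_mat_index c)
  also have "\<dots> = (?A ^\<^sub>m k) $$ (a, c) * \<zeta> (Suc c)"
    using c by simp
  also have "\<dots> = (if Suc a = (\<sigma> ^^ Suc k) (Suc b) then \<Prod>l<Suc k. \<zeta> ((\<sigma> ^^ Suc l) (Suc b)) else 0)"
    unfolding Suc.IH[OF Suc.prems(1) c(2)] prod.lessThan_Suc_shift c(1) [symmetric]
    by (simp add: funpow_swap1)
  finally show ?case .
qed

lemma mtrace_gen_perm_mat_pow:
  assumes \<sigma>: "\<sigma> permutes {1..n}"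
  shows "mtrace (gen_perm_mat n \<zeta> \<sigma> ^\<^sub>m k) = per_sum {1..n} \<sigma> \<zeta> k"
proof -
  \<comment> \<open>The matrix power weighs the points after each step, \<open>per_sum\<close> those
    before it; on a closed walk the two products agree.\<close>
  have shift: "(\<Prod>l<k. \<zeta> ((\<sigma> ^^ Suc l) x)) = (\<Prod>l<k. \<zeta> ((\<sigma> ^^ l) x))" if "(\<sigma> ^^ k) x = x" for x
  proof (cases k)
    case (Suc j)
    have "(\<Prod>l<k. \<zeta> ((\<sigma> ^^ l) x)) = \<zeta> x * (\<Prod>l<j. \<zeta> ((\<sigma> ^^ Suc l) x))"
      unfolding Suc by (subst prod.lessThan_Suc_shift) simp
    also have "\<dots> = (\<Prod>l<k. \<zeta> ((\<sigma> ^^ Suc l) x))"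
      using that by (simp add: Suc mult.commute)
    finally show ?thesis by simp
  qed simp
  have dim: "dim_row (gen_perm_mat n \<zeta> \<sigma> ^\<^sub>m k) = n"
    using pow_carrier_mat[OF gen_perm_mat_carrier] by blast
  have "mtrace (gen_perm_mat n \<zeta> \<sigma> ^\<^sub>m k) =
      (\<Sum>a<n. if Suc a = (\<sigma> ^^ k) (Suc a) then \<Prod>l<k. \<zeta> ((\<sigma> ^^ Suc l) (Suc a)) else 0)"
    unfolding mtrace_def dim by (intro sum.cong) (auto simp: gen_perm_mat_pow_index[OF \<sigma>])
  also have "\<dots> = (\<Sum>x\<in>{1..n}. if x = (\<sigma> ^^ k) x then \<Prod>l<k. \<zeta> ((\<sigma> ^^ Suc l) x) else 0)"
    by (rule sum.reindex_bij_witness[where i = "\<lambda>x. x - 1" and j = Suc]) auto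
  also have "\<dots> = (\<Sum>x\<in>{1..n}. if (\<sigma> ^^ k) x = x then \<Prod>l<k. \<zeta> ((\<sigma> ^^ l) x) else 0)"
    by (intro sum.cong refl) (simp only: shift cong: if_cong, metis)
  also have "\<dots> = per_sum {1..n} \<sigma> \<zeta> k"
    by (simp only: per_sum_def sum.inter_filter [symmetric] finite_atLeastAtMost)
  finally show ?thesis .
qed

text \<open>For the identity permutation \<open>per_sum\<close> is the power sum of the eigenvalues.
  Both families of \<open>per_sum\<close> values are then traces of powers of the matrix, and
  Newton's identity does the rest.\<close>

lemma inv_sum_eigenvalues:
  assumes \<sigma>: "\<sigma> permutes {1..n}"
  shows "inv_sum {..<n} (\<lambda>x. x) (\<lambda>j. eigenvalue_list (gen_perm_mat n \<zeta> \<sigma>) ! j) m = inv_sum {1..n} \<sigma> \<zeta> m"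
proof (rule inv_sum_cong_per_sum)
  fix i
  have "((\<lambda>x. x) ^^ i) x = (x :: nat)" for x i by (induction i) auto
  then show "per_sum {..<n} (\<lambda>x. x) (\<lambda>j. eigenvalue_list (gen_perm_mat n \<zeta> \<sigma>) ! j) i = per_sum {1..n} \<sigma> \<zeta> i"
    using mtrace_pow_eigenvalues[OF gen_perm_mat_carrier eigenvalue_list(1)[OF gen_perm_mat_carrier], of n \<zeta> \<sigma> i]
    unfolding mtrace_gen_perm_mat_pow[OF \<sigma>] by (simp add: per_sum_def lessThan_def)
qed (use \<sigma> permutes_id[unfolded id_def] in auto)

section \<open>Evaluating products of homogeneous series\<close>

definition hom_ser :: "nat \<Rightarrow> 'a::zero pser \<Rightarrow> bool" where
  "hom_ser m F \<longleftrightarrow> (\<forall>\<alpha>. pcoeff F \<alpha> \<noteq> 0 \<longrightarrow> mdeg \<alpha> = m)"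

lemma sym_value_hom:
  assumes "hom_ser m F"
  shows "sym_value F zs = (\<Sum>\<alpha>\<in>inv_exps {..<length zs} (\<lambda>x. x) m. pcoeff F \<alpha> * mweight (\<lambda>j. zs ! j) \<alpha>)"
  unfolding sym_value_def mweight_def
  by (rule sum.mono_neutral_left) (simp add: finite_inv_exps, use assms in \<open>auto simp: inv_exps_def hom_ser_def\<close>)

lemma hom_ser_mult:
  assumes "hom_ser m F" "hom_ser k G"
  shows "hom_ser (m + k) (F * G)"
  unfolding hom_ser_def
proof (intro allI impI)
  fix \<gamma> assume "pcoeff (F * G) \<gamma> \<noteq> 0"
  then obtain \<alpha> \<beta> where "\<alpha> + \<beta> = \<gamma>" "pcoeff F \<alpha> * pcoeff G \<beta> \<noteq> 0"
    unfolding pcoeff_mult by (auto elim!: sum.not_neutral_contains_not_neutral)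
  then have "\<alpha> + \<beta> = \<gamma>" "pcoeff F \<alpha> \<noteq> 0" "pcoeff G \<beta> \<noteq> 0"
    by auto
  then show "mdeg \<gamma> = m + k"
    using assms by (auto simp: hom_ser_def)
qed

text \<open>Homogeneity makes the sums in \<open>sym_value\<close> finite. It also reduces the
  convolution to pairs of exponents of degrees \<open>m\<close> and \<open>k\<close>, since all
  other pairs have coefficient zero.\<close>

lemma sym_value_mult:
  assumes F: "hom_ser m F" and G: "hom_ser k G"
  shows "sym_value (F * G) zs = sym_value F zs * sym_value G zs"
proof -
  let ?H = "inv_exps {..<length zs} (\<lambda>x. x)"
  let ?w = "mweight (\<lambda>j. zs ! j)"
  let ?t = "\<lambda>(\<alpha>, \<beta>). pcoeff F \<alpha> * pcoeff G \<beta> * (?w \<alpha> * ?w \<beta>)"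
  have "sym_value (F * G) zs = (\<Sum>\<gamma>\<in>?H (m + k). \<Sum>u | fst u + snd u = \<gamma>. ?t u)"
    unfolding sym_value_hom[OF hom_ser_mult[OF F G]] pcoeff_mult sum_distrib_right
    by (intro sum.cong) (auto simp: mweight_add)
  also have "\<dots> = (\<Sum>(\<gamma>, u)\<in>(SIGMA \<gamma>:?H (m + k). {u. fst u + snd u = \<gamma>}). ?t u)"
    using finite_monom_splits by (intro sum.Sigma) (auto simp: finite_inv_exps case_prod_unfold)
  also have "\<dots> = (\<Sum>(\<gamma>, u)\<in>(\<lambda>u. (fst u + snd u, u)) ` (?H m \<times> ?H k). ?t u)"
  proof (rule sum.mono_neutral_right)
    show "finite (SIGMA \<gamma>:?H (m + k). {u. fst u + snd u = \<gamma>})"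
      using finite_monom_splits by (intro finite_SigmaI) (auto simp: finite_inv_exps case_prod_unfold)
  next
    show "(\<lambda>u. (fst u + snd u, u)) ` (?H m \<times> ?H k) \<subseteq> (SIGMA \<gamma>:?H (m + k). {u. fst u + snd u = \<gamma>})"
      by (auto simp: inv_exps_def keys_add_nat)
  next
    show "\<forall>v\<in>(SIGMA \<gamma>:?H (m + k). {u. fst u + snd u = \<gamma>}) - (\<lambda>u. (fst u + snd u, u)) ` (?H m \<times> ?H k).
        (case v of (\<gamma>, u) \<Rightarrow> ?t u) = 0"
    proof (clarify, rule ccontr)
      fix \<gamma> \<alpha> \<beta> assume *: "fst (\<alpha>, \<beta>) + snd (\<alpha>, \<beta>) \<in> ?H (m + k)"
        "(fst (\<alpha>, \<beta>) + snd (\<alpha>, \<beta>), \<alpha>, \<beta>) \<notin> (\<lambda>u. (fst u + snd u, u)) ` (?H m \<times> ?H k)"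
        "pcoeff F \<alpha> * pcoeff G \<beta> * (?w \<alpha> * ?w \<beta>) \<noteq> 0"
      then have "(\<alpha>, \<beta>) \<in> ?H m \<times> ?H k"
        using F G by (auto simp: hom_ser_def inv_exps_def keys_add_nat)
      then show False using *(2) by force
    qed
  qed
  also have "\<dots> = (\<Sum>u\<in>?H m \<times> ?H k. ?t u)"
    by (subst sum.reindex) (auto simp: inj_on_def)
  also have "\<dots> = sym_value F zs * sym_value G zs"
    by (simp add: sym_value_hom[OF F] sym_value_hom[OF G] sum_product sum.cartesian_product case_prod_unfold mult_ac)
  finally show ?thesis .
qed

lemma sym_value_1: "sym_value 1 zs = 1"
proof -
  have "{\<alpha>. pcoeff (1 :: complex pser) \<alpha> \<noteq> 0 \<and> Poly_Mapping.keys \<alpha> \<subseteq> {..<length zs}} = {0}"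
    by (auto simp: pcoeff_1 split: if_splits)
  then show ?thesis by (simp add: sym_value_def pcoeff_1)
qed

lemma hom_ser_sym_h: "hom_ser m (sym_h m)"
  by (simp add: hom_ser_def sym_h_def)

lemma sym_value_sym_h: "sym_value (sym_h m) zs = inv_sum {..<length zs} (\<lambda>x. x) (\<lambda>j. zs ! j) m"
  by (simp add: sym_value_hom[OF hom_ser_sym_h] inv_sum_def) (simp add: sym_h_def inv_exps_def)

lemma sym_value_sym_h_part:
  "sym_value (sym_h_part \<tau>) zs =
    (\<Prod>j\<in>Poly_Mapping.keys \<tau>. inv_sum {..<length zs} (\<lambda>x. x) (\<lambda>j. zs ! j) (Poly_Mapping.lookup \<tau> j))"
proof -
  \<comment> \<open>Homogeneity is carried through the induction because
    \<open>sym_value_mult\<close> asks for it of both factors.\<close>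
  have "hom_ser (\<Sum>j\<in>J. e j) (\<Prod>j\<in>J. sym_h (e j) :: complex pser) \<and> sym_value (\<Prod>j\<in>J. sym_h (e j)) zs =
      (\<Prod>j\<in>J. inv_sum {..<length zs} (\<lambda>x. x) (\<lambda>j. zs ! j) (e j))" if "finite J" for J :: "nat set" and e
    using that
  proof (induction J)
    case empty
    then show ?case by (auto simp: sym_value_1 hom_ser_def pcoeff_1 split: if_splits)
  next
    case (insert j J)
    then show ?case
      by (auto simp: hom_ser_mult hom_ser_sym_h sym_value_mult[OF hom_ser_sym_h] sym_value_sym_h)
  qed
  then show ?thesis
    unfolding sym_h_part_def by auto
qed

lemma sym_value_gen_perm_mat:
  assumes "\<sigma> permutes {1..n}"
  shows "sym_value (sym_h_part \<tau>) (eigenvalue_list (gen_perm_mat n \<zeta> \<sigma>)) =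
    (\<Prod>j\<in>Poly_Mapping.keys \<tau>. inv_sum {1..n} \<sigma> \<zeta> (Poly_Mapping.lookup \<tau> j))"
  using eigenvalue_list(2)[of "gen_perm_mat n \<zeta> \<sigma>" n]
  by (simp add: sym_value_sym_h_part inv_sum_eigenvalues[OF assms])


section \<open>Averaging over the group\<close>

text \<open>A finite nonempty set of tuples of nonzero numbers closed under products is a group, so
  inverses are not listed. The \<open>restrict\<close> keeps products extensional.\<close>

definition tuple_group :: "nat \<Rightarrow> (nat \<Rightarrow> complex) set \<Rightarrow> bool" where
  "tuple_group n T \<longleftrightarrow> finite T \<and> T \<noteq> {} \<and> T \<subseteq> {1..n} \<rightarrow>\<^sub>E UNIV - {0} \<and>
     (\<forall>\<chi>\<in>T. \<forall>\<zeta>\<in>T. (\<lambda>x\<in>{1..n}. \<chi> x * \<zeta> x) \<in> T)"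

text \<open>Orthogonality of characters: multiplication by \<chi> permutes \<open>T\<close> and
  multiplies the sum by \<open>mweight \<chi> \<alpha>\<close>, so the sum vanishes once this factor
  differs from 1.\<close>

lemma character_sum:
  assumes T: "tuple_group n T" and \<alpha>: "Poly_Mapping.keys \<alpha> \<subseteq> {1..n}"
  shows "(\<Sum>\<zeta>\<in>T. mweight \<zeta> \<alpha>) = (if \<forall>\<zeta>\<in>T. mweight \<zeta> \<alpha> = 1 then of_nat (card T) else 0)"
proof (cases "\<forall>\<zeta>\<in>T. mweight \<zeta> \<alpha> = 1")
  case False
  then obtain \<chi> where \<chi>: "\<chi> \<in> T" "mweight \<chi> \<alpha> \<noteq> 1" by blast
  let ?m = "\<lambda>\<zeta>. \<lambda>x\<in>{1..n}. \<chi> x * \<zeta> x"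
  have fin: "finite T" and ne: "\<And>\<zeta> x. \<zeta> \<in> T \<Longrightarrow> x \<in> {1..n} \<Longrightarrow> \<zeta> x \<noteq> 0"
    and ext: "\<And>\<zeta>. \<zeta> \<in> T \<Longrightarrow> \<zeta> \<in> extensional {1..n}" and closed: "\<And>\<zeta>. \<zeta> \<in> T \<Longrightarrow> ?m \<zeta> \<in> T"
    using T \<chi>(1) by (auto simp: tuple_group_def PiE_def Pi_def)
  have inj: "inj_on ?m T"
  proof (rule inj_onI)
    fix \<zeta> \<xi> assume *: "\<zeta> \<in> T" "\<xi> \<in> T" "?m \<zeta> = ?m \<xi>"
    show "\<zeta> = \<xi>"
    proof (rule extensionalityI[OF ext ext])
      fix x assume x: "x \<in> {1..n}"
      then have "\<chi> x * \<zeta> x = \<chi> x * \<xi> x"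
        using fun_cong[OF *(3), of x] by simp
      then show "\<zeta> x = \<xi> x"
        using ne[OF \<chi>(1) x] by simp
    qed (use * in auto)
  qed
  have "?m ` T = T"
    by (rule endo_inj_surj[OF fin _ inj]) (use closed in auto)
  then have "(\<Sum>\<zeta>\<in>T. mweight \<zeta> \<alpha>) = (\<Sum>\<zeta>\<in>T. mweight (?m \<zeta>) \<alpha>)"
    using sum.reindex[OF inj, of "\<lambda>\<zeta>. mweight \<zeta> \<alpha>"] by simp
  also have "\<dots> = (\<Sum>\<zeta>\<in>T. mweight \<chi> \<alpha> * mweight \<zeta> \<alpha>)"
    by (intro sum.cong refl)
      (simp add: mweight_superset[OF finite_atLeastAtMost \<alpha>] prod.distrib power_mult_distrib)
  also have "\<dots> = mweight \<chi> \<alpha> * (\<Sum>\<zeta>\<in>T. mweight \<zeta> \<alpha>)"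
    by (simp add: sum_distrib_left)
  finally show ?thesis
    using \<chi>(2) False by auto
qed auto

section \<open>Fillings of the points with monomials\<close>

definition fillings :: "nat set \<Rightarrow> monom_exp \<Rightarrow> (nat \<Rightarrow> monom_exp) set" where
  "fillings X \<tau> = {F \<in> X \<rightarrow>\<^sub>E UNIV. (\<Sum>x\<in>X. F x) = \<tau>}"

text \<open>The exponent vector with which \<zeta> weighs the filling: a variable of
  \<open>F x\<close> contributes one factor \<zeta>(x) for each unit of its exponent.\<close>

definition profile :: "nat set \<Rightarrow> (nat \<Rightarrow> monom_exp) \<Rightarrow> monom_exp" where
  "profile X F = (\<Sum>x\<in>X. Poly_Mapping.single x (mdeg (F x)))"

lemma lookup_sum_single:
  "finite X \<Longrightarrow> Poly_Mapping.lookup (\<Sum>x\<in>X. Poly_Mapping.single x (f x)) y = (if y \<in> X then f y else 0)"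
  by (simp add: lookup_sum lookup_single when_def)

lemma mdeg_fillings: "F \<in> fillings X \<tau> \<Longrightarrow> (\<Sum>x\<in>X. mdeg (F x)) = mdeg \<tau>"
  by (auto simp: fillings_def mdeg_sum)

lemma lookup_fillings: "F \<in> fillings X \<tau> \<Longrightarrow> (\<Sum>x\<in>X. Poly_Mapping.lookup (F x) j) = Poly_Mapping.lookup \<tau> j"
  by (auto simp: fillings_def lookup_sum)

lemma finite_fillings:
  assumes "finite X"
  shows "finite (fillings X \<tau>)"
proof (rule finite_subset)
  let ?A = "{\<alpha> :: monom_exp. Poly_Mapping.keys \<alpha> \<subseteq> Poly_Mapping.keys \<tau> \<and> mdeg \<alpha> \<le> mdeg \<tau>}"
  show "fillings X \<tau> \<subseteq> X \<rightarrow>\<^sub>E ?A"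
  proof
    fix F assume F: "F \<in> fillings X \<tau>"
    have "F x \<in> ?A" if "x \<in> X" for x
    proof -
      have "mdeg (F x) \<le> (\<Sum>x\<in>X. mdeg (F x))"
        using assms that by (intro member_le_sum) auto
      moreover have "Poly_Mapping.lookup (F x) j \<le> (\<Sum>x\<in>X. Poly_Mapping.lookup (F x) j)" for j
        using assms that by (intro member_le_sum) auto
      ultimately show ?thesis
        using lookup_fillings[OF F] mdeg_fillings[OF F]
        by (auto simp: in_keys_iff) (metis le_zero_eq not_gr_zero)
    qed
    then show "F \<in> X \<rightarrow>\<^sub>E ?A"
      using F by (auto simp: fillings_def PiE_def Pi_def)
  qed
  show "finite (X \<rightarrow>\<^sub>E ?A)"
    using assms by (intro finite_PiE finite_bounded_monoms) auto
qed

text \<open>A family \<phi> and a filling \<open>F\<close> are one array read by columns and by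
  rows: the exponent of variable j in \<open>F x\<close> is the entry of \<phi> j at x. Column sums
  equal to the parts of \<tau> mean that the monomials \<open>F x\<close> have product \<tau>; row
  sums give the profile.\<close>

lemma sum_families_eq_sum_fillings:
  assumes X: "finite X" and \<sigma>: "\<sigma> permutes X"
  shows "(\<Sum>\<phi>\<in>(\<Pi>\<^sub>E j\<in>Poly_Mapping.keys \<tau>. inv_exps X \<sigma> (Poly_Mapping.lookup \<tau> j)).
            g (\<Sum>j\<in>Poly_Mapping.keys \<tau>. \<phi> j)) =
    (\<Sum>F | F \<in> fillings X \<tau> \<and> (\<forall>x\<in>X. F (\<sigma> x) = F x). g (profile X F))"
proof -
  let ?L = Poly_Mapping.lookup
  let ?K = "Poly_Mapping.keys \<tau>"
  let ?S = "\<lambda>x i. Poly_Mapping.single x i :: monom_exp"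
  let ?f = "\<lambda>\<phi>. \<lambda>x\<in>X. \<Sum>j\<in>?K. ?S j (?L (\<phi> j) x)"
  let ?b = "\<lambda>F. \<lambda>j\<in>?K. \<Sum>x\<in>X. ?S x (?L (F x) j)"
  have \<sigma>X: "\<sigma> x \<in> X \<longleftrightarrow> x \<in> X" for x
    using \<sigma> by (rule permutes_in_image)
  show ?thesis
  proof (rule sum.reindex_bij_witness[where j = ?f and i = ?b], goal_cases)
    case (1 \<phi>)
    then have \<phi>: "\<phi> \<in> extensional ?K" "\<And>j. j \<in> ?K \<Longrightarrow> Poly_Mapping.keys (\<phi> j) \<subseteq> X"
      by (auto simp: PiE_def Pi_def inv_exps_def)
    have "?b (?f \<phi>) j = \<phi> j" if "j \<in> ?K" for j
      using \<phi>(2)[OF that] that X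
      by (intro poly_mapping_eqI) (auto simp: lookup_sum_single in_keys_iff subset_iff)
    then show ?case
      by (intro extensionalityI[of _ ?K]) (use \<phi>(1) in auto)
  next
    case (2 \<phi>)
    then have \<phi>: "\<phi> \<in> extensional ?K" "\<And>j. j \<in> ?K \<Longrightarrow> Poly_Mapping.keys (\<phi> j) \<subseteq> X"
        "\<And>j x. j \<in> ?K \<Longrightarrow> ?L (\<phi> j) (\<sigma> x) = ?L (\<phi> j) x" "\<And>j. j \<in> ?K \<Longrightarrow> mdeg (\<phi> j) = ?L \<tau> j"
      by (auto simp: PiE_def Pi_def inv_exps_def)
    have "(\<Sum>x\<in>X. ?f \<phi> x) = (\<Sum>x\<in>X. \<Sum>j\<in>?K. ?S j (?L (\<phi> j) x))"
      by simp
    also have "\<dots> = \<tau>"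
    proof (rule poly_mapping_eqI)
      fix j
      have "?L (\<Sum>x\<in>X. \<Sum>j\<in>?K. ?S j (?L (\<phi> j) x)) j = (\<Sum>x\<in>X. if j \<in> ?K then ?L (\<phi> j) x else 0)"
        by (simp add: lookup_sum[of _ X] lookup_sum_single)
      also have "\<dots> = ?L \<tau> j"
        using \<phi>(4)[of j] mdeg_superset[OF X \<phi>(2)[of j]]
        by (cases "j \<in> ?K") (auto simp: in_keys_iff)
      finally show "?L (\<Sum>x\<in>X. \<Sum>j\<in>?K. ?S j (?L (\<phi> j) x)) j = ?L \<tau> j" .
    qed
    finally show ?case
      using \<phi>(3) by (auto simp: fillings_def \<sigma>X)
  next
    case (3 F)
    then have F: "F \<in> fillings X \<tau>" and inv: "\<And>x. x \<in> X \<Longrightarrow> F (\<sigma> x) = F x"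
      by auto
    have "?f (?b F) x = F x" if "x \<in> X" for x
    proof (rule poly_mapping_eqI)
      fix j
      \<comment> \<open>Variables absent from \<tau> are absent from every \<open>F x\<close>, so
        restricting the columns to \<open>?K\<close> loses nothing.\<close>
      have "?L (F x) j \<le> ?L \<tau> j"
        unfolding lookup_fillings[OF F, symmetric] using X that by (intro member_le_sum) auto
      then show "?L (?f (?b F) x) j = ?L (F x) j"
        using that X by (auto simp: lookup_sum_single in_keys_iff)
    qed
    then show ?case
      by (intro extensionalityI[of _ X]) (use F in \<open>auto simp: fillings_def PiE_def\<close>)
  next
    case (4 F)
    then have F: "F \<in> fillings X \<tau>" and inv: "\<And>x. x \<in> X \<Longrightarrow> F (\<sigma> x) = F x"
      by auto
    have "(\<Sum>x\<in>X. ?S x (?L (F x) j)) \<in> inv_exps X \<sigma> (?L \<tau> j)" for j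
      unfolding inv_exps_def
      using X inv lookup_fillings[OF F]
      by (auto simp: lookup_sum_single \<sigma>X mdeg_sum in_keys_iff split: if_splits)
    then show ?case by auto
  next
    case (5 \<phi>)
    have "(\<Sum>j\<in>?K. \<phi> j) = profile X (?f \<phi>)"
    proof (rule poly_mapping_eqI)
      fix x
      have "?L (\<Sum>j\<in>?K. \<phi> j) x = 0" if "x \<notin> X"
        using 5 that by (auto simp: lookup_sum PiE_def Pi_def inv_exps_def in_keys_iff subset_iff)
      then show "?L (\<Sum>j\<in>?K. \<phi> j) x = ?L (profile X (?f \<phi>)) x"
        using X by (simp add: profile_def lookup_sum_single mdeg_sum) (simp add: lookup_sum)
    qed
    then show ?case by simp
  qed
qed

text \<open>Weights are nonzero, so the positions of the nonzero entries determine the permutation.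
  Their values then determine the tuple at all points, since each point is some \<sigma> y.\<close>

lemma gen_perm_mat_inj:
  assumes T: "tuple_group n T"
  shows "inj_on (\<lambda>(\<sigma>, \<zeta>). gen_perm_mat n \<zeta> \<sigma>) ({\<sigma>. \<sigma> permutes {1..n}} \<times> T)"
proof (rule inj_onI, clarify)
  fix \<sigma> \<zeta> \<rho> \<xi>
  assume \<sigma>: "\<sigma> permutes {1..n}" and \<rho>: "\<rho> permutes {1..n}" and \<zeta>: "\<zeta> \<in> T" and \<xi>: "\<xi> \<in> T"
    and eq: "gen_perm_mat n \<zeta> \<sigma> = gen_perm_mat n \<xi> \<rho>"
  have T': "\<zeta> x \<noteq> 0" "\<xi> x \<noteq> 0" if "x \<in> {1..n}" for x
    using T \<zeta> \<xi> that by (auto simp: tuple_group_def PiE_def Pi_def)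
  have entry: "(if x = \<sigma> y then \<zeta> x else 0) = (if x = \<rho> y then \<xi> x else 0)"
    if "x \<in> {1..n}" "y \<in> {1..n}" for x y
  proof -
    from that obtain i j where "x = Suc i" "y = Suc j" "i < n" "j < n"
      by (cases x; cases y) auto
    then show ?thesis
      using arg_cong[OF eq, of "\<lambda>A. A $$ (i, j)"] by (simp only: gen_perm_mat_index)
  qed
  have same: "\<sigma> y = \<rho> y" "\<zeta> (\<sigma> y) = \<xi> (\<sigma> y)" if "y \<in> {1..n}" for y
    using entry[of "\<sigma> y" y] T'(1)[of "\<sigma> y"] that permutes_in_image[OF \<sigma>, of y]
    by (auto split: if_splits)
  have "\<sigma> y = \<rho> y" for y
    using same(1)[of y] permutes_not_in[OF \<sigma>, of y] permutes_not_in[OF \<rho>, of y] by metis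
  moreover have "\<zeta> x = \<xi> x" for x
  proof (cases "x \<in> {1..n}")
    case True
    then have "Hilbert_Choice.inv \<sigma> x \<in> {1..n}"
      by (simp only: permutes_in_image[OF permutes_inv[OF \<sigma>]])
    then show ?thesis
      using same(2)[of "Hilbert_Choice.inv \<sigma> x"] permutes_inverses(1)[OF \<sigma>] by simp
  next
    case False
    moreover have "\<zeta> \<in> extensional {1..n}" "\<xi> \<in> extensional {1..n}"
      using T \<zeta> \<xi> unfolding tuple_group_def PiE_def by blast+
    ultimately show ?thesis
      using False by (metis extensional_arb)
  qed
  ultimately show "\<sigma> = \<rho> \<and> \<zeta> = \<xi>"
    by (auto intro: ext)
qed

definition good_fillings :: "nat \<Rightarrow> (nat \<Rightarrow> complex) set \<Rightarrow> monom_exp \<Rightarrow> (nat \<Rightarrow> monom_exp) set" where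
  "good_fillings n T \<tau> = {F \<in> fillings {1..n} \<tau>. \<forall>\<zeta>\<in>T. mweight \<zeta> (profile {1..n} F) = 1}"

lemma expectation_gen_perm_group:
  assumes T: "tuple_group n T" and H: "finite H" "H \<noteq> {}" "\<And>\<sigma>. \<sigma> \<in> H \<Longrightarrow> \<sigma> permutes {1..n}"
  shows "expectation (gen_perm_group n T H) (\<lambda>g. sym_value (sym_h_part \<tau>) (eigenvalue_list g)) =
    of_nat (\<Sum>\<sigma>\<in>H. card {F \<in> good_fillings n T \<tau>. \<forall>x\<in>{1..n}. F (\<sigma> x) = F x}) / of_nat (card H)"
proof -
  let ?X = "{1..n}" and ?K = "Poly_Mapping.keys \<tau>"
  let ?m = "\<lambda>(\<sigma>, \<zeta>). gen_perm_mat n \<zeta> \<sigma>"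
  let ?v = "\<lambda>g. sym_value (sym_h_part \<tau>) (eigenvalue_list g)"
  have finT: "finite T" and neT: "T \<noteq> {}"
    using T by (auto simp: tuple_group_def)
  have G: "gen_perm_group n T H = ?m ` (H \<times> T)"
    by (auto simp: gen_perm_group_def gen_perm_mat_def image_iff)
  have inj: "inj_on ?m (H \<times> T)"
    by (rule inj_on_subset[OF gen_perm_mat_inj[OF T]]) (use H in auto)
  have inner: "(\<Sum>\<zeta>\<in>T. ?v (gen_perm_mat n \<zeta> \<sigma>)) =
      of_nat (card T) * of_nat (card {F \<in> good_fillings n T \<tau>. \<forall>x\<in>?X. F (\<sigma> x) = F x})" if "\<sigma> \<in> H" for \<sigma>
  proof -
    note \<sigma> = H(3)[OF that]
    let ?Fix = "{F. F \<in> fillings ?X \<tau> \<and> (\<forall>x\<in>?X. F (\<sigma> x) = F x)}"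
    have fin: "finite ?Fix"
      using finite_fillings[of ?X \<tau>] by simp
    \<comment> \<open>Expanding the product over the variables selects one invariant exponent vector
      for each of them; the resulting families are then read as fillings.\<close>
    have "?v (gen_perm_mat n \<zeta> \<sigma>) = (\<Sum>F\<in>?Fix. mweight \<zeta> (profile ?X F))" for \<zeta>
      unfolding sum_families_eq_sum_fillings[OF finite_atLeastAtMost \<sigma>, symmetric]
        sym_value_gen_perm_mat[OF \<sigma>] inv_sum_def mweight_sum
      by (rule prod_sum_PiE) (auto intro: finite_inv_exps)
    then have "(\<Sum>\<zeta>\<in>T. ?v (gen_perm_mat n \<zeta> \<sigma>)) = (\<Sum>F\<in>?Fix. \<Sum>\<zeta>\<in>T. mweight \<zeta> (profile ?X F))"
      by (simp add: sum.swap[of _ T])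
    also have "\<dots> = (\<Sum>F\<in>?Fix. if \<forall>\<zeta>\<in>T. mweight \<zeta> (profile ?X F) = 1 then of_nat (card T) else 0)"
      by (intro sum.cong refl character_sum[OF T]) (auto simp: profile_def lookup_sum_single in_keys_iff split: if_splits)
    also have "\<dots> = (\<Sum>F\<in>{F \<in> ?Fix. \<forall>\<zeta>\<in>T. mweight \<zeta> (profile ?X F) = 1}. of_nat (card T))"
      using fin by (simp only: sum.inter_filter)
    also have "{F \<in> ?Fix. \<forall>\<zeta>\<in>T. mweight \<zeta> (profile ?X F) = 1} =
        {F \<in> good_fillings n T \<tau>. \<forall>x\<in>?X. F (\<sigma> x) = F x}"
      by (auto simp: good_fillings_def)
    finally show ?thesis by (simp add: mult.commute)
  qed
  have "sum ?v (?m ` (H \<times> T)) = (\<Sum>\<sigma>\<in>H. \<Sum>\<zeta>\<in>T. ?v (gen_perm_mat n \<zeta> \<sigma>))"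
    by (subst sum.reindex[OF inj]) (simp add: sum.cartesian_product case_prod_unfold)
  then have "expectation (gen_perm_group n T H) ?v = (\<Sum>\<sigma>\<in>H. \<Sum>\<zeta>\<in>T. ?v (gen_perm_mat n \<zeta> \<sigma>)) / of_nat (card (H \<times> T))"
    by (simp only: expectation_def G card_image[OF inj])
  also have "\<dots> = of_nat (\<Sum>\<sigma>\<in>H. card {F \<in> good_fillings n T \<tau>. \<forall>x\<in>?X. F (\<sigma> x) = F x}) / of_nat (card H)"
    using finT neT by (simp add: inner card_cartesian_product flip: sum_distrib_left)
  finally show ?thesis .
qed

text \<open>
  Burnside's lemma with the orbits given as the fibres of an invariant \<open>M\<close>.
\<close>

lemma burnside_fibres:
  assumes "finite \<Omega>" "finite H"
    and act: "\<And>F \<sigma>. F \<in> \<Omega> \<Longrightarrow> \<sigma> \<in> H \<Longrightarrow> act F \<sigma> \<in> \<Omega>"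
      "\<And>F \<rho> \<sigma>. F \<in> \<Omega> \<Longrightarrow> \<rho> \<in> H \<Longrightarrow> \<sigma> \<in> H \<Longrightarrow> act F (mul \<rho> \<sigma>) = act (act F \<rho>) \<sigma>"
    and mul: "\<And>\<rho>. \<rho> \<in> H \<Longrightarrow> bij_betw (mul \<rho>) H H"
    and M: "\<And>F \<sigma>. F \<in> \<Omega> \<Longrightarrow> \<sigma> \<in> H \<Longrightarrow> M (act F \<sigma>) = M F"
      "\<And>F F'. F \<in> \<Omega> \<Longrightarrow> F' \<in> \<Omega> \<Longrightarrow> M F = M F' \<Longrightarrow> \<exists>\<rho>\<in>H. F' = act F \<rho>"
  shows "(\<Sum>\<sigma>\<in>H. card {F \<in> \<Omega>. act F \<sigma> = F}) = card H * card (M ` \<Omega>)"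
proof -
  \<comment> \<open>Orbit-stabilizer: if F = \<open>act F0 \<rho>\<close>, then left multiplication
    by \<rho> carries the stabilizer of F to the elements taking F0 to F. As F runs through the
    fibre, these sets partition \<open>H\<close>.\<close>
  have fibre: "(\<Sum>F | F \<in> \<Omega> \<and> M F = m. card {\<sigma> \<in> H. act F \<sigma> = F}) = card H" if "m \<in> M ` \<Omega>" for m
  proof -
    from that obtain F0 where F0: "F0 \<in> \<Omega>" "M F0 = m" by blast
    have "card {\<sigma> \<in> H. act F \<sigma> = F} = card {\<sigma> \<in> H. act F0 \<sigma> = F}" if F: "F \<in> \<Omega>" "M F = m" for F
    proof -
      obtain \<rho> where \<rho>: "\<rho> \<in> H" "F = act F0 \<rho>"
        using M(2)[of F0 F] F F0 by auto
      have "act F0 (mul \<rho> \<sigma>) = act F \<sigma>" if "\<sigma> \<in> H" for \<sigma>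
        using act(2)[OF F0(1) \<rho>(1) that] \<rho>(2) by simp
      then have "bij_betw (mul \<rho>) {\<sigma> \<in> H. act F \<sigma> = F} {\<sigma> \<in> H. act F0 \<sigma> = F}"
        using mul[OF \<rho>(1)] by (auto simp: bij_betw_def inj_on_def image_iff) (metis imageE)
      then show ?thesis by (rule bij_betw_same_card)
    qed
    then have "(\<Sum>F | F \<in> \<Omega> \<and> M F = m. card {\<sigma> \<in> H. act F \<sigma> = F}) =
        (\<Sum>F | F \<in> \<Omega> \<and> M F = m. \<Sum>\<sigma> | \<sigma> \<in> H \<and> act F0 \<sigma> = F. 1)"
      by (intro sum.cong) auto
    also have "\<dots> = card H"
      using assms(1,2) act(1)[OF F0(1)] M(1)[OF F0(1)] F0(2)
      by (subst sum.group) auto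
    finally show ?thesis .
  qed
  have "(\<Sum>\<sigma>\<in>H. card {F \<in> \<Omega>. act F \<sigma> = F}) = (\<Sum>F\<in>\<Omega>. card {\<sigma> \<in> H. act F \<sigma> = F})"
    using sum.swap_restrict[OF assms(2,1), of "\<lambda>_ _. 1 :: nat" "\<lambda>\<sigma> F. act F \<sigma> = F"] by simp
  also have "\<dots> = (\<Sum>m\<in>M ` \<Omega>. \<Sum>F | F \<in> \<Omega> \<and> M F = m. card {\<sigma> \<in> H. act F \<sigma> = F})"
    using assms(1) by (rule sum.image_gen)
  also have "\<dots> = card H * card (M ` \<Omega>)"
    by (simp add: fibre)
  finally show ?thesis .
qed

section \<open>Contents of fillings and orbits of permutations\<close>

definition filling_content :: "nat set \<Rightarrow> (nat \<Rightarrow> monom_exp) \<Rightarrow> monom_exp multiset" where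
  "filling_content X F = filter_mset (\<lambda>\<alpha>. \<alpha> \<noteq> 0) (image_mset F (mset_set X))"

text \<open>Precomposition is a right action, as \<open>burnside_fibres\<close> requires; the
  restriction keeps the result extensional.\<close>

definition permute_filling :: "nat set \<Rightarrow> (nat \<Rightarrow> monom_exp) \<Rightarrow> (nat \<Rightarrow> nat) \<Rightarrow> nat \<Rightarrow> monom_exp" where
  "permute_filling X F \<sigma> = restrict (F \<circ> \<sigma>) X"

lemma image_mset_permutes:
  assumes "\<sigma> permutes X"
  shows "image_mset (F \<circ> \<sigma>) (mset_set X) = image_mset F (mset_set X)"
  using image_mset_mset_set[OF permutes_inj_on[OF assms], of X]
  by (simp add: image_mset.compositionality [symmetric] permutes_image[OF assms])

lemma content_permute:
  assumes "\<sigma> permutes X"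
  shows "filling_content X (permute_filling X F \<sigma>) = filling_content X F"
proof -
  have "image_mset (permute_filling X F \<sigma>) (mset_set X) = image_mset (F \<circ> \<sigma>) (mset_set X)"
    by (cases "finite X") (auto simp: permute_filling_def intro: image_mset_cong)
  then show ?thesis
    unfolding filling_content_def by (simp only: image_mset_permutes[OF assms])
qed

lemma permute_fillings:
  assumes "\<sigma> permutes X" "F \<in> fillings X \<tau>"
  shows "permute_filling X F \<sigma> \<in> fillings X \<tau>"
proof -
  have "(\<Sum>x\<in>X. permute_filling X F \<sigma> x) = (\<Sum>x\<in>X. F (\<sigma> x))"
    by (simp add: permute_filling_def)
  also have "\<dots> = (\<Sum>x\<in>X. F x)"
    by (rule sum.reindex_bij_betw) (rule permutes_imp_bij[OF assms(1)])
  finally show ?thesis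
    using assms(2) by (auto simp: fillings_def permute_filling_def)
qed

lemma sum_mset_filter_nonzero: "\<Sum>\<^sub># (filter_mset (\<lambda>\<alpha>. \<alpha> \<noteq> 0) M) = \<Sum>\<^sub># (M :: monom_exp multiset)"
  by (induction M) auto

lemma sum_mset_content: "F \<in> fillings X \<tau> \<Longrightarrow> \<Sum>\<^sub># (filling_content X F) = \<tau>"
  by (simp add: filling_content_def sum_mset_filter_nonzero fillings_def sum_unfold_sum_mset)

lemma set_mset_content: "finite X \<Longrightarrow> set_mset (filling_content X F) = F ` X - {0}"
  by (auto simp: filling_content_def)

text \<open>The number of points is fixed, so the content also determines how often the trivial
  monomial is taken.\<close>

lemma image_mset_eq_content:
  "finite X \<Longrightarrow> image_mset F (mset_set X) = filling_content X F + replicate_mset (card X - size (filling_content X F)) 0"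
proof -
  assume X: "finite X"
  let ?M = "image_mset F (mset_set X)"
  have M: "?M = filling_content X F + filter_mset (\<lambda>\<alpha>. \<not> \<alpha> \<noteq> 0) ?M"
    unfolding filling_content_def by (rule multiset_partition)
  have z: "filter_mset (\<lambda>\<alpha>. \<not> \<alpha> \<noteq> 0) ?M = replicate_mset (count ?M 0) 0"
    by (simp add: filter_eq_replicate_mset)
  have "size ?M = size (filling_content X F) + count ?M 0"
    using arg_cong[OF M, of size] unfolding z by simp
  then show ?thesis using M z by simp
qed

text \<open>The members of \<open>N\<close> are placed on the first points and the remaining ones
  get the trivial monomial. List positions start at 0 and points at 1, hence
  \<open>x - 1\<close>.\<close>

lemma content_surj:
  assumes X: "X = {1..n}" and N: "N \<in> all_msets (UNIV - {0}) \<tau>" "size N \<le> n"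
  obtains F where "F \<in> fillings X \<tau>" "filling_content X F = N"
proof -
  obtain xs where xs: "mset xs = N"
    using ex_mset by blast
  define L where "L = xs @ replicate (n - length xs) (0 :: monom_exp)"
  have len: "length L = n"
    using N(2) by (auto simp: L_def xs [symmetric])
  define F where "F = restrict (\<lambda>x. L ! (x - 1)) X"
  have X': "mset_set X = image_mset Suc (mset_set {0..<n})"
    by (simp add: X image_mset_mset_set image_Suc_atLeastLessThan atLeastLessThanSuc_atLeastAtMost)
  have "image_mset F (mset_set X) = image_mset (\<lambda>x. L ! (x - 1)) (mset_set X)"
    by (intro image_mset_cong) (auto simp: F_def X)
  also have "\<dots> = mset (map (\<lambda>i. L ! i) [0..<n])"
    by (simp add: X' image_mset.compositionality comp_def flip: mset_upt)
  also have "\<dots> = mset L"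
    by (simp add: len [symmetric] map_nth)
  also have "\<dots> = N + replicate_mset (n - length xs) 0"
    by (simp add: L_def xs)
  finally have M: "image_mset F (mset_set X) = N + replicate_mset (n - length xs) 0" .
  have "filter_mset (\<lambda>\<alpha>. \<alpha> \<noteq> 0) N = N"
    using N(1) by (auto simp: all_msets_def filter_mset_eq_conv)
  then have "filling_content X F = N"
    by (simp add: filling_content_def M)
  moreover have "(\<Sum>x\<in>X. F x) = \<tau>"
    using N(1) by (simp add: sum_unfold_sum_mset M all_msets_def)
  then have "F \<in> fillings X \<tau>"
    by (auto simp: fillings_def F_def)
  ultimately show ?thesis using that by blast
qed

text \<open>
  Some permutation of \<open>{1..n}\<close> carries \<open>F'\<close> to \<open>F\<close>; it only matters on the at most \<open>k\<close> points where
  \<open>F'\<close> is nontrivial, and there an element of \<open>H\<close> agrees with it.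
\<close>

lemma k_transitive_orbit:
  assumes H: "\<And>\<sigma>. \<sigma> \<in> H \<Longrightarrow> \<sigma> permutes {1..n}" and tr: "k_transitive n k H" and le: "mdeg \<tau> \<le> k"
    and F: "F \<in> fillings {1..n} \<tau>" "F' \<in> fillings {1..n} \<tau>"
    and eq: "filling_content {1..n} F = filling_content {1..n} F'"
  shows "\<exists>\<sigma>\<in>H. F' = permute_filling {1..n} F \<sigma>"
proof -
  let ?X = "{1..n}"
  have "image_mset F' (mset_set ?X) = image_mset F (mset_set ?X)"
    using eq by (simp add: image_mset_eq_content)
  then obtain \<pi> where \<pi>: "\<pi> permutes ?X" "\<forall>x\<in>?X. F' x = F (\<pi> x)"
    using image_mset_eq_implies_permutes[of ?X F' F] by blast
  let ?S = "{x \<in> ?X. F' x \<noteq> 0}"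
  have "card ?S = (\<Sum>x\<in>?S. 1)"
    by simp
  also have "\<dots> \<le> (\<Sum>x\<in>?S. mdeg (F' x))"
    by (intro sum_mono) (auto simp: Suc_le_eq simp flip: mdeg_eq_0_iff)
  also have "\<dots> \<le> (\<Sum>x\<in>?X. mdeg (F' x))"
    by (intro sum_mono2) auto
  also have "\<dots> \<le> k"
    using le mdeg_fillings[OF F(2)] by simp
  finally have "card ?S \<le> k" .
  moreover have kn: "k \<le> card ?X"
    using tr by (simp add: k_transitive_def)
  \<comment> \<open>\<open>k_transitive\<close> speaks of tuples of length exactly \<open>k\<close>,
    so a smaller support is enlarged to \<open>k\<close> points.\<close>
  ultimately obtain Y where Y: "?S \<subseteq> Y" "Y \<subseteq> ?X" "card Y = k"
    using exists_subset_between[of ?S k ?X] that by (metis (no_types, lifting) finite_atLeastAtMost mem_Collect_eq subsetI)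
  then obtain xs where xs: "set xs = Y" "distinct xs"
    using finite_distinct_list[of Y] finite_subset[OF Y(2)] by auto
  then have len: "length xs = k"
    using Y(3) distinct_card by force
  have "distinct (map \<pi> xs)"
    using xs(2) permutes_inj_on[OF \<pi>(1)] by (simp add: distinct_map)
  moreover have "set (map \<pi> xs) \<subseteq> ?X"
    using xs(1) Y(2) permutes_in_image[OF \<pi>(1)] by auto
  ultimately obtain \<sigma> where \<sigma>: "\<sigma> \<in> H" "map \<sigma> xs = map \<pi> xs"
    using tr xs Y(2) len unfolding k_transitive_def by (metis length_map)
  have same: "\<sigma> x = \<pi> x" if "x \<in> Y" for x
    using \<sigma>(2) that xs(1) by auto
  have "F (\<sigma> x) = F' x" if x: "x \<in> ?X" for x
  proof (cases "x \<in> Y")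
    case True
    then show ?thesis using same \<pi>(2) x by simp
  next
    case False
    then have "F' x = 0" using Y(1) x by auto
    \<comment> \<open>\<pi> maps the support of \<open>F'\<close> onto that of \<open>F\<close>, and
      \<sigma> agrees with it there. By injectivity \<sigma> sends no point outside \<open>Y\<close>
      into the support of \<open>F\<close>.\<close>
    moreover have "F (\<sigma> x) = 0"
    proof (rule ccontr)
      assume ne: "F (\<sigma> x) \<noteq> 0"
      have \<sigma>x: "\<sigma> x \<in> ?X"
        using x by (simp only: permutes_in_image[OF H[OF \<sigma>(1)]])
      then obtain z where z: "z \<in> ?X" "\<pi> z = \<sigma> x"
        using permutes_image[OF \<pi>(1)] by (metis imageE)
      then have "F' z \<noteq> 0" using \<pi>(2) ne by simp
      then have "z \<in> Y" using Y(1) z(1) by auto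
      then have "\<sigma> z = \<sigma> x" using same z(2) by simp
      then have "z = x" using permutes_inj[OF H[OF \<sigma>(1)]] by (simp add: inj_eq)
      then show False using False \<open>z \<in> Y\<close> by simp
    qed
    ultimately show ?thesis by simp
  qed
  then have "F' = permute_filling ?X F \<sigma>"
    by (intro extensionalityI[of _ ?X]) (use F(2) in \<open>auto simp: fillings_def permute_filling_def PiE_def\<close>)
  then show ?thesis using \<sigma>(1) by blast
qed

lemma subgroup_sym_group:
  assumes "subgroup H (sym_group n)"
  shows "finite H" "H \<noteq> {}" "\<sigma> \<in> H \<Longrightarrow> \<sigma> permutes {1..n}"
    "\<rho> \<in> H \<Longrightarrow> bij_betw ((\<circ>) \<rho>) H H"
proof -
  have sub: "H \<subseteq> {\<sigma>. \<sigma> permutes {1..n}}"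
    using subgroup.subset[OF assms] by (auto simp: sym_group_carrier)
  then show "\<sigma> \<in> H \<Longrightarrow> \<sigma> permutes {1..n}" by auto
  show fin: "finite H"
    using sub by (rule finite_subset) (simp add: finite_permutations)
  show "H \<noteq> {}"
    using subgroup.one_closed[OF assms] by auto
  show "bij_betw ((\<circ>) \<rho>) H H" if "\<rho> \<in> H"
  proof -
    have inj: "inj_on ((\<circ>) \<rho>) H"
      using permutes_inj[of \<rho>] sub that by (intro inj_onI) (auto simp: fun.inj_map inj_eq dest: injD[OF fun.inj_map])
    have "(\<circ>) \<rho> ` H \<subseteq> H"
      using subgroup.m_closed[OF assms that] by (auto simp: sym_group_mult)
    then show ?thesis
      using endo_inj_surj[OF fin _ inj] inj by (simp add: bij_betw_def)
  qed
qed

text \<open>Contents are constant on orbits and, by \<open>k_transitive_orbit\<close>, separate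
  them. Burnside's lemma thus turns the average number of fixed good fillings into the number of
  their contents.\<close>

lemma expectation_eq_card_content:
  assumes T: "tuple_group n T" and sub: "subgroup H (sym_group n)" and tr: "k_transitive n k H"
    and le: "mdeg \<tau> \<le> k"
    and inv: "\<And>F \<sigma>. F \<in> good_fillings n T \<tau> \<Longrightarrow> \<sigma> permutes {1..n} \<Longrightarrow> permute_filling {1..n} F \<sigma> \<in> good_fillings n T \<tau>"
  shows "expectation (gen_perm_group n T H) (\<lambda>g. sym_value (sym_h_part \<tau>) (eigenvalue_list g)) =
    of_nat (card (filling_content {1..n} ` good_fillings n T \<tau>))"
proof -
  let ?X = "{1..n}"
  let ?G = "good_fillings n T \<tau>"
  note H = subgroup_sym_group[OF sub]
  have G: "F \<in> fillings ?X \<tau>" if "F \<in> ?G" for F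
    using that by (simp add: good_fillings_def)
  have fix_iff: "permute_filling ?X F \<sigma> = F \<longleftrightarrow> (\<forall>x\<in>?X. F (\<sigma> x) = F x)" if "F \<in> ?G" for F \<sigma>
  proof
    assume "\<forall>x\<in>?X. F (\<sigma> x) = F x"
    then show "permute_filling ?X F \<sigma> = F"
      by (intro extensionalityI[of _ ?X]) (use G[OF that] in \<open>auto simp: fillings_def permute_filling_def PiE_def\<close>)
  qed (auto simp: permute_filling_def fun_eq_iff restrict_def comp_def, metis)
  have "(\<Sum>\<sigma>\<in>H. card {F \<in> ?G. permute_filling ?X F \<sigma> = F}) = card H * card (filling_content ?X ` ?G)"
  proof (rule burnside_fibres[where mul = "(\<circ>)"])
    show "finite ?G"
      using finite_fillings[of ?X \<tau>] by (simp add: good_fillings_def)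
    show "finite H" by (rule H)
    show "permute_filling ?X F \<sigma> \<in> ?G" if "F \<in> ?G" "\<sigma> \<in> H" for F \<sigma>
      using inv[OF that(1) H(3)[OF that(2)]] .
    show "permute_filling ?X F (\<rho> \<circ> \<sigma>) = permute_filling ?X (permute_filling ?X F \<rho>) \<sigma>" if "\<sigma> \<in> H" for F \<rho> \<sigma>
      using permutes_in_image[OF H(3)[OF that]] unfolding permute_filling_def restrict_def comp_def by metis
    show "bij_betw ((\<circ>) \<rho>) H H" if "\<rho> \<in> H" for \<rho>
      using that by (rule H)
    show "filling_content ?X (permute_filling ?X F \<sigma>) = filling_content ?X F" if "\<sigma> \<in> H" for F \<sigma>
      using content_permute[OF H(3)[OF that]] .
    show "\<exists>\<rho>\<in>H. F' = permute_filling ?X F \<rho>"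
      if "F \<in> ?G" "F' \<in> ?G" "filling_content ?X F = filling_content ?X F'" for F F'
      using k_transitive_orbit[OF H(3) tr le G[OF that(1)] G[OF that(2)] that(3)] .
  qed
  also have "(\<Sum>\<sigma>\<in>H. card {F \<in> ?G. permute_filling ?X F \<sigma> = F}) =
      (\<Sum>\<sigma>\<in>H. card {F \<in> ?G. \<forall>x\<in>?X. F (\<sigma> x) = F x})"
    using fix_iff by (intro sum.cong refl arg_cong[of _ _ card]) blast
  finally show ?thesis
    using H(1,2) by (simp add: expectation_gen_perm_group[OF T H(1-3)])
qed


section \<open>Coefficients of the moment generating function\<close>

lemma down_closed_eq_lessThan:
  fixes D :: "nat set"
  assumes "finite D" "\<And>i j. j \<in> D \<Longrightarrow> i \<le> j \<Longrightarrow> i \<in> D"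
  shows "D = {..<card D}"
proof (cases "D = {}")
  case False
  have "D = {..Max D}"
    using assms Max_in[OF assms(1) False] by (auto intro: Max_ge)
  then show ?thesis
    by (metis card_atMost lessThan_Suc_atMost)
qed simp

text \<open>For \<open>v > 0\<close> the set of indices with part at least \<open>v\<close> is a
  finite initial segment, hence determined by its cardinality, which rearranging preserves.\<close>

lemma partition_rearrangement_unique:
  assumes \<tau>: "is_partition \<tau>" and \<rho>: "is_partition \<rho>"
    and \<pi>: "bij \<pi>" "Poly_Mapping.lookup \<rho> = Poly_Mapping.lookup \<tau> \<circ> \<pi>"
  shows "\<rho> = \<tau>"
proof -
  let ?L = Poly_Mapping.lookup
  have level: "{j. v \<le> ?L \<alpha> j} = {..<card {j. v \<le> ?L \<alpha> j}}" if "is_partition \<alpha>" "v > 0" for \<alpha> v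
  proof (rule down_closed_eq_lessThan)
    show "finite {j. v \<le> ?L \<alpha> j}"
      by (rule finite_subset[OF _ finite_keys[of \<alpha>]]) (use that(2) in \<open>auto simp: in_keys_iff\<close>)
  qed (use that(1) in \<open>auto simp: is_partition_def dest: antimonoD order.trans\<close>)
  have image: "{j. v \<le> ?L \<tau> j} = \<pi> ` {j. v \<le> ?L \<rho> j}" for v
    using \<pi>(1) unfolding \<pi>(2) comp_def by (auto simp: image_iff) (metis bij_pointE)
  then have "card {j. v \<le> ?L \<tau> j} = card {j. v \<le> ?L \<rho> j}" for v
    by (simp only: image card_image[OF inj_on_subset[OF bij_is_inj[OF \<pi>(1)] subset_UNIV]])
  then have eq: "v \<le> ?L \<tau> j \<longleftrightarrow> v \<le> ?L \<rho> j" if "v > 0" for v j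
    using arg_cong[OF level[OF \<tau> that], of "\<lambda>A. j \<in> A"] arg_cong[OF level[OF \<rho> that], of "\<lambda>A. j \<in> A"]
    by simp
  show ?thesis
  proof (rule poly_mapping_eqI)
    fix j
    show "?L \<rho> j = ?L \<tau> j"
      using eq[of "?L \<tau> j" j] eq[of "?L \<rho> j" j] by (cases "?L \<tau> j = 0"; cases "?L \<rho> j = 0") auto
  qed
qed

text \<open>Among the \<open>sym_m \<rho>\<close> with \<rho> a partition, only
  \<open>sym_m \<tau>\<close> contains the monomial \<tau>, so the infinite sum has at most one
  nonzero term there.\<close>

lemma pcoeff_sigma_mgf:
  assumes "is_partition \<tau>"
  shows "pcoeff (sigma_mgf G) \<tau> =
    expectation G (\<lambda>g. sym_value (sym_h_part \<tau>) (eigenvalue_list g))"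
proof -
  let ?e = "\<lambda>\<tau>. expectation G (\<lambda>g. sym_value (sym_h_part \<tau>) (eigenvalue_list g))"
  have m: "pcoeff (sym_m \<rho>) \<tau> = (if \<rho> = \<tau> then 1 else (0 :: complex))" if "is_partition \<rho>" for \<rho>
  proof -
    have "(\<exists>\<pi>. bij \<pi> \<and> Poly_Mapping.lookup \<tau> = Poly_Mapping.lookup \<rho> \<circ> \<pi>) \<longleftrightarrow> \<rho> = \<tau>"
      using partition_rearrangement_unique[OF that assms] by (metis bij_id comp_id)
    then show ?thesis by (simp add: sym_m_def)
  qed
  let ?c = "\<lambda>\<rho>. pcoeff (pconst (?e \<rho>) * sym_m \<rho>) \<tau>"
  have "pcoeff (sigma_mgf G) \<tau> = (\<Sum>\<rho> | \<rho> \<in> {\<rho>. is_partition \<rho>} \<and> ?c \<rho> \<noteq> 0. ?c \<rho>)"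
    by (simp add: sigma_mgf_def psum_def)
  also have "\<dots> = (\<Sum>\<rho>\<in>{\<tau>}. ?c \<rho>)"
    by (rule sum.mono_neutral_left) (use assms m in \<open>auto simp: pcoeff_pconst_mult split: if_splits\<close>)
  also have "\<dots> = ?e \<tau>"
    using m[OF assms] by (simp add: pcoeff_pconst_mult)
  finally show ?thesis .
qed

section \<open>Tuples of roots of unity\<close>

lemma finite_roots_of_unity: "r \<ge> 1 \<Longrightarrow> finite {z :: complex. z ^ r = 1}"
  using bij_betw_finite[OF bij_betw_roots_unity[of r]] by auto

lemma tuple_group_mu_tuples:
  assumes "r \<ge> 1"
  shows "tuple_group n (mu_tuples r n)"
proof -
  have "(\<lambda>x\<in>{1..n}. 1) \<in> mu_tuples r n"
    by (auto simp: mu_tuples_def)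
  moreover have "z \<noteq> 0" if "z ^ r = 1" for z :: complex
    using that assms by (auto simp: power_0_left)
  moreover have "finite (mu_tuples r n)"
    unfolding mu_tuples_def using assms by (intro finite_PiE finite_roots_of_unity) auto
  moreover have "mu_tuples r n \<subseteq> {1..n} \<rightarrow>\<^sub>E UNIV - {0}"
    using calculation(2) by (auto simp: mu_tuples_def PiE_def Pi_def)
  moreover have "(\<lambda>x\<in>{1..n}. \<chi> x * \<zeta> x) \<in> mu_tuples r n"
    if "\<chi> \<in> mu_tuples r n" "\<zeta> \<in> mu_tuples r n" for \<chi> \<zeta>
    using that by (auto simp: mu_tuples_def PiE_def Pi_def power_mult_distrib)
  ultimately show ?thesis
    unfolding tuple_group_def by blast
qed

lemma primitive_root_power:
  assumes "r \<ge> 1"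
  shows "cis (2 * pi / of_nat r) ^ m = 1 \<longleftrightarrow> r dvd m"
proof -
  let ?\<omega> = "cis (2 * pi / of_nat r)"
  have r: "?\<omega> ^ r = 1"
    using assms by (simp add: DeMoivre)
  have "?\<omega> ^ m = ?\<omega> ^ (r * (m div r) + m mod r)"
    by simp
  also have "\<dots> = ?\<omega> ^ (m mod r)"
    by (simp only: power_add power_mult r power_one mult_1)
  also have "\<dots> = cis (2 * pi * real (m mod r) / real r)"
    by (simp add: DeMoivre mult_ac)
  finally have eq: "?\<omega> ^ m = cis (2 * pi * real (m mod r) / real r)" .
  have "inj_on (\<lambda>k. cis (2 * pi * real k / real r)) {..<r}"
    using bij_betw_roots_unity[of r] assms by (simp add: bij_betw_def)
  from inj_onD[OF this, of "m mod r" 0] have "m mod r = 0" if "?\<omega> ^ m = 1"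
    using that assms unfolding eq by simp
  moreover have "?\<omega> ^ m = 1" if "m mod r = 0"
    unfolding eq that by simp
  ultimately show ?thesis unfolding dvd_eq_mod_eq_0 by (rule iffI)
qed

lemma mweight_profile:
  "finite X \<Longrightarrow> mweight \<zeta> (profile X F) = (\<Prod>x\<in>X. \<zeta> x ^ mdeg (F x))"
  by (simp add: profile_def mweight_sum)

lemma good_fillings_mu_tuples:
  assumes r: "r \<ge> 1"
  shows "good_fillings n (mu_tuples r n) \<tau> = {F \<in> fillings {1..n} \<tau>. \<forall>x\<in>{1..n}. r dvd mdeg (F x)}"
proof -
  let ?X = "{1..n}"
  have "(\<forall>\<zeta>\<in>mu_tuples r n. (\<Prod>x\<in>?X. \<zeta> x ^ mdeg (F x)) = 1) \<longleftrightarrow> (\<forall>x\<in>?X. r dvd mdeg (F x))" for F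
  proof safe
    fix x assume all: "\<forall>\<zeta>\<in>mu_tuples r n. (\<Prod>x\<in>?X. \<zeta> x ^ mdeg (F x)) = 1" and x: "x \<in> ?X"
    let ?\<omega> = "cis (2 * pi / of_nat r)"
    \<comment> \<open>A primitive root at \<open>x\<close> and 1 elsewhere isolates the degree of
      \<open>F x\<close>.\<close>
    define \<zeta> where "\<zeta> = (\<lambda>y\<in>?X. if y = x then ?\<omega> else 1)"
    have "\<zeta> \<in> mu_tuples r n"
      using primitive_root_power[OF r, of r] by (auto simp: \<zeta>_def mu_tuples_def)
    then have "1 = (\<Prod>y\<in>?X. \<zeta> y ^ mdeg (F y))"
      using all by simp
    also have "\<dots> = (\<Prod>y\<in>?X. if y = x then ?\<omega> ^ mdeg (F x) else 1)"
      by (intro prod.cong) (auto simp: \<zeta>_def)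
    also have "\<dots> = ?\<omega> ^ mdeg (F x)"
      using x by simp
    finally show "r dvd mdeg (F x)"
      using primitive_root_power[OF r, of "mdeg (F x)"] by simp
  next
    fix \<zeta> assume "\<forall>x\<in>?X. r dvd mdeg (F x)" and \<zeta>: "\<zeta> \<in> mu_tuples r n"
    then show "(\<Prod>x\<in>?X. \<zeta> x ^ mdeg (F x)) = 1"
      by (intro prod.neutral) (auto simp: mu_tuples_def PiE_def Pi_def power_mult elim!: dvdE)
  qed
  then show ?thesis
    by (simp add: good_fillings_def mweight_profile)
qed

lemma permute_filling_ball:
  assumes "\<sigma> permutes X"
  shows "(\<forall>x\<in>X. P (permute_filling X F \<sigma> x)) \<longleftrightarrow> (\<forall>x\<in>X. P (F x))"
proof -
  have "(\<forall>x\<in>X. P (F (\<sigma> x))) \<longleftrightarrow> (\<forall>x\<in>\<sigma> ` X. P (F x))"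
    by blast
  then show ?thesis
    by (simp add: permute_filling_def permutes_image[OF assms])
qed

text \<open>A multiset of nontrivial monomials with product \<tau> has at most
  \<open>mdeg \<tau>\<close> members, so it fits on \<open>n\<close> points.\<close>

lemma content_fillings_eq_all_msets:
  assumes S: "0 \<notin> S" and n: "mdeg \<tau> \<le> n"
  shows "filling_content {1..n} ` {F \<in> fillings {1..n} \<tau>. \<forall>x\<in>{1..n}. F x \<in> insert 0 S} = all_msets S \<tau>"
proof (intro equalityI subsetI)
  fix N assume "N \<in> filling_content {1..n} ` {F \<in> fillings {1..n} \<tau>. \<forall>x\<in>{1..n}. F x \<in> insert 0 S}"
  then obtain F where F: "F \<in> fillings {1..n} \<tau>" "\<forall>x\<in>{1..n}. F x \<in> insert 0 S" "N = filling_content {1..n} F"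
    by blast
  have "set_mset N \<subseteq> S"
    using F(2) unfolding F(3) set_mset_content[OF finite_atLeastAtMost] by blast
  then show "N \<in> all_msets S \<tau>"
    using sum_mset_content[OF F(1)] F(3) by (simp add: all_msets_def)
next
  fix N assume N: "N \<in> all_msets S \<tau>"
  then have 0: "0 \<notin># N" and sum: "\<Sum>\<^sub># N = \<tau>" and sub: "set_mset N \<subseteq> S"
    using S by (auto simp: all_msets_def)
  have "size N \<le> n"
    using size_le_mdeg_sum_mset[OF 0] sum n by simp
  moreover have "N \<in> all_msets (UNIV - {0}) \<tau>"
    using 0 sum by (auto simp: all_msets_def)
  ultimately obtain F where F: "F \<in> fillings {1..n} \<tau>" "filling_content {1..n} F = N"
    using content_surj[OF refl] by blast
  have "F x \<in> insert 0 S" if "x \<in> {1..n}" for x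
    using set_mset_content[of "{1..n}" F] sub that unfolding F(2) by blast
  then show "N \<in> filling_content {1..n} ` {F \<in> fillings {1..n} \<tau>. \<forall>x\<in>{1..n}. F x \<in> insert 0 S}"
    using F by blast
qed

lemma content_mult_fillings:
  assumes "mdeg \<tau> \<le> n"
  shows "filling_content {1..n} ` {F \<in> fillings {1..n} \<tau>. \<forall>x\<in>{1..n}. r dvd mdeg (F x)} =
    all_msets (mult_monoms r) \<tau>"
proof -
  have "r dvd mdeg \<alpha> \<longleftrightarrow> \<alpha> \<in> insert 0 (mult_monoms r)" for \<alpha>
    by (auto simp: mult_monoms_def)
  then show ?thesis
    using content_fillings_eq_all_msets[OF _ assms, of "mult_monoms r"]
    by (simp add: mult_monoms_def)
qed

lemma sigma_mgf_mu_tuples: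
  assumes sub: "subgroup H (sym_group n)" and tr: "k_transitive n k H" and r: "r \<ge> 1"
  shows "sym_cong k (sigma_mgf (gen_perm_group n (mu_tuples r n) H))
    (map_pser of_rat (Exp_sigma (psum {1..} (\<lambda>j. sym_h (j * r)))))"
  unfolding sym_cong_def
proof (intro allI impI, elim conjE)
  fix \<tau> assume \<tau>: "is_partition \<tau>" "mdeg \<tau> \<le> k"
  have n: "mdeg \<tau> \<le> n"
    using \<tau>(2) tr by (simp add: k_transitive_def)
  have "pcoeff (sigma_mgf (gen_perm_group n (mu_tuples r n) H)) \<tau> =
      of_nat (card (filling_content {1..n} ` good_fillings n (mu_tuples r n) \<tau>))"
    unfolding pcoeff_sigma_mgf[OF \<tau>(1)]
  proof (rule expectation_eq_card_content[OF tuple_group_mu_tuples[OF r] sub tr \<tau>(2)])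
    fix F \<sigma> assume "F \<in> good_fillings n (mu_tuples r n) \<tau>" "\<sigma> permutes {1..n}"
    then show "permute_filling {1..n} F \<sigma> \<in> good_fillings n (mu_tuples r n) \<tau>"
      unfolding good_fillings_mu_tuples[OF r]
      using permute_fillings permute_filling_ball[of \<sigma> "{1..n}" "\<lambda>\<alpha>. r dvd mdeg \<alpha>" F] by simp
  qed
  also have "\<dots> = of_nat (card (all_msets (mult_monoms r) \<tau>))"
    by (simp only: good_fillings_mu_tuples[OF r] content_mult_fillings[OF n])
  finally show "pcoeff (sigma_mgf (gen_perm_group n (mu_tuples r n) H)) \<tau> =
      pcoeff (map_pser of_rat (Exp_sigma (psum {1..} (\<lambda>j. sym_h (j * r))))) \<tau>"
    by (simp only: map_pser_def pcoeff_Abs pcoeff_Exp_sigma_multiples[OF r] of_rat_of_nat_eq)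
qed

section \<open>Sign tuples with product one\<close>

definition even_tuples :: "nat \<Rightarrow> (nat \<Rightarrow> complex) set" where
  "even_tuples n = {\<zeta> \<in> mu_tuples 2 n. (\<Prod>i\<in>{1..n}. \<zeta> i) = 1}"

lemma tuple_group_even_tuples: "tuple_group n (even_tuples n)"
proof -
  have mu: "tuple_group n (mu_tuples 2 n)"
    by (rule tuple_group_mu_tuples) simp
  have "(\<lambda>x\<in>{1..n}. 1) \<in> even_tuples n"
    by (auto simp: even_tuples_def mu_tuples_def)
  moreover have "(\<lambda>x\<in>{1..n}. \<chi> x * \<zeta> x) \<in> even_tuples n" if "\<chi> \<in> even_tuples n" "\<zeta> \<in> even_tuples n" for \<chi> \<zeta>
    using mu that by (auto simp: tuple_group_def even_tuples_def prod.distrib)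
  moreover have "finite (even_tuples n)" "even_tuples n \<subseteq> {1..n} \<rightarrow>\<^sub>E UNIV - {0}"
    using mu by (auto simp: tuple_group_def even_tuples_def)
  ultimately show ?thesis
    unfolding tuple_group_def by blast
qed

lemma good_fillings_even_tuples:
  "good_fillings n (even_tuples n) \<tau> = {F \<in> fillings {1..n} \<tau>.
     (\<forall>x\<in>{1..n}. even (mdeg (F x))) \<or> (\<forall>x\<in>{1..n}. odd (mdeg (F x)))}"
proof -
  let ?X = "{1..n}"
  have "(\<forall>\<zeta>\<in>even_tuples n. (\<Prod>x\<in>?X. \<zeta> x ^ mdeg (F x)) = 1) \<longleftrightarrow>
      (\<forall>x\<in>?X. even (mdeg (F x))) \<or> (\<forall>x\<in>?X. odd (mdeg (F x)))" for F
  proof (intro iffI)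
    assume all: "\<forall>\<zeta>\<in>even_tuples n. (\<Prod>x\<in>?X. \<zeta> x ^ mdeg (F x)) = 1"
    show "(\<forall>x\<in>?X. even (mdeg (F x))) \<or> (\<forall>x\<in>?X. odd (mdeg (F x)))"
    proof (rule ccontr)
      assume "\<not> ?thesis"
      then obtain x y where xy: "x \<in> ?X" "y \<in> ?X" "odd (mdeg (F x))" "even (mdeg (F y))" by blast
      let ?s = "\<lambda>x z. if z = x then - 1 else (1 :: complex)"
      \<comment> \<open>Signs -1 at two points of different parity have product 1, yet they weigh
        the filling by -1.\<close>
      define \<zeta> where "\<zeta> = (\<lambda>z\<in>?X. ?s x z * ?s y z)"
      have val: "(\<Prod>z\<in>?X. \<zeta> z ^ e z) = (- 1) ^ e x * (- 1) ^ e y" for e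
      proof -
        have "(\<Prod>z\<in>?X. \<zeta> z ^ e z) =
            (\<Prod>z\<in>?X. (if z = x then (- 1) ^ e x else 1) * (if z = y then (- 1) ^ e y else 1))"
          by (intro prod.cong) (auto simp: \<zeta>_def power_mult_distrib)
        also have "\<dots> = (- 1) ^ e x * (- 1) ^ e y"
          using xy by (simp add: prod.distrib)
        finally show ?thesis .
      qed
      have "\<zeta> \<in> even_tuples n"
        using val[of "\<lambda>_. 1"] by (auto simp: even_tuples_def mu_tuples_def \<zeta>_def)
      then have "(- 1) ^ mdeg (F x) * (- 1) ^ mdeg (F y) = (1 :: complex)"
        using all val[of "\<lambda>z. mdeg (F z)"] by simp
      then show False using xy by simp
    qed
  next
    assume par: "(\<forall>x\<in>?X. even (mdeg (F x))) \<or> (\<forall>x\<in>?X. odd (mdeg (F x)))"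
    show "\<forall>\<zeta>\<in>even_tuples n. (\<Prod>x\<in>?X. \<zeta> x ^ mdeg (F x)) = 1"
    proof
      fix \<zeta> assume \<zeta>: "\<zeta> \<in> even_tuples n"
      then have sq: "(\<zeta> x)\<^sup>2 = 1" if "x \<in> ?X" for x
        using that by (auto simp: even_tuples_def mu_tuples_def)
      from par show "(\<Prod>x\<in>?X. \<zeta> x ^ mdeg (F x)) = 1"
      proof
        assume "\<forall>x\<in>?X. even (mdeg (F x))"
        then show ?thesis
          using sq by (intro prod.neutral) (auto simp: power_mult elim!: evenE)
      next
        assume "\<forall>x\<in>?X. odd (mdeg (F x))"
        \<comment> \<open>In the odd case the weight collapses to the product of the signs, which is
          1 on this subgroup.\<close>
        then have "\<zeta> x ^ mdeg (F x) = \<zeta> x" if "x \<in> ?X" for x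
        proof -
          from \<open>\<forall>x\<in>?X. odd (mdeg (F x))\<close> that obtain m where "mdeg (F x) = 2 * m + 1"
            by (blast elim: oddE)
          then show ?thesis using sq[OF that] by (simp add: power_mult)
        qed
        then have "(\<Prod>x\<in>?X. \<zeta> x ^ mdeg (F x)) = (\<Prod>x\<in>?X. \<zeta> x)"
          by (intro prod.cong) auto
        then show ?thesis using \<zeta> by (simp add: even_tuples_def)
      qed
    qed
  qed
  then show ?thesis
    by (simp add: good_fillings_def mweight_profile)
qed

lemma mdeg_eq_1_iff: "mdeg \<alpha> = 1 \<longleftrightarrow> \<alpha> \<in> range (\<lambda>j. Poly_Mapping.single j 1)"
proof
  have "\<alpha> = 0 \<or> (\<exists>\<nu> i. \<alpha> = \<nu> + Poly_Mapping.single i 1)"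
    by (induction \<alpha> rule: monom_induct) auto
  moreover assume "mdeg \<alpha> = 1"
  ultimately show "\<alpha> \<in> range (\<lambda>j. Poly_Mapping.single j 1)"
    by auto
qed auto

text \<open>Odd degrees are at least 1 and sum to \<open>mdeg \<tau> \<le> n\<close> over
  \<open>n\<close> points, so all of them equal 1 and no point is trivial.\<close>

lemma content_odd_fillings:
  assumes n: "n \<ge> 1" "mdeg \<tau> \<le> n"
  shows "filling_content {1..n} ` {F \<in> fillings {1..n} \<tau>. \<forall>x\<in>{1..n}. odd (mdeg (F x))} =
    msets (range (\<lambda>j. Poly_Mapping.single j 1)) n \<tau>"
proof (intro equalityI subsetI)
  let ?X = "{1..n}"
  fix N assume "N \<in> filling_content ?X ` {F \<in> fillings ?X \<tau>. \<forall>x\<in>?X. odd (mdeg (F x))}"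
  then obtain F where F: "F \<in> fillings ?X \<tau>" "\<forall>x\<in>?X. odd (mdeg (F x))" "N = filling_content ?X F"
    by blast
  have pos: "mdeg (F x) \<ge> 1" if "x \<in> ?X" for x
    using F(2) that by (metis One_nat_def Suc_leI odd_pos)
  have one: "mdeg (F x) = 1" if x: "x \<in> ?X" for x
  proof (rule ccontr)
    assume "mdeg (F x) \<noteq> 1"
    then have "1 < mdeg (F x)"
      using pos[OF x] by linarith
    then have "(\<Sum>x\<in>?X. 1) < (\<Sum>x\<in>?X. mdeg (F x))"
      using pos x by (intro sum_strict_mono_ex1) blast+
    then show False
      using mdeg_fillings[OF F(1)] n by simp
  qed
  have nz: "F x \<noteq> 0" if "x \<in> ?X" for x
    using one[OF that] by auto
  have "N = image_mset F (mset_set ?X)"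
    unfolding F(3) filling_content_def by (subst filter_mset_eq_conv) (use nz in auto)
  then have "size N = n" "set_mset N \<subseteq> {\<alpha>. mdeg \<alpha> = 1}"
    using one by auto
  then show "N \<in> msets (range (\<lambda>j. Poly_Mapping.single j 1)) n \<tau>"
    using sum_mset_content[OF F(1)] unfolding F(3) msets_def mdeg_eq_1_iff Collect_mem_eq by simp
next
  let ?X = "{1..n}"
  fix N assume "N \<in> msets (range (\<lambda>j. Poly_Mapping.single j 1)) n \<tau>"
  then have N: "size N = n" "\<Sum>\<^sub># N = \<tau>" "\<And>\<alpha>. \<alpha> \<in># N \<Longrightarrow> mdeg \<alpha> = 1"
    unfolding mdeg_eq_1_iff by (auto simp: msets_def)
  have "N \<in> all_msets (UNIV - {0}) \<tau>"
    using N(2) N(3)[of 0] by (auto simp: all_msets_def)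
  then obtain F where F: "F \<in> fillings ?X \<tau>" "filling_content ?X F = N"
    using content_surj[OF refl, of N \<tau> n] N(1) by auto
  have "image_mset F (mset_set ?X) = N"
    using image_mset_eq_content[of ?X F] F(2) N(1) by simp
  then have "F x \<in># N" if "x \<in> ?X" for x
    using that by auto
  then have "odd (mdeg (F x))" if "x \<in> ?X" for x
    using N(3) that by simp
  then show "N \<in> filling_content ?X ` {F \<in> fillings ?X \<tau>. \<forall>x\<in>?X. odd (mdeg (F x))}"
    using F by blast
qed

lemma sym_group_k_transitive: "k_transitive n n (carrier (sym_group n))"
  unfolding k_transitive_def
proof (intro conjI allI impI order_refl)
  fix xs ys :: "nat list"
  assume *: "length xs = n \<and> distinct xs \<and> set xs \<subseteq> {1..n} \<and> length ys = n \<and> distinct ys \<and> set ys \<subseteq> {1..n}"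
  then have sets: "set xs = {1..n}" "set ys = {1..n}"
    using card_subset_eq[of "{1..n}" "set xs"] card_subset_eq[of "{1..n}" "set ys"]
    by (simp_all add: distinct_card)
  define \<sigma> where "\<sigma> x = (if x \<in> {1..n} then the (map_of (zip xs ys) x) else x)" for x
  have nth: "\<sigma> (xs ! i) = ys ! i" if "i < n" for i
  proof -
    have "xs ! i \<in> {1..n}" using * that sets by (metis nth_mem)
    then show ?thesis
      using * that by (simp add: \<sigma>_def map_of_zip_nth)
  qed
  then have map: "map \<sigma> xs = ys"
    using * by (intro nth_equalityI) auto
  have "bij_betw \<sigma> {1..n} {1..n}"
    using * map sets by (metis bij_betw_def distinct_map set_map)
  then have "\<sigma> permutes {1..n}"
    by (rule bij_imp_permutes) (auto simp: \<sigma>_def)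
  then show "\<exists>\<sigma>\<in>carrier (sym_group n). map \<sigma> xs = ys"
    using map by (auto simp: sym_group_carrier)
qed

lemma sigma_mgf_even_tuples:
  assumes n: "n \<ge> 1"
  shows "sym_cong n (sigma_mgf (gen_perm_group n (even_tuples n) (carrier (sym_group n))))
    (map_pser of_rat (Exp_sigma (psum {1..} (\<lambda>j. sym_h (j * 2))) + sym_h n))"
  unfolding sym_cong_def
proof (intro allI impI, elim conjE)
  fix \<tau> assume \<tau>: "is_partition \<tau>" "mdeg \<tau> \<le> n"
  let ?X = "{1..n}"
  let ?S = "range (\<lambda>j. Poly_Mapping.single j 1) :: monom_exp set"
  let ?E = "\<lambda>F. \<forall>x\<in>?X. even (mdeg (F x))" and ?O = "\<lambda>F. \<forall>x\<in>?X. odd (mdeg (F x))"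
  have "pcoeff (sigma_mgf (gen_perm_group n (even_tuples n) (carrier (sym_group n)))) \<tau> =
      of_nat (card (filling_content ?X ` good_fillings n (even_tuples n) \<tau>))"
    unfolding pcoeff_sigma_mgf[OF \<tau>(1)]
  proof (rule expectation_eq_card_content[OF tuple_group_even_tuples _ sym_group_k_transitive \<tau>(2)])
    show "subgroup (carrier (sym_group n)) (sym_group n)"
      using group.subgroup_self[OF sym_group_is_group] .
    fix F \<sigma> assume "F \<in> good_fillings n (even_tuples n) \<tau>" "\<sigma> permutes ?X"
    then show "permute_filling ?X F \<sigma> \<in> good_fillings n (even_tuples n) \<tau>"
      unfolding good_fillings_even_tuples
      using permute_fillings permute_filling_ball[of \<sigma> ?X "\<lambda>\<alpha>. even (mdeg \<alpha>)" F]
        permute_filling_ball[of \<sigma> ?X "\<lambda>\<alpha>. odd (mdeg \<alpha>)" F] by simp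
  qed
  also have "good_fillings n (even_tuples n) \<tau> = {F \<in> fillings ?X \<tau>. ?E F} \<union> {F \<in> fillings ?X \<tau>. ?O F}"
    unfolding good_fillings_even_tuples by blast
  also have "filling_content ?X ` \<dots> = all_msets (mult_monoms 2) \<tau> \<union> msets ?S n \<tau>"
    unfolding image_Un content_mult_fillings[OF \<tau>(2)] content_odd_fillings[OF n \<tau>(2)] ..
  also have "card \<dots> = card (all_msets (mult_monoms 2) \<tau>) + card (msets ?S n \<tau>)"
  proof (rule card_Un_disjoint)
    show "finite (all_msets (mult_monoms 2) \<tau>)"
      by (rule finite_all_msets) (simp add: mult_monoms_def)
    have False if "M \<in> all_msets (mult_monoms 2) \<tau>" "M \<in> msets ?S n \<tau>" for M
    proof -
      \<comment> \<open>For \<open>n = 0\<close> the empty multiset would be counted on both sides;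
        \<open>n \<ge> 1\<close> excludes it.\<close>
      have "M \<noteq> {#}"
        using that(2) n by (auto simp: msets_def)
      then obtain \<alpha> where \<alpha>: "\<alpha> \<in># M" by blast
      then have "mdeg \<alpha> = 1" "even (mdeg \<alpha>)"
        using that unfolding mdeg_eq_1_iff by (auto simp: all_msets_def msets_def mult_monoms_def)
      then show False by simp
    qed
    then show "all_msets (mult_monoms 2) \<tau> \<inter> msets ?S n \<tau> = {}" by blast
  qed simp
  also have "of_nat \<dots> = (of_rat (of_nat (card (all_msets (mult_monoms 2) \<tau>)) + of_nat (card (msets ?S n \<tau>))) :: complex)"
    by (simp only: of_nat_add [symmetric] of_rat_of_nat_eq)
  also have "of_nat (card (msets ?S n \<tau>)) = pcoeff (sym_h n :: rat pser) \<tau>"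
    unfolding mset_ser_singles [symmetric] by (simp only: mset_ser_def pcoeff_Abs)
  finally show "pcoeff (sigma_mgf (gen_perm_group n (even_tuples n) (carrier (sym_group n)))) \<tau> =
      pcoeff (map_pser of_rat (Exp_sigma (psum {1..} (\<lambda>j. sym_h (j * 2))) + sym_h n)) \<tau>"
    by (simp only: map_pser_def pcoeff_Abs pcoeff_add pcoeff_Exp_sigma_multiples[OF one_le_numeral])
qed


section \<open>The Weyl group of type D\<close>

lemma gen_perm_mat_cong:
  assumes "\<And>x. x \<in> {1..n} \<Longrightarrow> \<zeta> x = \<xi> x" "\<And>x. x \<in> {1..n} \<Longrightarrow> \<sigma> x = \<rho> x"
  shows "gen_perm_mat n \<zeta> \<sigma> = gen_perm_mat n \<xi> \<rho>"
  by (rule eq_matI) (use assms in \<open>auto simp: gen_perm_mat_index carrier_matD[OF gen_perm_mat_carrier]\<close>)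

text \<open>The second factor acts first, and \<sigma> carries its weight at \<open>y\<close> to row
  \<sigma> y. Prescribing \<theta> at the points \<sigma> y avoids the inverse permutation.\<close>

lemma gen_perm_mat_mult:
  assumes \<sigma>: "\<sigma> permutes {1..n}" and \<rho>: "\<rho> permutes {1..n}"
    and \<theta>: "\<And>y. y \<in> {1..n} \<Longrightarrow> \<theta> (\<sigma> y) = \<zeta> (\<sigma> y) * \<xi> y"
  shows "gen_perm_mat n \<zeta> \<sigma> * gen_perm_mat n \<xi> \<rho> = gen_perm_mat n \<theta> (\<sigma> \<circ> \<rho>)"
proof (rule eq_matI)
  note dims = carrier_matD[OF gen_perm_mat_carrier]
  fix i j assume "i < dim_row (gen_perm_mat n \<theta> (\<sigma> \<circ> \<rho>))" "j < dim_col (gen_perm_mat n \<theta> (\<sigma> \<circ> \<rho>))"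
  then have ij: "i < n" "j < n"
    by (simp_all only: dims)
  have "\<rho> (Suc j) \<in> {1..n}"
    using ij by (subst permutes_in_image[OF \<rho>]) auto
  then obtain c where c: "\<rho> (Suc j) = Suc c" "c < n"
    by (cases "\<rho> (Suc j)") auto
  have "(gen_perm_mat n \<zeta> \<sigma> * gen_perm_mat n \<xi> \<rho>) $$ (i, j) =
      (\<Sum>l<n. gen_perm_mat n \<zeta> \<sigma> $$ (i, l) * gen_perm_mat n \<xi> \<rho> $$ (l, j))"
    using ij by (simp add: scalar_prod_def lessThan_atLeast0 dims)
  also have "\<dots> = (\<Sum>l<n. if l = c then gen_perm_mat n \<zeta> \<sigma> $$ (i, c) * \<xi> (Suc c) else 0)"
    using ij by (intro sum.cong) (auto simp: gen_perm_mat_index c)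
  also have "\<dots> = gen_perm_mat n \<zeta> \<sigma> $$ (i, c) * \<xi> (Suc c)"
    using c by simp
  also have "\<dots> = gen_perm_mat n \<theta> (\<sigma> \<circ> \<rho>) $$ (i, j)"
    using ij c \<theta>[of "Suc c"] by (auto simp: gen_perm_mat_index)
  finally show "(gen_perm_mat n \<zeta> \<sigma> * gen_perm_mat n \<xi> \<rho>) $$ (i, j) = gen_perm_mat n \<theta> (\<sigma> \<circ> \<rho>) $$ (i, j)" .
qed (simp_all add: carrier_matD[OF gen_perm_mat_carrier])

lemma gen_perm_mat_one: "gen_perm_mat n (\<lambda>_. 1) id = 1\<^sub>m n"
  by (rule eq_matI) (auto simp: gen_perm_mat_index carrier_matD[OF gen_perm_mat_carrier])

section \<open>Reflections in the roots\<close>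

definition pair_tuple :: "nat \<Rightarrow> nat \<Rightarrow> complex \<Rightarrow> nat \<Rightarrow> complex" where
  "pair_tuple x y c z = (if z = x \<or> z = y then c else 1)"

text \<open>By \<open>reflection_mat_D_root\<close>, \<open>c = 1\<close> belongs to the root e_x -
  e_y and \<open>c = -1\<close> to e_x + e_y.\<close>

definition pair_refl :: "nat \<Rightarrow> nat \<Rightarrow> nat \<Rightarrow> complex \<Rightarrow> complex mat" where
  "pair_refl n x y c = gen_perm_mat n (pair_tuple x y c) (Transposition.transpose x y)"

lemma pair_refl_commute: "pair_refl n x y c = pair_refl n y x c"
  by (simp add: pair_refl_def pair_tuple_def[abs_def] disj_commute transpose_commute)

text \<open>All roots have squared length 2, so the entries of the reflection are those of 1 - v
  v^T: the diagonal entries at i and j cancel, and -(a * b) appears off the diagonal.\<close>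

lemma reflection_mat_D_root:
  assumes "i < j" "j < n" "a \<in> {1, -1}" "b \<in> {1, -1}"
  shows "reflection_mat n (a \<cdot>\<^sub>v unit_vec n i + b \<cdot>\<^sub>v unit_vec n j) = pair_refl n (Suc i) (Suc j) (- (a * b))"
proof (rule eq_matI)
  let ?v = "a \<cdot>\<^sub>v unit_vec n i + b \<cdot>\<^sub>v unit_vec n j"
  have v: "?v $ l = (if l = i then a else if l = j then b else 0)" if "l < n" for l
    using that assms by auto
  have "?v \<bullet> ?v = (\<Sum>l<n. ?v $ l * ?v $ l)"
    by (simp add: scalar_prod_def lessThan_atLeast0)
  also have "\<dots> = (\<Sum>l<n. (if l = i then a * a else 0) + (if l = j then b * b else 0))"
    using assms(1) by (intro sum.cong refl) (subst (1 2) v, auto)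
  also have "\<dots> = 2"
    using assms by (auto simp: sum.distrib)
  finally have vv: "?v \<bullet> ?v = 2" .
  fix p q assume "p < dim_row (pair_refl n (Suc i) (Suc j) (- (a * b)))"
    "q < dim_col (pair_refl n (Suc i) (Suc j) (- (a * b)))"
  then have pq: "p < n" "q < n"
    by (simp_all only: pair_refl_def carrier_matD[OF gen_perm_mat_carrier])
  have "reflection_mat n ?v $$ (p, q) = (if p = q then 1 else 0) - ?v $ p * ?v $ q"
    using pq by (simp add: reflection_mat_def vv del: index_add_vec index_smult_vec)
  also have "\<dots> = pair_refl n (Suc i) (Suc j) (- (a * b)) $$ (p, q)"
    unfolding v[OF pq(1)] v[OF pq(2)] pair_refl_def gen_perm_mat_index[OF pq]
    using assms by (auto simp: pair_tuple_def transpose_def)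
  finally show "reflection_mat n ?v $$ (p, q) = pair_refl n (Suc i) (Suc j) (- (a * b)) $$ (p, q)" .
qed (simp_all add: reflection_mat_def pair_refl_def carrier_matD[OF gen_perm_mat_carrier])

lemma reflections_D: "reflection_mat n ` D_roots n =
    {pair_refl n x y c | x y c. x \<in> {1..n} \<and> y \<in> {1..n} \<and> x \<noteq> y \<and> c \<in> {1, -1}}"
proof (intro equalityI subsetI)
  fix A assume "A \<in> reflection_mat n ` D_roots n"
  then obtain a b i j where *: "a \<in> {1, -1}" "b \<in> {1, -1}" "i < j" "j < n"
      "A = reflection_mat n (a \<cdot>\<^sub>v unit_vec n i + b \<cdot>\<^sub>v unit_vec n j)"
    unfolding D_roots_def by blast
  have "A = pair_refl n (Suc i) (Suc j) (- (a * b))"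
    unfolding *(5) using * by (intro reflection_mat_D_root)
  moreover have "- (a * b) \<in> {1, -1}" "Suc i \<in> {1..n}" "Suc j \<in> {1..n}" "Suc i \<noteq> Suc j"
    using * by auto
  ultimately show "A \<in> {pair_refl n x y c | x y c. x \<in> {1..n} \<and> y \<in> {1..n} \<and> x \<noteq> y \<and> c \<in> {1, -1}}"
    by blast
next
  have mem: "pair_refl n (Suc i) (Suc j) c \<in> reflection_mat n ` D_roots n"
    if "i < j" "j < n" "c \<in> {1, -1}" for i j c
  proof -
    have "pair_refl n (Suc i) (Suc j) c = reflection_mat n (1 \<cdot>\<^sub>v unit_vec n i + (- c) \<cdot>\<^sub>v unit_vec n j)"
      using reflection_mat_D_root[OF that(1,2), of 1 "- c"] that(3) by auto
    moreover have "1 \<cdot>\<^sub>v unit_vec n i + (- c) \<cdot>\<^sub>v unit_vec n j \<in> D_roots n"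
    proof -
      have "1 \<in> {1, -1 :: complex}" "- c \<in> {1, -1}"
        using that(3) by auto
      then show ?thesis
        unfolding D_roots_def using that(1,2) by blast
    qed
    ultimately show ?thesis by blast
  qed
  fix A assume "A \<in> {pair_refl n x y c | x y c. x \<in> {1..n} \<and> y \<in> {1..n} \<and> x \<noteq> y \<and> c \<in> {1, -1}}"
  then obtain x y c where A: "A = pair_refl n x y c" and *: "x \<in> {1..n}" "y \<in> {1..n}" "x \<noteq> y" "c \<in> {1, -1}"
    by blast
  from *(1,2) obtain i j where ij: "x = Suc i" "y = Suc j" "i < n" "j < n"
    by (cases x; cases y) auto
  show "A \<in> reflection_mat n ` D_roots n"
  proof (cases "i < j")
    case True
    then show ?thesis using mem ij * by (simp add: A)
  next
    case False
    then have "j < i" using ij * by simp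
    then show ?thesis
      using mem ij * unfolding A pair_refl_commute[of n x y] by simp
  qed
qed

lemma GL_simps: "mult (GL n) A B = A * B" "one (GL n) = 1\<^sub>m n"
  by (simp_all add: GL_def units_of_def ring_mat_def)

lemma group_GL: "group (GL n)"
  unfolding GL_def by (rule monoid.units_group) (rule ring.is_monoid[OF ring_mat])

text \<open>Serves the inverse rule of \<open>generate\<close>: reflections are their own
  inverses.\<close>

lemma GL_involution:
  assumes "A \<in> carrier_mat n n" "A * A = 1\<^sub>m n"
  shows "A \<in> carrier (GL n)" "inv\<^bsub>GL n\<^esub> A = A"
proof -
  show A: "A \<in> carrier (GL n)"
    using assms by (auto simp: GL_def units_of_def Units_def ring_mat_def)
  show "inv\<^bsub>GL n\<^esub> A = A"
    by (rule group.inv_equality[OF group_GL _ A A]) (simp add: GL_simps assms)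
qed

lemma transpose_permutes: "x \<in> X \<Longrightarrow> y \<in> X \<Longrightarrow> Transposition.transpose x y permutes X"
  by (rule permutes_swap_id)

lemma prod_pair_tuple:
  assumes "x \<in> {1..n}" "y \<in> {1..n}" "x \<noteq> y"
  shows "(\<Prod>z\<in>{1..n}. pair_tuple x y c z) = c * c"
proof -
  have "(\<Prod>z\<in>{1..n}. pair_tuple x y c z) =
      (\<Prod>z\<in>{1..n}. (if z = x then c else 1) * (if z = y then c else 1))"
    using assms(3) by (intro prod.cong) (auto simp: pair_tuple_def)
  then show ?thesis
    using assms by (simp add: prod.distrib)
qed

lemma pair_refl_square:
  assumes "x \<in> {1..n}" "y \<in> {1..n}" "x \<noteq> y" "c \<in> {1, -1}"
  shows "pair_refl n x y c * pair_refl n x y c = 1\<^sub>m n"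
proof -
  have "pair_refl n x y c * pair_refl n x y c =
      gen_perm_mat n (\<lambda>_. 1) (Transposition.transpose x y \<circ> Transposition.transpose x y)"
    unfolding pair_refl_def
    using assms by (intro gen_perm_mat_mult transpose_permutes) (auto simp: pair_tuple_def transpose_def)
  then show ?thesis by (simp add: gen_perm_mat_one)
qed

lemma mem_gen_perm_groupI:
  assumes "\<sigma> permutes {1..n}" "\<And>x. x \<in> {1..n} \<Longrightarrow> \<zeta> x ^ 2 = 1" "(\<Prod>x\<in>{1..n}. \<zeta> x) = 1"
  shows "gen_perm_mat n \<zeta> \<sigma> \<in> gen_perm_group n (even_tuples n) (carrier (sym_group n))"
proof -
  have "restrict \<zeta> {1..n} \<in> even_tuples n"
    using assms(2,3) by (auto simp: even_tuples_def mu_tuples_def)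
  moreover have "gen_perm_mat n \<zeta> \<sigma> = gen_perm_mat n (restrict \<zeta> {1..n}) \<sigma>"
    by (rule gen_perm_mat_cong) auto
  ultimately show ?thesis
    using assms(1) unfolding gen_perm_group_def gen_perm_mat_def sym_group_carrier by blast
qed

lemma mem_gen_perm_groupE:
  assumes "A \<in> gen_perm_group n (even_tuples n) (carrier (sym_group n))"
  obtains \<zeta> \<sigma> where "A = gen_perm_mat n \<zeta> \<sigma>" "\<sigma> permutes {1..n}" "\<zeta> \<in> even_tuples n"
  using assms unfolding gen_perm_group_def gen_perm_mat_def sym_group_carrier by blast

lemma even_tuplesD:
  assumes "\<zeta> \<in> even_tuples n"
  shows "x \<in> {1..n} \<Longrightarrow> \<zeta> x ^ 2 = 1" "(\<Prod>x\<in>{1..n}. \<zeta> x) = 1"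
  using assms by (auto simp: even_tuples_def mu_tuples_def)

lemma gen_perm_group_mult_closed:
  assumes "A \<in> gen_perm_group n (even_tuples n) (carrier (sym_group n))"
    "B \<in> gen_perm_group n (even_tuples n) (carrier (sym_group n))"
  shows "A * B \<in> gen_perm_group n (even_tuples n) (carrier (sym_group n))"
proof -
  let ?X = "{1..n}"
  obtain \<zeta> \<sigma> where A: "A = gen_perm_mat n \<zeta> \<sigma>" and \<sigma>: "\<sigma> permutes ?X" and \<zeta>: "\<zeta> \<in> even_tuples n"
    using assms(1) by (rule mem_gen_perm_groupE)
  obtain \<xi> \<rho> where B: "B = gen_perm_mat n \<xi> \<rho>" and \<rho>: "\<rho> permutes ?X" and \<xi>: "\<xi> \<in> even_tuples n"
    using assms(2) by (rule mem_gen_perm_groupE)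
  let ?i = "Hilbert_Choice.inv \<sigma>"
  have i: "?i permutes ?X"
    using \<sigma> by (rule permutes_inv)
  have "A * B = gen_perm_mat n (\<lambda>x. \<zeta> x * \<xi> (?i x)) (\<sigma> \<circ> \<rho>)"
    unfolding A B by (rule gen_perm_mat_mult[OF \<sigma> \<rho>]) (simp add: permutes_inverses[OF \<sigma>])
  moreover have "(\<Prod>x\<in>?X. \<xi> (?i x)) = (\<Prod>x\<in>?X. \<xi> x)"
    by (rule prod.reindex_bij_betw[OF permutes_imp_bij[OF i]])
  then have "(\<Prod>x\<in>?X. \<zeta> x * \<xi> (?i x)) = 1"
    by (simp only: prod.distrib even_tuplesD(2)[OF \<zeta>] even_tuplesD(2)[OF \<xi>] mult_1)
  moreover have "(\<zeta> x * \<xi> (?i x)) ^ 2 = 1" if "x \<in> ?X" for x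
  proof -
    have "?i x \<in> ?X"
      using that by (simp only: permutes_in_image[OF i])
    then show ?thesis
      using even_tuplesD(1)[OF \<zeta> that] even_tuplesD(1)[OF \<xi>] by (simp add: power_mult_distrib)
  qed
  ultimately show ?thesis
    using permutes_compose[OF \<rho> \<sigma>] by (simp only: mem_gen_perm_groupI)
qed

text \<open>The reflections lie in the matrix group, which is closed under products. Conversely,
  reflections with \<open>c = 1\<close> are transpositions and generate the permutation matrices;
  two reflections in the same coordinates change a pair of signs, and pairs generate all even sign
  changes.\<close>

lemma weyl_D_eq: "weyl_D n = gen_perm_group n (even_tuples n) (carrier (sym_group n))"
proof (intro equalityI subsetI)
  let ?X = "{1..n}"
  let ?D = "gen_perm_group n (even_tuples n) (carrier (sym_group n))"
  have refl: "pair_refl n x y c \<in> ?D" "pair_refl n x y c \<in> carrier_mat n n"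
    if "x \<in> ?X" "y \<in> ?X" "x \<noteq> y" "c \<in> {1, -1}" for x y c
  proof -
    show "pair_refl n x y c \<in> ?D"
      unfolding pair_refl_def
    proof (rule mem_gen_perm_groupI)
      show "(\<Prod>z\<in>?X. pair_tuple x y c z) = 1"
        unfolding prod_pair_tuple[OF that(1-3)] using that(4) by auto
    qed (use that in \<open>auto simp: pair_tuple_def intro: transpose_permutes\<close>)
  qed (simp add: pair_refl_def)
  fix A assume "A \<in> weyl_D n"
  then have "A \<in> generate (GL n) (reflection_mat n ` D_roots n)"
    by (simp only: weyl_D_def)
  then show "A \<in> ?D"
  proof (induction rule: generate.induct)
    case one
    show ?case
      unfolding GL_simps gen_perm_mat_one [symmetric] by (rule mem_gen_perm_groupI) (auto simp: permutes_id)
  next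
    case (incl h)
    then show ?case unfolding reflections_D using refl(1) by blast
  next
    case (inv h)
    then obtain x y c where h: "h = pair_refl n x y c" and *: "x \<in> ?X" "y \<in> ?X" "x \<noteq> y" "c \<in> {1, -1}"
      unfolding reflections_D by blast
    have "inv\<^bsub>GL n\<^esub> h = h"
      unfolding h using refl(2)[OF *] pair_refl_square[OF *] by (rule GL_involution)
    then show ?case using refl(1)[OF *] h by simp
  next
    case (eng h1 h2)
    then show ?case unfolding GL_simps by (intro gen_perm_group_mult_closed)
  qed
next
  let ?X = "{1..n}"
  have mult: "A * B \<in> weyl_D n" if "A \<in> weyl_D n" "B \<in> weyl_D n" for A B
    using that generate.eng[of A "GL n" _ B] unfolding weyl_D_def GL_simps by blast
  have one: "gen_perm_mat n (\<lambda>_. 1) id \<in> weyl_D n"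
    using generate.one[of "GL n"] unfolding weyl_D_def gen_perm_mat_one GL_simps by blast
  have refl: "pair_refl n x y c \<in> weyl_D n" if "x \<in> ?X" "y \<in> ?X" "x \<noteq> y" "c \<in> {1, -1}" for x y c
    unfolding weyl_D_def by (rule generate.incl) (use that in \<open>unfold reflections_D, blast\<close>)
  have perms: "gen_perm_mat n (\<lambda>_. 1) \<sigma> \<in> weyl_D n" if "\<sigma> permutes ?X" for \<sigma>
    using that finite_atLeastAtMost[of 1 n]
  proof (induction rule: permutes_induct)
    case (swap a b p)
    have eq: "gen_perm_mat n (\<lambda>_. 1) (Transposition.transpose a b \<circ> p) =
        pair_refl n a b 1 * gen_perm_mat n (\<lambda>_. 1) p"
      unfolding pair_refl_def
      by (rule gen_perm_mat_mult [symmetric]) (use swap in \<open>auto simp: pair_tuple_def intro: transpose_permutes\<close>)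
    show ?case
      unfolding eq by (rule mult[OF refl[OF swap.hyps(1-3)] swap.IH]) simp
  qed (rule one)
  have pair: "gen_perm_mat n (pair_tuple a b (- 1)) id \<in> weyl_D n" if "a \<in> ?X" "b \<in> ?X" "a \<noteq> b" for a b
  proof -
    \<comment> \<open>The transpositions cancel, and the signs of the first factor remain.\<close>
    have "pair_refl n a b (- 1) * pair_refl n a b 1 =
        gen_perm_mat n (pair_tuple a b (- 1)) (Transposition.transpose a b \<circ> Transposition.transpose a b)"
      unfolding pair_refl_def
      using that by (intro gen_perm_mat_mult transpose_permutes) (auto simp: pair_tuple_def)
    then show ?thesis
      using mult[OF refl[OF that, of "- 1"] refl[OF that, of 1]] by simp
  qed
  have diag: "gen_perm_mat n \<zeta> id \<in> weyl_D n"
    if "\<And>x. x \<in> ?X \<Longrightarrow> \<zeta> x ^ 2 = 1" "(\<Prod>x\<in>?X. \<zeta> x) = 1" for \<zeta>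
    using that
  \<comment> \<open>Induction on the number of negative signs, removing two at a time.\<close>
  proof (induction "card {x \<in> ?X. \<zeta> x \<noteq> 1}" arbitrary: \<zeta> rule: less_induct)
    case less
    let ?N = "{x \<in> ?X. \<zeta> x \<noteq> 1}"
    have neg: "\<zeta> x = - 1" if "x \<in> ?N" for x
      using less.prems(1)[of x] that by (auto simp: power2_eq_1_iff)
    show ?case
    proof (cases "?N = {}")
      case True
      then have "gen_perm_mat n \<zeta> id = gen_perm_mat n (\<lambda>_. 1) id"
        by (intro gen_perm_mat_cong) auto
      then show ?thesis using one by simp
    next
      case False
      then obtain a where a: "a \<in> ?N" by blast
      \<comment> \<open>A single negative sign would make the product -1.\<close>
      have "\<exists>b\<in>?N. b \<noteq> a"
      proof (rule ccontr)
        assume "\<not> ?thesis"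
        then have "(\<Prod>x\<in>?X. \<zeta> x) = (\<Prod>x\<in>?X. if x = a then - 1 else 1)"
          using neg[OF a] by (intro prod.cong) auto
        then show False using less.prems(2) a by simp
      qed
      then obtain b where b: "b \<in> ?N" "b \<noteq> a" by blast
      define \<zeta>' where "\<zeta>' z = (if z = a \<or> z = b then 1 else \<zeta> z)" for z
      have fact: "\<zeta> z = pair_tuple a b (- 1) z * \<zeta>' z" for z
        using neg[OF a] neg[OF b(1)] by (simp add: \<zeta>'_def pair_tuple_def)
      have "gen_perm_mat n \<zeta>' id \<in> weyl_D n"
      proof (rule less.hyps)
        show "card {x \<in> ?X. \<zeta>' x \<noteq> 1} < card ?N"
          by (rule psubset_card_mono) (use a in \<open>auto simp: \<zeta>'_def\<close>)
        show "\<zeta>' x ^ 2 = 1" if "x \<in> ?X" for x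
          using less.prems(1)[OF that] by (simp add: \<zeta>'_def)
        have "(\<Prod>x\<in>?X. \<zeta> x) = (\<Prod>x\<in>?X. pair_tuple a b (- 1) x) * (\<Prod>x\<in>?X. \<zeta>' x)"
          unfolding prod.distrib [symmetric] using fact by simp
        then show "(\<Prod>x\<in>?X. \<zeta>' x) = 1"
          using less.prems(2) a b prod_pair_tuple[of a n b "- 1"] by simp
      qed
      moreover have "gen_perm_mat n \<zeta> id = gen_perm_mat n (pair_tuple a b (- 1)) id * gen_perm_mat n \<zeta>' id"
        using gen_perm_mat_mult[of id n id \<zeta> "pair_tuple a b (- 1)" \<zeta>'] fact by (simp add: permutes_id)
      ultimately show ?thesis
        using mult pair[of a b] a b by simp
    qed
  qed
  fix A assume "A \<in> gen_perm_group n (even_tuples n) (carrier (sym_group n))"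
  then obtain \<zeta> \<sigma> where A: "A = gen_perm_mat n \<zeta> \<sigma>" and \<sigma>: "\<sigma> permutes ?X" and \<zeta>: "\<zeta> \<in> even_tuples n"
    by (rule mem_gen_perm_groupE)
  have "A = gen_perm_mat n \<zeta> id * gen_perm_mat n (\<lambda>_. 1) \<sigma>"
    unfolding A using gen_perm_mat_mult[of id n \<sigma> \<zeta> \<zeta> "\<lambda>_. 1"] \<sigma> by (simp add: permutes_id)
  then show "A \<in> weyl_D n"
    using mult[OF diag[OF even_tuplesD[OF \<zeta>]] perms[OF \<sigma>]] by simp
qed

theorem theorem2:
  shows
    "(\<forall>(n::nat) (k::nat) (r::nat) (H :: (nat \<Rightarrow> nat) set).
        subgroup H (sym_group n) \<and> k_transitive n k H \<and> r \<ge> 1 \<longrightarrow>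
        sym_cong k
          (sigma_mgf (gen_perm_group n (mu_tuples r n) H))
          (map_pser of_rat (Exp_sigma (psum {1..} (\<lambda>j. sym_h (j * r)))))) \<and>
     (\<forall>n::nat. n \<ge> 1 \<longrightarrow>
        weyl_D n = gen_perm_group n {\<zeta> \<in> mu_tuples 2 n. (\<Prod>i\<in>{1..n}. \<zeta> i) = 1}
                     (carrier (sym_group n)) \<and>
        sym_cong n
          (sigma_mgf (weyl_D n))
          (map_pser of_rat (Exp_sigma (psum {1..} (\<lambda>j. sym_h (j * 2))) + sym_h n)))"
  using sigma_mgf_mu_tuples sigma_mgf_even_tuples weyl_D_eq
  by (simp only: even_tuples_def) blast

end
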